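(* Let $M$ be a smooth manifold and let $L\subset\mathbb{T}_{\mathbb{C}}M$ be a generalized complex structure, with corresponding endomorphism $$J=\begin{bmatrix}a&\pi^\sharp\\ \omega^\sharp&-a^*\end{bmatrix}:TM\oplus T^*M\to TM\oplus T^*M,\qquad L=\{J(s)+is\mid s\in\mathbb{T}M\},$$ where $a:TM\to TM$ is a bundle map, $\pi\in\mathfrak{X}^2(M)$ and $\omega\in\Omega^2(M)$. Then $$L\star\mathcal{R}_{-1}(\overline{L})=\mathrm{Gr}\left(\tfrac{1}{2i}\pi\right),\qquad L\circledast\mathcal{R}_{-1}(\overline{L})=\mathrm{Gr}\left(\tfrac{1}{2i}\omega\right).$$ In particular, $L$ and $\overline{L}$ concur weakly if and only if $\mathrm{d}\omega=0$. Therefore the following conditions are equivalent: (i) $J$ concurs with its conjugate $\overline{J}=-J$ (that is, $L$ and $\overline{L}$ concur); (ii) $(\pi,a)$ is a $PN$-structure and $(\omega,a)$ is an $\Omega N$-structure.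
   Context: Let $\mathbb{T}M=TM\oplus T^*M$ with pairing $\langle u+\xi,v+\eta\rangle=\xi(v)+\eta(u)$ and Dorfman bracket $[u+\xi,v+\eta]=[u,v]+\mathscr{L}_u\eta-\iota_v\mathrm{d}\xi$, and let $\mathbb{T}_{\mathbb{C}}M=\mathbb{T}M\otimes\mathbb{C}$ with their $\mathbb{C}$-bilinear extensions and projections $\mathrm{pr}_T,\mathrm{pr}_{T^*}$. A complex Lagrangian family is a subset $L\subset\mathbb{T}_{\mathbb{C}}M$ meeting each fibre in a complex subspace $L_x=L_x^\perp$ (no continuity assumed). It is involutive if $\langle[s_1,s_2],s_3\rangle=0$ for all smooth local sections $s_1,s_2,s_3$ of $L$; a complex Dirac structure is an involutive complex Lagrangian family which is a vector subbundle. A generalized complex structure is a complex Dirac structure $L$ with $L\oplus\overline{L}=\mathbb{T}_{\mathbb{C}}M$; equivalently $L$ is the $+i$-eigenbundle $\{J(s)+is\}$ of a $\langle\cdot,\cdot\rangle$-orthogonal $J:\mathbb{T}M\to\mathbb{T}M$ with $J^2=-\mathrm{id}$, which then has the displayed block form, with $a^2+\pi^\sharp\omega^\sharp=-\mathrm{id}$, $a^*\omega^\sharp=\omega^\sharp a$, $a\pi^\sharp=\pi^\sharp a^*$. Here $\pi^\sharp(\xi)=\iota_\xi\pi$ and $\omega^\sharp(u)=\iota_u\omega$. Operations: $\mathcal{R}_{-1}(u+\xi)=-u+\xi$; $\mathrm{Gr}(\pi)=\{\pi^\sharp(\xi)+\xi\}$ and $\mathrm{Gr}(\omega)=\{u+\omega^\sharp(u)\}$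 for complex bivectors and two-forms; $L\star R=\{s+\mathrm{pr}_{T^*}(t)\mid(s,t)\in L\times R\text{ in the same fibre},\ \mathrm{pr}_T(s)=\mathrm{pr}_T(t)\}$; $L\circledast R=\{s+\mathrm{pr}_T(t)\mid(s,t)\in L\times R\text{ in the same fibre},\ \mathrm{pr}_{T^*}(s)=\mathrm{pr}_{T^*}(t)\}$. Complex Dirac structures $L,R$ concur if $L\circledast R$ is a complex Dirac structure, and concur weakly if $L\circledast R$ is involutive. Nijenhuis endomorphisms: for $a:TM\to TM$ put $[u,v]^a=[a(u),v]+[u,a(v)]-a[u,v]$; $a$ is Nijenhuis if $a[u,v]^a=[a(u),a(v)]$ for all vector fields $u,v$. $PN$-structure: $(\pi,a)$ with $\pi$ Poisson, $a$ Nijenhuis, $\pi(a^*\xi,\eta)=\pi(\xi,a^*\eta)$ for all one-forms, and vanishing concomitant $a^*\big(\mathscr{L}_{\pi^\sharp(\xi)}\eta-\iota_{\pi^\sharp(\eta)}\mathrm{d}\xi\big)-\big(\mathscr{L}_{\pi^\sharp(\xi)}(a^*\eta)-\iota_{\pi^\sharp(\eta)}\mathrm{d}(a^*\xi)\big)=0$ for all $\xi,\eta\in\Omega^1(M)$. $\Omega N$-structure: $(\omega,a)$ with $\omega$ closed, $a$ Nijenhuis, $\omega(a(u),v)=\omega(u,a(v))$ for all vector fields, and vanishing concomitant $[a(u),\omega^\sharp(v)]+[\omega^\sharp(u),a(v)]-\omega^\sharp[u,v]^a+a^*[u,v]^\omega=0$ for all $u,v\in\mathfrak{X}(M)$, the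 first two brackets being Dorfman brackets and $[u,v]^\omega=[\omega^\sharp(u),v]+[u,\omega^\sharp(v)]-\omega^\sharp[u,v]=\iota_v\iota_u\mathrm{d}\omega$. *)

theory Defs
  imports "HOL-Analysis.Analysis" "HOL-Library.Function_Algebras"
begin

section \<open>Smooth maps and smooth manifolds\<close>

fun times_differentiable_on ::
  "nat \<Rightarrow> 'a::real_normed_vector set \<Rightarrow> ('a \<Rightarrow> 'b::real_normed_vector) \<Rightarrow> bool" where
  "times_differentiable_on 0 S f \<longleftrightarrow> continuous_on S f"
| "times_differentiable_on (Suc k) S f \<longleftrightarrow>
     (\<forall>x\<in>S. f differentiable (at x)) \<and>
     (\<forall>v. times_differentiable_on k S (\<lambda>x. frechet_derivative f (at x) v))"

text \<open>Meaningful for open \<open>S\<close>.\<close>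

definition smooth_on :: "'a::real_normed_vector set \<Rightarrow> ('a \<Rightarrow> 'b::real_normed_vector) \<Rightarrow> bool" where
  "smooth_on S f \<longleftrightarrow> (\<forall>k. times_differentiable_on k S f)"

text \<open>A chart is a pair of a domain and a coordinate map; the values of the coordinate map
  outside the domain are irrelevant.\<close>

type_synonym ('m, 'n) chart = "'m set \<times> ('m \<Rightarrow> (real, 'n) vec)"

record ('m, 'n) manifold =
  mtop :: "'m topology"
  atlas :: "('m, 'n) chart set"

abbreviation points :: "('m, 'n) manifold \<Rightarrow> 'm set" where
  "points M \<equiv> topspace (mtop M)"

definition chart_inv :: "('m, 'n::finite) chart \<Rightarrow> real^'n \<Rightarrow> 'm" where
  "chart_inv \<phi> = inv_into (fst \<phi>) (snd \<phi>)"

definition is_chart :: "'m topology \<Rightarrow> ('m, 'n::finite) chart \<Rightarrow> bool" where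
  "is_chart X \<phi> \<longleftrightarrow> openin X (fst \<phi>) \<and> open (snd \<phi> ` fst \<phi>) \<and>
     homeomorphic_map (subtopology X (fst \<phi>)) (top_of_set (snd \<phi> ` fst \<phi>)) (snd \<phi>)"

definition smooth_manifold :: "('m, 'n::finite) manifold \<Rightarrow> bool" where
  "smooth_manifold M \<longleftrightarrow>
     Hausdorff_space (mtop M) \<and> second_countable (mtop M) \<and>
     (\<forall>\<phi>\<in>atlas M. is_chart (mtop M) \<phi>) \<and>
     (\<Union>\<phi>\<in>atlas M. fst \<phi>) = points M \<and>
     (\<forall>\<phi>\<in>atlas M. \<forall>\<psi>\<in>atlas M.
        smooth_on (snd \<phi> ` (fst \<phi> \<inter> fst \<psi>)) (snd \<psi> \<circ> chart_inv \<phi>))"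

definition charts_at :: "('m, 'n::finite) manifold \<Rightarrow> 'm \<Rightarrow> ('m, 'n) chart set" where
  "charts_at M x = {\<phi> \<in> atlas M. x \<in> fst \<phi>}"

text \<open>The \<open>i\<close>-th partial derivative at \<open>x\<close> in the coordinates \<open>\<phi>\<close>.\<close>

definition pd :: "('m, 'n::finite) chart \<Rightarrow> 'n \<Rightarrow> ('m \<Rightarrow> 'b::real_normed_vector) \<Rightarrow> 'm \<Rightarrow> 'b" where
  "pd \<phi> i f x = frechet_derivative (f \<circ> chart_inv \<phi>) (at (snd \<phi> x)) (axis i 1)"

definition jacobian :: "('m, 'n::finite) chart \<Rightarrow> ('m, 'n) chart \<Rightarrow> 'm \<Rightarrow> real^'n^'n" where
  "jacobian \<phi> \<psi> x = (\<chi> j i. pd \<phi> i (\<lambda>y. snd \<psi> y $ j) x)"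


section \<open>Tensors and their components\<close>

text \<open>A tangent or cotangent vector at \<open>x\<close> is the collection of its components in all the charts
  around \<open>x\<close>, related by the usual transformation law (and set to zero at the other charts, so that
  equality of functions is equality of vectors). The components lie in \<open>'k\<close>: with \<open>'k = real\<close> one
  obtains \<open>TM\<close> and \<open>T*M\<close>, and with \<open>'k = complex\<close> their complexifications. Likewise, endomorphisms,
  bivectors and two-forms are given by their component matrices.\<close>

type_synonym ('m, 'n, 'k) comps = "('m, 'n) chart \<Rightarrow> ('k, 'n) vec"
type_synonym ('m, 'n, 'k) mcomps = "('m, 'n) chart \<Rightarrow> (('k, 'n) vec, 'n) vec"
type_synonym ('m, 'n, 'k) gcomps = "('m, 'n, 'k) comps \<times> ('m, 'n, 'k) comps"

definition tangent_at ::
  "('m, 'n::finite) manifold \<Rightarrow> 'm \<Rightarrow> ('m, 'n, 'k::real_normed_field) comps set" where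
  "tangent_at M x = {u. (\<forall>\<phi>. \<phi> \<notin> charts_at M x \<longrightarrow> u \<phi> = 0) \<and>
     (\<forall>\<phi>\<in>charts_at M x. \<forall>\<psi>\<in>charts_at M x.
        u \<psi> = map_matrix of_real (jacobian \<phi> \<psi> x) *v u \<phi>)}"

definition cotangent_at ::
  "('m, 'n::finite) manifold \<Rightarrow> 'm \<Rightarrow> ('m, 'n, 'k::real_normed_field) comps set" where
  "cotangent_at M x = {\<xi>. (\<forall>\<phi>. \<phi> \<notin> charts_at M x \<longrightarrow> \<xi> \<phi> = 0) \<and>
     (\<forall>\<phi>\<in>charts_at M x. \<forall>\<psi>\<in>charts_at M x.
        \<xi> \<phi> = \<xi> \<psi> v* map_matrix of_real (jacobian \<phi> \<psi> x))}"

text \<open>The fibre of \<open>TM \<oplus> T*M\<close>, respectively of its complexification.\<close>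

definition gtangent_at ::
  "('m, 'n::finite) manifold \<Rightarrow> 'm \<Rightarrow> ('m, 'n, 'k::real_normed_field) gcomps set" where
  "gtangent_at M x = tangent_at M x \<times> cotangent_at M x"

definition smooth_comps ::
  "('m, 'n::finite) manifold \<Rightarrow> 'm set \<Rightarrow> ('m \<Rightarrow> ('m, 'n) chart \<Rightarrow> 'b::real_normed_vector) \<Rightarrow> bool" where
  "smooth_comps M U s \<longleftrightarrow>
     (\<forall>\<phi>\<in>atlas M. smooth_on (snd \<phi> ` (U \<inter> fst \<phi>)) (\<lambda>y. s (chart_inv \<phi> y) \<phi>))"

definition vector_field ::
  "('m, 'n::finite) manifold \<Rightarrow> ('m \<Rightarrow> ('m, 'n, real) comps) \<Rightarrow> bool" where
  "vector_field M u \<longleftrightarrow> (\<forall>x\<in>points M. u x \<in> tangent_at M x) \<and> smooth_comps M (points M) u"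

definition one_form ::
  "('m, 'n::finite) manifold \<Rightarrow> ('m \<Rightarrow> ('m, 'n, real) comps) \<Rightarrow> bool" where
  "one_form M \<xi> \<longleftrightarrow> (\<forall>x\<in>points M. \<xi> x \<in> cotangent_at M x) \<and> smooth_comps M (points M) \<xi>"

text \<open>The matrix \<open>P x \<phi>\<close> of a bivector or two-form has the entries \<open>P(e\<^sub>i, e\<^sub>j)\<close>, and that of an
  endomorphism acts on columns.\<close>

definition endomorphism_field ::
  "('m, 'n::finite) manifold \<Rightarrow> ('m \<Rightarrow> ('m, 'n, real) mcomps) \<Rightarrow> bool" where
  "endomorphism_field M a \<longleftrightarrow> smooth_comps M (points M) a \<and>
     (\<forall>x\<in>points M. \<forall>\<phi>\<in>charts_at M x. \<forall>\<psi>\<in>charts_at M x.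
        a x \<psi> ** jacobian \<phi> \<psi> x = jacobian \<phi> \<psi> x ** a x \<phi>)"

definition bivector_field ::
  "('m, 'n::finite) manifold \<Rightarrow> ('m \<Rightarrow> ('m, 'n, real) mcomps) \<Rightarrow> bool" where
  "bivector_field M \<pi> \<longleftrightarrow> smooth_comps M (points M) \<pi> \<and>
     (\<forall>x\<in>points M. \<forall>\<phi>\<in>charts_at M x. transpose (\<pi> x \<phi>) = - \<pi> x \<phi>) \<and>
     (\<forall>x\<in>points M. \<forall>\<phi>\<in>charts_at M x. \<forall>\<psi>\<in>charts_at M x.
        \<pi> x \<psi> = jacobian \<phi> \<psi> x ** \<pi> x \<phi> ** transpose (jacobian \<phi> \<psi> x))"

definition two_form ::
  "('m, 'n::finite) manifold \<Rightarrow> ('m \<Rightarrow> ('m, 'n, real) mcomps) \<Rightarrow> bool" where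
  "two_form M \<omega> \<longleftrightarrow> smooth_comps M (points M) \<omega> \<and>
     (\<forall>x\<in>points M. \<forall>\<phi>\<in>charts_at M x. transpose (\<omega> x \<phi>) = - \<omega> x \<phi>) \<and>
     (\<forall>x\<in>points M. \<forall>\<phi>\<in>charts_at M x. \<forall>\<psi>\<in>charts_at M x.
        \<omega> x \<phi> = transpose (jacobian \<phi> \<psi> x) ** \<omega> x \<psi> ** jacobian \<phi> \<psi> x)"

text \<open>Pointwise algebra. \<open>contract P t\<close> inserts \<open>t\<close> in the first slot of \<open>P\<close>: it is the interior
  product \<open>\<iota>\<^sub>t P\<close>, hence also both \<open>\<pi>\<^sup>\<sharp>\<close> and \<open>\<omega>\<^sup>\<sharp>\<close>.\<close>

definition contract ::
  "('m, 'n::finite, 'k::real_normed_field) mcomps \<Rightarrow> ('m, 'n, 'k) comps \<Rightarrow> ('m, 'n, 'k) comps" where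
  "contract P t = (\<lambda>\<phi>. t \<phi> v* P \<phi>)"

definition endo ::
  "('m, 'n::finite, 'k::real_normed_field) mcomps \<Rightarrow> ('m, 'n, 'k) comps \<Rightarrow> ('m, 'n, 'k) comps" where
  "endo a u = (\<lambda>\<phi>. a \<phi> *v u \<phi>)"

definition dual_endo ::
  "('m, 'n::finite, 'k::real_normed_field) mcomps \<Rightarrow> ('m, 'n, 'k) comps \<Rightarrow> ('m, 'n, 'k) comps" where
  "dual_endo a \<xi> = (\<lambda>\<phi>. \<xi> \<phi> v* a \<phi>)"

definition evaluate ::
  "('m, 'n::finite, 'k::real_normed_field) mcomps \<Rightarrow> ('m, 'n, 'k) comps \<Rightarrow> ('m, 'n, 'k) comps \<Rightarrow>
   ('m, 'n) chart \<Rightarrow> 'k" where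
  "evaluate P s t \<phi> = (\<Sum>i\<in>UNIV. \<Sum>j\<in>UNIV. P \<phi> $ i $ j * s \<phi> $ i * t \<phi> $ j)"

text \<open>The pairing of \<open>TM \<oplus> T*M\<close>, computed in the chart \<open>\<phi>\<close>; on elements of a fibre over \<open>x\<close> it is
  the same for all charts around \<open>x\<close>.\<close>

definition pairing ::
  "('m, 'n) chart \<Rightarrow> ('m, 'n::finite, 'k::real_normed_field) gcomps \<Rightarrow> ('m, 'n, 'k) gcomps \<Rightarrow> 'k" where
  "pairing \<phi> s t = (\<Sum>i\<in>UNIV. snd s \<phi> $ i * fst t \<phi> $ i + snd t \<phi> $ i * fst s \<phi> $ i)"


section \<open>Differential calculus\<close>

text \<open>For \<open>'k = complex\<close> these are the complex bilinear extensions of the real operations. They are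
  given by their coordinate expressions in each chart, which define the same tensor fields in all
  charts. Values at charts not containing the point are meaningless and never used.\<close>

definition lie_bracket ::
  "('m \<Rightarrow> ('m, 'n::finite, 'k::real_normed_field) comps) \<Rightarrow> ('m \<Rightarrow> ('m, 'n, 'k) comps) \<Rightarrow>
   'm \<Rightarrow> ('m, 'n, 'k) comps" where
  "lie_bracket u v x \<phi> = (\<chi> j. \<Sum>i\<in>UNIV.
     u x \<phi> $ i * pd \<phi> i (\<lambda>y. v y \<phi> $ j) x - v x \<phi> $ i * pd \<phi> i (\<lambda>y. u y \<phi> $ j) x)"

definition lie_derivative ::
  "('m \<Rightarrow> ('m, 'n::finite, 'k::real_normed_field) comps) \<Rightarrow> ('m \<Rightarrow> ('m, 'n, 'k) comps) \<Rightarrow>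
   'm \<Rightarrow> ('m, 'n, 'k) comps" where
  "lie_derivative u \<eta> x \<phi> = (\<chi> j. \<Sum>i\<in>UNIV.
     u x \<phi> $ i * pd \<phi> i (\<lambda>y. \<eta> y \<phi> $ j) x + \<eta> x \<phi> $ i * pd \<phi> j (\<lambda>y. u y \<phi> $ i) x)"

definition ext_deriv ::
  "('m \<Rightarrow> ('m, 'n::finite, 'k::real_normed_field) comps) \<Rightarrow> 'm \<Rightarrow> ('m, 'n, 'k) mcomps" where
  "ext_deriv \<xi> x \<phi> = (\<chi> i j. pd \<phi> i (\<lambda>y. \<xi> y \<phi> $ j) x - pd \<phi> j (\<lambda>y. \<xi> y \<phi> $ i) x)"

definition closed_two_form ::
  "('m, 'n::finite) manifold \<Rightarrow> ('m \<Rightarrow> ('m, 'n, real) mcomps) \<Rightarrow> bool" where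
  "closed_two_form M \<omega> \<longleftrightarrow> (\<forall>x\<in>points M. \<forall>\<phi>\<in>charts_at M x. \<forall>i j k.
     pd \<phi> i (\<lambda>y. \<omega> y \<phi> $ j $ k) x + pd \<phi> j (\<lambda>y. \<omega> y \<phi> $ k $ i) x + pd \<phi> k (\<lambda>y. \<omega> y \<phi> $ i $ j) x = 0)"

definition schouten_square ::
  "('m \<Rightarrow> ('m, 'n::finite, real) mcomps) \<Rightarrow> 'm \<Rightarrow> ('m, 'n) chart \<Rightarrow> 'n \<Rightarrow> 'n \<Rightarrow> 'n \<Rightarrow> real" where
  "schouten_square \<pi> x \<phi> i j k = 2 * (\<Sum>l\<in>UNIV.
     \<pi> x \<phi> $ l $ i * pd \<phi> l (\<lambda>y. \<pi> y \<phi> $ j $ k) x +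
     \<pi> x \<phi> $ l $ j * pd \<phi> l (\<lambda>y. \<pi> y \<phi> $ k $ i) x +
     \<pi> x \<phi> $ l $ k * pd \<phi> l (\<lambda>y. \<pi> y \<phi> $ i $ j) x)"

definition poisson ::
  "('m, 'n::finite) manifold \<Rightarrow> ('m \<Rightarrow> ('m, 'n, real) mcomps) \<Rightarrow> bool" where
  "poisson M \<pi> \<longleftrightarrow> bivector_field M \<pi> \<and>
     (\<forall>x\<in>points M. \<forall>\<phi>\<in>charts_at M x. \<forall>i j k. schouten_square \<pi> x \<phi> i j k = 0)"

definition dorfman ::
  "('m \<Rightarrow> ('m, 'n::finite, 'k::real_normed_field) gcomps) \<Rightarrow> ('m \<Rightarrow> ('m, 'n, 'k) gcomps) \<Rightarrow>
   'm \<Rightarrow> ('m, 'n, 'k) gcomps" where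
  "dorfman s t x =
     (lie_bracket (fst \<circ> s) (fst \<circ> t) x,
      lie_derivative (fst \<circ> s) (snd \<circ> t) x - contract (ext_deriv (snd \<circ> s) x) (fst (t x)))"


section \<open>Families of subspaces of the complexified generalized tangent bundle\<close>

definition total_space :: "('m, 'n::finite) manifold \<Rightarrow> ('m \<times> ('m, 'n, complex) gcomps) set" where
  "total_space M = (SIGMA x:points M. gtangent_at M x)"

definition fibre :: "('m \<times> ('m, 'n, complex) gcomps) set \<Rightarrow> 'm \<Rightarrow> ('m, 'n, complex) gcomps set" where
  "fibre L x = {s. (x, s) \<in> L}"

definition gscale :: "complex \<Rightarrow> ('m, 'n::finite, complex) gcomps \<Rightarrow> ('m, 'n, complex) gcomps" where
  "gscale c s = (\<lambda>\<phi>. c *s fst s \<phi>, \<lambda>\<phi>. c *s snd s \<phi>)"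

definition complex_subspace :: "('m, 'n::finite, complex) gcomps set \<Rightarrow> bool" where
  "complex_subspace S \<longleftrightarrow> 0 \<in> S \<and> (\<forall>s\<in>S. \<forall>t\<in>S. s + t \<in> S) \<and> (\<forall>c. \<forall>s\<in>S. gscale c s \<in> S)"

definition orthogonal_at ::
  "('m, 'n::finite) manifold \<Rightarrow> 'm \<Rightarrow> ('m, 'n, complex) gcomps set \<Rightarrow> ('m, 'n, complex) gcomps set" where
  "orthogonal_at M x S =
     {t \<in> gtangent_at M x. \<forall>s\<in>S. \<forall>\<phi>\<in>charts_at M x. pairing \<phi> s t = 0}"

definition complex_lagrangian_family ::
  "('m, 'n::finite) manifold \<Rightarrow> ('m \<times> ('m, 'n, complex) gcomps) set \<Rightarrow> bool" where
  "complex_lagrangian_family M L \<longleftrightarrow> L \<subseteq> total_space M \<and>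
     (\<forall>x\<in>points M. complex_subspace (fibre L x) \<and> fibre L x = orthogonal_at M x (fibre L x))"

definition local_section ::
  "('m, 'n::finite) manifold \<Rightarrow> ('m \<times> ('m, 'n, complex) gcomps) set \<Rightarrow> 'm set \<Rightarrow>
   ('m \<Rightarrow> ('m, 'n, complex) gcomps) \<Rightarrow> bool" where
  "local_section M L U s \<longleftrightarrow> openin (mtop M) U \<and> (\<forall>x\<in>U. (x, s x) \<in> L) \<and>
     smooth_comps M U (fst \<circ> s) \<and> smooth_comps M U (snd \<circ> s)"

definition involutive ::
  "('m, 'n::finite) manifold \<Rightarrow> ('m \<times> ('m, 'n, complex) gcomps) set \<Rightarrow> bool" where
  "involutive M L \<longleftrightarrow> (\<forall>U s1 s2 s3.
     local_section M L U s1 \<and> local_section M L U s2 \<and> local_section M L U s3 \<longrightarrow>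
     (\<forall>x\<in>U. \<forall>\<phi>\<in>charts_at M x. pairing \<phi> (dorfman s1 s2 x) (s3 x) = 0))"

definition vector_subbundle ::
  "('m, 'n::finite) manifold \<Rightarrow> ('m \<times> ('m, 'n, complex) gcomps) set \<Rightarrow> bool" where
  "vector_subbundle M L \<longleftrightarrow> L \<subseteq> total_space M \<and>
     (\<forall>x\<in>points M. \<exists>U r e. x \<in> U \<and> (\<forall>i<r::nat. local_section M L U (e i)) \<and>
        openin (mtop M) U \<and>
        (\<forall>y\<in>U. fibre L y = range (\<lambda>c. \<Sum>i<r. gscale (c i) (e i y)) \<and>
           (\<forall>c. (\<Sum>i<r. gscale (c i) (e i y)) = 0 \<longrightarrow> (\<forall>i<r. c i = 0))))"

definition complex_dirac ::
  "('m, 'n::finite) manifold \<Rightarrow> ('m \<times> ('m, 'n, complex) gcomps) set \<Rightarrow> bool" where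
  "complex_dirac M L \<longleftrightarrow>
     complex_lagrangian_family M L \<and> involutive M L \<and> vector_subbundle M L"

definition conj_family ::
  "('m \<times> ('m, 'n::finite, complex) gcomps) set \<Rightarrow> ('m \<times> ('m, 'n, complex) gcomps) set" where
  "conj_family L =
     {(x, (\<lambda>\<phi>. \<chi> i. cnj (u \<phi> $ i), \<lambda>\<phi>. \<chi> i. cnj (\<xi> \<phi> $ i))) | x u \<xi>. (x, (u, \<xi>)) \<in> L}"

definition generalized_complex ::
  "('m, 'n::finite) manifold \<Rightarrow> ('m \<times> ('m, 'n, complex) gcomps) set \<Rightarrow> bool" where
  "generalized_complex M L \<longleftrightarrow> complex_dirac M L \<and>
     (\<forall>x\<in>points M. fibre L x \<inter> fibre (conj_family L) x = {0} \<and>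
        {s + t | s t. s \<in> fibre L x \<and> t \<in> fibre (conj_family L) x} = gtangent_at M x)"

definition reverse ::
  "('m \<times> ('m, 'n::finite, complex) gcomps) set \<Rightarrow> ('m \<times> ('m, 'n, complex) gcomps) set" where
  "reverse L = {(x, (- u, \<xi>)) | x u \<xi>. (x, (u, \<xi>)) \<in> L}"

definition tangent_product ::
  "('m \<times> ('m, 'n::finite, complex) gcomps) set \<Rightarrow> ('m \<times> ('m, 'n, complex) gcomps) set \<Rightarrow>
   ('m \<times> ('m, 'n, complex) gcomps) set"  (infixl \<open>\<star>\<close> 65) where
  "L \<star> R = {(x, s + (0, snd t)) | x s t. (x, s) \<in> L \<and> (x, t) \<in> R \<and> fst s = fst t}"

definition cotangent_product ::
  "('m \<times> ('m, 'n::finite, complex) gcomps) set \<Rightarrow> ('m \<times> ('m, 'n, complex) gcomps) set \<Rightarrow>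
   ('m \<times> ('m, 'n, complex) gcomps) set"  (infixl \<open>\<circledast>\<close> 65) where
  "L \<circledast> R = {(x, s + (fst t, 0)) | x s t. (x, s) \<in> L \<and> (x, t) \<in> R \<and> snd s = snd t}"

definition concur ::
  "('m, 'n::finite) manifold \<Rightarrow> ('m \<times> ('m, 'n, complex) gcomps) set \<Rightarrow>
   ('m \<times> ('m, 'n, complex) gcomps) set \<Rightarrow> bool" where
  "concur M L R \<longleftrightarrow> complex_dirac M (L \<circledast> R)"

definition concur_weakly ::
  "('m, 'n::finite) manifold \<Rightarrow> ('m \<times> ('m, 'n, complex) gcomps) set \<Rightarrow>
   ('m \<times> ('m, 'n, complex) gcomps) set \<Rightarrow> bool" where
  "concur_weakly M L R \<longleftrightarrow> involutive M (L \<circledast> R)"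

definition graph_bivector ::
  "('m, 'n::finite) manifold \<Rightarrow> ('m \<Rightarrow> ('m, 'n, complex) mcomps) \<Rightarrow>
   ('m \<times> ('m, 'n, complex) gcomps) set" where
  "graph_bivector M \<pi> = {(x, (contract (\<pi> x) \<xi>, \<xi>)) | x \<xi>. x \<in> points M \<and> \<xi> \<in> cotangent_at M x}"

definition graph_two_form ::
  "('m, 'n::finite) manifold \<Rightarrow> ('m \<Rightarrow> ('m, 'n, complex) mcomps) \<Rightarrow>
   ('m \<times> ('m, 'n, complex) gcomps) set" where
  "graph_two_form M \<omega> = {(x, (u, contract (\<omega> x) u)) | x u. x \<in> points M \<and> u \<in> tangent_at M x}"

definition complex_multiple ::
  "complex \<Rightarrow> ('m \<Rightarrow> ('m, 'n::finite, real) mcomps) \<Rightarrow> 'm \<Rightarrow> ('m, 'n, complex) mcomps" where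
  "complex_multiple c P x \<phi> = map_matrix (\<lambda>t. c * of_real t) (P x \<phi>)"

definition complexify :: "('m, 'n::finite, real) gcomps \<Rightarrow> ('m, 'n, complex) gcomps" where
  "complexify s = (\<lambda>\<phi>. \<chi> i. of_real (fst s \<phi> $ i), \<lambda>\<phi>. \<chi> i. of_real (snd s \<phi> $ i))"

text \<open>The endomorphism of \<open>TM \<oplus> T*M\<close> with the blocks \<open>a\<close>, \<open>\<pi>\<^sup>\<sharp>\<close>, \<open>\<omega>\<^sup>\<sharp>\<close>, \<open>-a*\<close>.\<close>

definition block_endo ::
  "('m \<Rightarrow> ('m, 'n::finite, real) mcomps) \<Rightarrow> ('m \<Rightarrow> ('m, 'n, real) mcomps) \<Rightarrow>
   ('m \<Rightarrow> ('m, 'n, real) mcomps) \<Rightarrow> 'm \<Rightarrow> ('m, 'n, real) gcomps \<Rightarrow> ('m, 'n, real) gcomps" where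
  "block_endo a \<pi> \<omega> x s =
     (endo (a x) (fst s) + contract (\<pi> x) (snd s), contract (\<omega> x) (fst s) - dual_endo (a x) (snd s))"

definition eigen_family ::
  "('m, 'n::finite) manifold \<Rightarrow> ('m \<Rightarrow> ('m, 'n, real) gcomps \<Rightarrow> ('m, 'n, real) gcomps) \<Rightarrow>
   ('m \<times> ('m, 'n, complex) gcomps) set" where
  "eigen_family M J = {(x, complexify (J x s) + gscale \<i> (complexify s)) | x s.
     x \<in> points M \<and> s \<in> gtangent_at M x}"


section \<open>PN- and \<open>\<Omega>N\<close>-structures\<close>

definition endo_field ::
  "('m \<Rightarrow> ('m, 'n::finite, real) mcomps) \<Rightarrow> ('m \<Rightarrow> ('m, 'n, real) comps) \<Rightarrow> 'm \<Rightarrow> ('m, 'n, real) comps" where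
  "endo_field a u x = endo (a x) (u x)"

definition dual_endo_field ::
  "('m \<Rightarrow> ('m, 'n::finite, real) mcomps) \<Rightarrow> ('m \<Rightarrow> ('m, 'n, real) comps) \<Rightarrow> 'm \<Rightarrow> ('m, 'n, real) comps" where
  "dual_endo_field a \<xi> x = dual_endo (a x) (\<xi> x)"

definition sharp ::
  "('m \<Rightarrow> ('m, 'n::finite, real) mcomps) \<Rightarrow> ('m \<Rightarrow> ('m, 'n, real) comps) \<Rightarrow> 'm \<Rightarrow> ('m, 'n, real) comps" where
  "sharp P t x = contract (P x) (t x)"

definition endo_bracket ::
  "('m \<Rightarrow> ('m, 'n::finite, real) mcomps) \<Rightarrow> ('m \<Rightarrow> ('m, 'n, real) comps) \<Rightarrow>
   ('m \<Rightarrow> ('m, 'n, real) comps) \<Rightarrow> 'm \<Rightarrow> ('m, 'n, real) comps" where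
  "endo_bracket a u v = lie_bracket (endo_field a u) v + lie_bracket u (endo_field a v)
     - endo_field a (lie_bracket u v)"

definition nijenhuis ::
  "('m, 'n::finite) manifold \<Rightarrow> ('m \<Rightarrow> ('m, 'n, real) mcomps) \<Rightarrow> bool" where
  "nijenhuis M a \<longleftrightarrow> endomorphism_field M a \<and>
     (\<forall>u v. vector_field M u \<and> vector_field M v \<longrightarrow>
        (\<forall>x\<in>points M. \<forall>\<phi>\<in>charts_at M x.
           endo_field a (endo_bracket a u v) x \<phi> = lie_bracket (endo_field a u) (endo_field a v) x \<phi>))"

definition pn_concomitant ::
  "('m \<Rightarrow> ('m, 'n::finite, real) mcomps) \<Rightarrow> ('m \<Rightarrow> ('m, 'n, real) mcomps) \<Rightarrow>
   ('m \<Rightarrow> ('m, 'n, real) comps) \<Rightarrow> ('m \<Rightarrow> ('m, 'n, real) comps) \<Rightarrow> 'm \<Rightarrow> ('m, 'n, real) comps" where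
  "pn_concomitant \<pi> a \<xi> \<eta> =
     dual_endo_field a (lie_derivative (sharp \<pi> \<xi>) \<eta> - sharp (ext_deriv \<xi>) (sharp \<pi> \<eta>))
     - (lie_derivative (sharp \<pi> \<xi>) (dual_endo_field a \<eta>)
        - sharp (ext_deriv (dual_endo_field a \<xi>)) (sharp \<pi> \<eta>))"

definition PN_structure ::
  "('m, 'n::finite) manifold \<Rightarrow> ('m \<Rightarrow> ('m, 'n, real) mcomps) \<Rightarrow> ('m \<Rightarrow> ('m, 'n, real) mcomps) \<Rightarrow> bool" where
  "PN_structure M \<pi> a \<longleftrightarrow> poisson M \<pi> \<and> nijenhuis M a \<and>
     (\<forall>\<xi> \<eta>. one_form M \<xi> \<and> one_form M \<eta> \<longrightarrow>
        (\<forall>x\<in>points M. \<forall>\<phi>\<in>charts_at M x.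
           evaluate (\<pi> x) (dual_endo_field a \<xi> x) (\<eta> x) \<phi> =
             evaluate (\<pi> x) (\<xi> x) (dual_endo_field a \<eta> x) \<phi> \<and>
           pn_concomitant \<pi> a \<xi> \<eta> x \<phi> = 0))"

definition vec_section ::
  "('m \<Rightarrow> ('m, 'n::finite, real) comps) \<Rightarrow> 'm \<Rightarrow> ('m, 'n, real) gcomps" where
  "vec_section u x = (u x, 0)"

definition form_section ::
  "('m \<Rightarrow> ('m, 'n::finite, real) comps) \<Rightarrow> 'm \<Rightarrow> ('m, 'n, real) gcomps" where
  "form_section \<xi> x = (0, \<xi> x)"

text \<open>The bracket \<open>[u, v]\<^sup>\<omega>\<close>; the tangent component of the Dorfman brackets involved vanishes.\<close>

definition form_bracket ::
  "('m \<Rightarrow> ('m, 'n::finite, real) mcomps) \<Rightarrow> ('m \<Rightarrow> ('m, 'n, real) comps) \<Rightarrow>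
   ('m \<Rightarrow> ('m, 'n, real) comps) \<Rightarrow> 'm \<Rightarrow> ('m, 'n, real) comps" where
  "form_bracket \<omega> u v x =
     snd (dorfman (form_section (sharp \<omega> u)) (vec_section v) x
          + dorfman (vec_section u) (form_section (sharp \<omega> v)) x
          - form_section (sharp \<omega> (lie_bracket u v)) x)"

definition omega_n_concomitant ::
  "('m \<Rightarrow> ('m, 'n::finite, real) mcomps) \<Rightarrow> ('m \<Rightarrow> ('m, 'n, real) mcomps) \<Rightarrow>
   ('m \<Rightarrow> ('m, 'n, real) comps) \<Rightarrow> ('m \<Rightarrow> ('m, 'n, real) comps) \<Rightarrow> 'm \<Rightarrow> ('m, 'n, real) gcomps" where
  "omega_n_concomitant \<omega> a u v =
     dorfman (vec_section (endo_field a u)) (form_section (sharp \<omega> v))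
     + dorfman (form_section (sharp \<omega> u)) (vec_section (endo_field a v))
     - form_section (sharp \<omega> (endo_bracket a u v))
     + form_section (dual_endo_field a (form_bracket \<omega> u v))"

definition omega_N_structure ::
  "('m, 'n::finite) manifold \<Rightarrow> ('m \<Rightarrow> ('m, 'n, real) mcomps) \<Rightarrow> ('m \<Rightarrow> ('m, 'n, real) mcomps) \<Rightarrow> bool" where
  "omega_N_structure M \<omega> a \<longleftrightarrow> two_form M \<omega> \<and> closed_two_form M \<omega> \<and> nijenhuis M a \<and>
     (\<forall>u v. vector_field M u \<and> vector_field M v \<longrightarrow>
        (\<forall>x\<in>points M. \<forall>\<phi>\<in>charts_at M x.
           evaluate (\<omega> x) (endo_field a u x) (v x) \<phi> = evaluate (\<omega> x) (u x) (endo_field a v x) \<phi> \<and>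
           fst (omega_n_concomitant \<omega> a u v x) \<phi> = 0 \<and>
           snd (omega_n_concomitant \<omega> a u v x) \<phi> = 0))"

end

theory Submission
  imports Defs
begin

text \<open>The endomorphism \<open>J\<close> squares to \<open>-id\<close>, because the fibres of \<open>L\<close> are complex subspaces; hence the
fibres of \<open>L\<close> and of its conjugate are the eigenspaces of \<open>J\<close> for \<open>\<i>\<close> and \<open>-\<i>\<close>. The two formulas for
products of \<open>L\<close> with its reversed conjugate are then linear algebra in one fibre, using the block
identities \<open>a\<^sup>2 + \<pi>\<omega> = -id\<close>, \<open>a*\<omega> = \<omega>a\<close>, \<open>a\<pi> = \<pi>a*\<close> (\<open>tangent_product_eq\<close>, \<open>cotangent_product_eq\<close>).

The same linear algebra (\<open>mem_D_iff\<close>) identifies the product \<open>D\<close> of \<open>L\<close> and its conjugate that defines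
concurrence: it consists of the elements \<open>e(p) = a p + (1/2) \<omega> p\<close> for complex tangent vectors \<open>p\<close>. The map
\<open>e\<close> is injective, since \<open>p = - a(a p) - 2 \<pi>((1/2) \<omega> p)\<close>. Therefore \<open>D\<close> is always a Lagrangian vector
subbundle, framed by the images of coordinate vector fields (\<open>D_lagrangian\<close>, \<open>D_subbundle\<close>), and
concurrence is the same as weak concurrence.

Involutivity of \<open>L\<close> says that the Nijenhuis torsion of \<open>J\<close> with respect to the Dorfman bracket
vanishes (\<open>nijenhuis_torsion_vanishes\<close>). On two vector fields, with \<open>\<beta> = [u,v]\<^sup>\<omega> = \<iota>\<^sub>v\<iota>\<^sub>u d\<omega>\<close>, this means
  \<open>[a u, a v] = a [u,v]\<^sup>a + \<pi> \<beta>\<close>,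
  \<open>L\<^bsub>a u\<^esub>(\<omega> v) - \<iota>\<^bsub>a v\<^esub>d(\<omega> u) = \<omega> [u,v]\<^sup>a - a* \<beta>\<close>,
and on two one-forms it means that \<open>\<pi>\<close> is Poisson and the concomitant of \<open>\<pi>\<close> and \<open>a\<close> vanishes. So \<open>\<pi>\<close> is Poisson and
concomitant-free in any case; when \<open>\<omega>\<close> is closed, \<open>\<beta> = 0\<close> and the first two identities say that \<open>a\<close> is
Nijenhuis and that the concomitant of \<open>\<omega>\<close> and \<open>a\<close> vanishes. This gives both structures from
\<open>d\<omega> = 0\<close>, while an \<open>\<Omega>N\<close>-structure includes \<open>d\<omega> = 0\<close> by definition.

The remaining equivalence, of \<open>d\<omega> = 0\<close> with involutivity of \<open>D\<close>, follows from the same two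
identities: they yield \<open>\<langle>[e(u), e(v)], e(w)\<rangle> = (1/2) d\<omega>(u, v, w)\<close> (\<open>half_section_bracket\<close>).\<close>

section \<open>Calculus of smooth maps between normed spaces\<close>

text \<open>The closure properties are proved by induction on the order of differentiability. Openness of the
domain is needed since each derivative must be identified with a simpler expression on a whole
neighbourhood before it can be differentiated again.\<close>

lemma frechet_derivative_eqI: "(f has_derivative D) (at x) \<Longrightarrow> frechet_derivative f (at x) = D"
  by (metis frechet_derivative_at)

lemma frechet_derivative_cong_open:
  assumes "open S" "x \<in> S" "\<And>y. y \<in> S \<Longrightarrow> f y = g y"
  shows "frechet_derivative f (at x) = frechet_derivative g (at x)"
proof -
  have "(f has_derivative D) (at x) \<longleftrightarrow> (g has_derivative D) (at x)" for D
    using has_derivative_transform_within_open[OF _ assms(1,2)] assms(3) by metis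
  then show ?thesis by (simp add: frechet_derivative_def)
qed

lemma differentiable_cong_open:
  assumes "open S" "x \<in> S" "\<And>y. y \<in> S \<Longrightarrow> f y = g y" "f differentiable (at x)"
  shows "g differentiable (at x)"
  using assms has_derivative_transform_within_open[OF _ assms(1,2)]
  unfolding differentiable_def by metis

lemma times_differentiable_on_cong:
  assumes "open S" "\<And>y. y \<in> S \<Longrightarrow> f y = g y" "times_differentiable_on k S f"
  shows "times_differentiable_on k S g"
  using assms(2,3)
proof (induction k arbitrary: f g)
  case 0
  then show ?case by (metis continuous_on_cong times_differentiable_on.simps(1))
next
  case (Suc k)
  have "times_differentiable_on k S (\<lambda>x. frechet_derivative g (at x) v)" for v
  proof (rule Suc.IH)
    show "times_differentiable_on k S (\<lambda>x. frechet_derivative f (at x) v)"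
      using Suc.prems(2) by simp
    show "frechet_derivative f (at y) v = frechet_derivative g (at y) v" if "y \<in> S" for y
      using frechet_derivative_cong_open[OF assms(1) that Suc.prems(1)] by simp
  qed
  then show ?case
    using Suc.prems differentiable_cong_open[OF assms(1) _ Suc.prems(1)] by auto
qed

lemma times_differentiable_on_lower:
  "times_differentiable_on (Suc k) S f \<Longrightarrow> times_differentiable_on k S f"
proof (induction k arbitrary: f)
  case 0
  then show ?case
    by (auto intro!: continuous_at_imp_continuous_on differentiable_imp_continuous_within)
next
  case (Suc k)
  then show ?case by (metis times_differentiable_on.simps(2))
qed

lemma times_differentiable_on_subset:
  "times_differentiable_on k S f \<Longrightarrow> T \<subseteq> S \<Longrightarrow> times_differentiable_on k T f"
  by (induction k arbitrary: f) (auto intro: continuous_on_subset)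

lemma times_differentiable_on_linear:
  assumes "open S" "bounded_linear h" "times_differentiable_on k S f"
  shows "times_differentiable_on k S (\<lambda>x. h (f x))"
  using assms(3)
proof (induction k arbitrary: f)
  case 0
  then show ?case
    by (simp add: bounded_linear.continuous_on[OF assms(2)])
next
  case (Suc k)
  have D: "((\<lambda>x. h (f x)) has_derivative (\<lambda>v. h (frechet_derivative f (at x) v))) (at x)"
    if "x \<in> S" for x
    using that Suc.prems by (auto intro!: bounded_linear.has_derivative[OF assms(2)]
        simp: frechet_derivative_works)
  have "times_differentiable_on k S (\<lambda>x. frechet_derivative (\<lambda>x. h (f x)) (at x) v)" for v
    by (rule times_differentiable_on_cong[OF assms(1) _ Suc.IH[of "\<lambda>x. frechet_derivative f (at x) v"]])
      (use Suc.prems frechet_derivative_eqI[OF D] in auto)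
  then show ?case using D by (auto simp: differentiable_def)
qed

lemma times_differentiable_on_add:
  assumes "open S" "times_differentiable_on k S f" "times_differentiable_on k S g"
  shows "times_differentiable_on k S (\<lambda>x. f x + g x)"
  using assms(2,3)
proof (induction k arbitrary: f g)
  case 0
  then show ?case by (simp add: continuous_on_add)
next
  case (Suc k)
  have D: "((\<lambda>x. f x + g x) has_derivative
      (\<lambda>v. frechet_derivative f (at x) v + frechet_derivative g (at x) v)) (at x)" if "x \<in> S" for x
    using that Suc.prems by (auto intro!: has_derivative_add simp: frechet_derivative_works)
  have "times_differentiable_on k S (\<lambda>x. frechet_derivative (\<lambda>x. f x + g x) (at x) v)" for v
    by (rule times_differentiable_on_cong[OF assms(1) _ Suc.IH[of
      "\<lambda>x. frechet_derivative f (at x) v" "\<lambda>x. frechet_derivative g (at x) v"]])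
      (use Suc.prems frechet_derivative_eqI[OF D] in auto)
  then show ?case using D by (auto simp: differentiable_def)
qed

lemma times_differentiable_on_bilinear:
  assumes "open S" "bounded_bilinear h" "times_differentiable_on k S f" "times_differentiable_on k S g"
  shows "times_differentiable_on k S (\<lambda>x. h (f x) (g x))"
  using assms(3,4)
proof (induction k arbitrary: f g)
  case 0
  then show ?case
    by (simp add: bounded_bilinear.continuous_on[OF assms(2)])
next
  case (Suc k)
  have D: "((\<lambda>x. h (f x) (g x)) has_derivative (\<lambda>v. h (f x) (frechet_derivative g (at x) v)
      + h (frechet_derivative f (at x) v) (g x))) (at x)" if "x \<in> S" for x
    using that Suc.prems by (auto intro!: bounded_bilinear.FDERIV[OF assms(2)]
        simp: frechet_derivative_works)
  have "times_differentiable_on k S (\<lambda>x. frechet_derivative (\<lambda>x. h (f x) (g x)) (at x) v)" for v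
  proof (rule times_differentiable_on_cong[OF assms(1) _ times_differentiable_on_add[OF assms(1)]])
    show "times_differentiable_on k S (\<lambda>x. h (f x) (frechet_derivative g (at x) v))"
      "times_differentiable_on k S (\<lambda>x. h (frechet_derivative f (at x) v) (g x))"
      by (rule Suc.IH; use Suc.prems times_differentiable_on_lower in auto)+
  qed (use frechet_derivative_eqI[OF D] in auto)
  then show ?case using D by (auto simp: differentiable_def)
qed

lemma times_differentiable_on_const: "times_differentiable_on k S (\<lambda>x. c)"
  by (induction k arbitrary: c) (auto simp: frechet_derivative_const)

lemma times_differentiable_on_sum:
  assumes "open S" "\<And>i. i \<in> I \<Longrightarrow> times_differentiable_on k S (f i)"
  shows "times_differentiable_on k S (\<lambda>x. \<Sum>i\<in>I. f i x)"
  using assms(2)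
  by (induction I rule: infinite_finite_induct)
    (auto intro: times_differentiable_on_const times_differentiable_on_add[OF assms(1)])

text \<open>In the chain rule the direction \<open>Df(x) v\<close> in which \<open>g\<close> is differentiated varies with \<open>x\<close>, whereas the
definition only provides derivatives in fixed directions. Expanding that direction in an orthonormal
basis separates the two dependences; this is where the intermediate space has to be Euclidean.\<close>

lemma times_differentiable_on_compose:
  fixes f :: "'a::real_normed_vector \<Rightarrow> 'b::euclidean_space" and g :: "'b \<Rightarrow> 'c::real_normed_vector"
  assumes "open S" "f ` S \<subseteq> T" "times_differentiable_on k S f" "times_differentiable_on k T g"
  shows "times_differentiable_on k S (\<lambda>x. g (f x))"
  using assms(3,4)
proof (induction k arbitrary: g)
  case 0
  then show ?case using assms(2) by (auto intro: continuous_on_compose2)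
next
  case (Suc k)
  let ?f' = "\<lambda>x. frechet_derivative f (at x)" and ?g' = "\<lambda>x. frechet_derivative g (at x)"
  have D: "((\<lambda>x. g (f x)) has_derivative (\<lambda>v. ?g' (f x) (?f' x v))) (at x)" if "x \<in> S" for x
  proof -
    have "(f has_derivative ?f' x) (at x)" "(g has_derivative ?g' (f x)) (at (f x))"
      using that Suc.prems assms(2) by (auto simp: frechet_derivative_works image_subset_iff)
    from diff_chain_at[OF this] show ?thesis by (simp add: o_def)
  qed
  have eq: "?g' (f x) w = (\<Sum>b\<in>Basis. (w \<bullet> b) *\<^sub>R ?g' (f x) b)" if "x \<in> S" for x w
  proof -
    have "linear (?g' (f x))"
      using that Suc.prems assms(2) by (intro linear_frechet_derivative) auto
    then have "?g' (f x) (\<Sum>b\<in>Basis. (w \<bullet> b) *\<^sub>R b) = (\<Sum>b\<in>Basis. (w \<bullet> b) *\<^sub>R ?g' (f x) b)"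
      by (simp add: linear_sum linear_cmul)
    then show ?thesis by (simp add: euclidean_representation)
  qed
  have "times_differentiable_on k S (\<lambda>x. frechet_derivative (\<lambda>x. g (f x)) (at x) v)" for v
  proof (rule times_differentiable_on_cong[OF assms(1)])
    have f': "times_differentiable_on k S (\<lambda>x. ?f' x v \<bullet> b)" for b
      by (rule times_differentiable_on_linear[OF assms(1) bounded_linear_inner_left])
        (use Suc.prems in simp)
    have g': "times_differentiable_on k S (\<lambda>x. ?g' (f x) b)" for b
    proof (rule Suc.IH[of "\<lambda>y. ?g' y b"])
      show "times_differentiable_on k S f"
        by (rule times_differentiable_on_lower) (rule Suc.prems)
    qed (use Suc.prems in simp)
    have "times_differentiable_on k S (\<lambda>x. (?f' x v \<bullet> b) *\<^sub>R ?g' (f x) b)" for b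
      by (rule times_differentiable_on_bilinear[OF assms(1) bounded_bilinear_scaleR f' g'])
    then show "times_differentiable_on k S (\<lambda>x. \<Sum>b\<in>Basis. (?f' x v \<bullet> b) *\<^sub>R ?g' (f x) b)"
      by (rule times_differentiable_on_sum[OF assms(1)])
  qed (use frechet_derivative_eqI[OF D] eq in auto)
  then show ?case using D by (auto simp: differentiable_def)
qed

lemma smooth_on_cong: "open S \<Longrightarrow> (\<And>y. y \<in> S \<Longrightarrow> f y = g y) \<Longrightarrow> smooth_on S f \<Longrightarrow> smooth_on S g"
  unfolding smooth_on_def using times_differentiable_on_cong by blast

lemma smooth_on_subset: "smooth_on S f \<Longrightarrow> T \<subseteq> S \<Longrightarrow> smooth_on T f"
  unfolding smooth_on_def using times_differentiable_on_subset by blast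

lemma smooth_on_linear: "open S \<Longrightarrow> bounded_linear h \<Longrightarrow> smooth_on S f \<Longrightarrow> smooth_on S (\<lambda>x. h (f x))"
  unfolding smooth_on_def by (blast intro: times_differentiable_on_linear)

lemma smooth_on_add: "open S \<Longrightarrow> smooth_on S f \<Longrightarrow> smooth_on S g \<Longrightarrow> smooth_on S (\<lambda>x. f x + g x)"
  unfolding smooth_on_def by (blast intro: times_differentiable_on_add)

lemma smooth_on_const: "smooth_on S (\<lambda>x. c)"
  unfolding smooth_on_def by (blast intro: times_differentiable_on_const)

lemma smooth_on_sum: "open S \<Longrightarrow> (\<And>i. i \<in> I \<Longrightarrow> smooth_on S (f i)) \<Longrightarrow> smooth_on S (\<lambda>x. \<Sum>i\<in>I. f i x)"
  unfolding smooth_on_def by (blast intro: times_differentiable_on_sum)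

lemma smooth_on_mult:
  fixes f g :: "_ \<Rightarrow> 'b::real_normed_algebra"
  shows "open S \<Longrightarrow> smooth_on S f \<Longrightarrow> smooth_on S g \<Longrightarrow> smooth_on S (\<lambda>x. f x * g x)"
  unfolding smooth_on_def
  by (blast intro: times_differentiable_on_bilinear bounded_bilinear_mult)

lemma smooth_on_compose:
  fixes f :: "'a::real_normed_vector \<Rightarrow> 'b::euclidean_space"
  shows "open S \<Longrightarrow> f ` S \<subseteq> T \<Longrightarrow> smooth_on S f \<Longrightarrow> smooth_on T g \<Longrightarrow> smooth_on S (\<lambda>x. g (f x))"
  unfolding smooth_on_def by (blast intro: times_differentiable_on_compose)

lemma smooth_on_frechet_derivative: "smooth_on S f \<Longrightarrow> smooth_on S (\<lambda>x. frechet_derivative f (at x) v)"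
  unfolding smooth_on_def by (metis times_differentiable_on.simps(2))

lemma smooth_on_imp_differentiable: "smooth_on S f \<Longrightarrow> x \<in> S \<Longrightarrow> f differentiable (at x)"
  unfolding smooth_on_def by (metis times_differentiable_on.simps(2))

lemma smooth_on_of_real:
  "open S \<Longrightarrow> smooth_on S f \<Longrightarrow> smooth_on S (\<lambda>x. of_real (f x) :: 'b::real_normed_field)"
  by (rule smooth_on_linear[OF _ bounded_linear_of_real])

lemma bounded_linear_axis: "bounded_linear (axis i :: 'b::real_normed_vector \<Rightarrow> 'b^'n::finite)"
  by (rule bounded_linear_intro[where K=1])
    (auto simp: vec_eq_iff axis_def norm_vec_def L2_set_def if_distrib[of norm] if_distrib[of "\<lambda>t. t^2"] cong: if_cong)

lemma smooth_on_vec_iff: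
  fixes f :: "_ \<Rightarrow> 'b::real_normed_vector ^ 'n::finite"
  assumes "open S"
  shows "smooth_on S f \<longleftrightarrow> (\<forall>i. smooth_on S (\<lambda>x. f x $ i))"
proof safe
  show "smooth_on S (\<lambda>x. f x $ i)" if "smooth_on S f" for i
    using that by (rule smooth_on_linear[OF assms bounded_linear_vec_nth])
next
  assume *: "\<forall>i. smooth_on S (\<lambda>x. f x $ i)"
  have "(\<Sum>i\<in>UNIV. axis i (f x $ i)) = f x" for x
    by (simp add: vec_eq_iff axis_def)
  moreover have "smooth_on S (\<lambda>x. \<Sum>i\<in>UNIV. axis i (f x $ i))"
    using * by (intro smooth_on_sum smooth_on_linear[OF assms bounded_linear_axis] assms) auto
  ultimately show "smooth_on S f" by simp
qed

lemmas smooth_intros = smooth_on_add smooth_on_sum smooth_on_mult smooth_on_of_real smooth_on_const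


section \<open>Charts, partial derivatives and coordinate fields\<close>

lemma map_matrix_id [simp]: "map_matrix id A = A"
  by (simp add: vec_eq_iff)

abbreviation differentiable_in_chart ::
  "('m, 'n::finite) chart \<Rightarrow> ('m \<Rightarrow> 'b::real_normed_vector) \<Rightarrow> 'm \<Rightarrow> bool" where
  "differentiable_in_chart \<phi> f x \<equiv> (f \<circ> chart_inv \<phi>) differentiable (at (snd \<phi> x))"

lemma pd_const [simp]: "pd \<phi> i (\<lambda>y. c) x = 0"
  by (simp add: pd_def o_def frechet_derivative_const)

lemma pd_add:
  assumes "differentiable_in_chart \<phi> f x" "differentiable_in_chart \<phi> g x"
  shows "pd \<phi> i (\<lambda>y. f y + g y) x = pd \<phi> i f x + pd \<phi> i g x"
  using has_derivative_add[OF assms[unfolded frechet_derivative_works]]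
  by (simp add: pd_def o_def frechet_derivative_eqI)

lemma pd_linear:
  assumes "bounded_linear h" "differentiable_in_chart \<phi> f x"
  shows "pd \<phi> i (\<lambda>y. h (f y)) x = h (pd \<phi> i f x)"
  using bounded_linear.has_derivative[OF assms(1) assms(2)[unfolded frechet_derivative_works]]
  by (simp add: pd_def o_def frechet_derivative_eqI)

lemma differentiable_in_chart_linear:
  assumes "bounded_linear h" "differentiable_in_chart \<phi> f x"
  shows "differentiable_in_chart \<phi> (\<lambda>y. h (f y)) x"
  using bounded_linear.has_derivative[OF assms(1) assms(2)[unfolded frechet_derivative_works]]
  by (auto simp: differentiable_def o_def)

lemma pd_mult:
  fixes f g :: "'m \<Rightarrow> 'b::real_normed_algebra"
  assumes "differentiable_in_chart \<phi> f x" "differentiable_in_chart \<phi> g x"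
    and "chart_inv \<phi> (snd \<phi> x) = x"
  shows "pd \<phi> i (\<lambda>y. f y * g y) x = f x * pd \<phi> i g x + pd \<phi> i f x * g x"
  using has_derivative_mult[OF assms(1,2)[unfolded frechet_derivative_works]] assms(3)
  by (simp add: pd_def o_def frechet_derivative_eqI)

lemma differentiable_in_chart_mult:
  fixes f g :: "'m \<Rightarrow> 'b::real_normed_algebra"
  shows "differentiable_in_chart \<phi> f x \<Longrightarrow> differentiable_in_chart \<phi> g x \<Longrightarrow>
    differentiable_in_chart \<phi> (\<lambda>y. f y * g y) x"
  by (simp add: o_def differentiable_mult)

lemma pd_sum:
  assumes "\<And>k. k \<in> I \<Longrightarrow> differentiable_in_chart \<phi> (f k) x"
  shows "pd \<phi> i (\<lambda>y. \<Sum>k\<in>I. f k y) x = (\<Sum>k\<in>I. pd \<phi> i (f k) x)"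
proof -
  have D: "(f k \<circ> chart_inv \<phi> has_derivative frechet_derivative (f k \<circ> chart_inv \<phi>) (at (snd \<phi> x)))
      (at (snd \<phi> x))" if "k \<in> I" for k
    using assms[OF that] by (simp only: frechet_derivative_works)
  have "((\<lambda>z. \<Sum>k\<in>I. (f k \<circ> chart_inv \<phi>) z) has_derivative
      (\<lambda>v. \<Sum>k\<in>I. frechet_derivative (f k \<circ> chart_inv \<phi>) (at (snd \<phi> x)) v)) (at (snd \<phi> x))"
    by (rule has_derivative_sum) (use D in \<open>simp add: o_def\<close>)
  then show ?thesis by (simp add: pd_def o_def frechet_derivative_eqI)
qed

locale manifold_charts =
  fixes M :: "('m, 'n::finite) manifold"
  assumes manifold: "smooth_manifold M"
begin

lemma is_chart: "\<phi> \<in> atlas M \<Longrightarrow> is_chart (mtop M) \<phi>"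
  using manifold by (simp add: smooth_manifold_def)

lemma openin_chart: "\<phi> \<in> atlas M \<Longrightarrow> openin (mtop M) (fst \<phi>)"
  using is_chart by (simp add: is_chart_def)

lemma charts_atD [dest]: "\<phi> \<in> charts_at M x \<Longrightarrow> \<phi> \<in> atlas M" "\<phi> \<in> charts_at M x \<Longrightarrow> x \<in> fst \<phi>"
  by (auto simp: charts_at_def)

lemma points_chart: "x \<in> points M \<longleftrightarrow> (\<exists>\<phi>. \<phi> \<in> charts_at M x)"
proof -
  have "(\<Union>\<phi>\<in>atlas M. fst \<phi>) = points M"
    using manifold by (simp add: smooth_manifold_def)
  then show ?thesis by (auto simp: charts_at_def set_eq_iff simp del: split_paired_Ex)
qed

lemma chart_homeomorphic:
  assumes "\<phi> \<in> atlas M"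
  shows "homeomorphic_map (subtopology (mtop M) (fst \<phi>)) (top_of_set (snd \<phi> ` fst \<phi>)) (snd \<phi>)"
    and "topspace (subtopology (mtop M) (fst \<phi>)) = fst \<phi>"
  using is_chart[OF assms] openin_subset[of "mtop M" "fst \<phi>"]
  by (auto simp: is_chart_def)

lemma inj_on_chart: "\<phi> \<in> atlas M \<Longrightarrow> inj_on (snd \<phi>) (fst \<phi>)"
  using chart_homeomorphic by (metis homeomorphic_imp_injective_map)

lemma open_chart_image:
  assumes "\<phi> \<in> atlas M" "openin (mtop M) U"
  shows "open (snd \<phi> ` (U \<inter> fst \<phi>))"
proof -
  have "openin (subtopology (mtop M) (fst \<phi>)) (U \<inter> fst \<phi>)"
    using assms(2) by (auto simp: openin_subtopology)
  then have "openin (top_of_set (snd \<phi> ` fst \<phi>)) (snd \<phi> ` (U \<inter> fst \<phi>))"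
    using chart_homeomorphic[OF assms(1)] homeomorphic_map_openness
    by (metis openin_subset)
  moreover have "open (snd \<phi> ` fst \<phi>)"
    using is_chart[OF assms(1)] by (simp add: is_chart_def)
  ultimately show ?thesis using openin_open_trans by blast
qed

lemma chart_inv_left [simp]: "\<phi> \<in> atlas M \<Longrightarrow> x \<in> fst \<phi> \<Longrightarrow> chart_inv \<phi> (snd \<phi> x) = x"
  using inj_on_chart by (simp add: chart_inv_def)

lemma pd_cong:
  assumes "\<phi> \<in> charts_at M x" "openin (mtop M) U" "x \<in> U"
    and "\<And>y. y \<in> U \<Longrightarrow> y \<in> fst \<phi> \<Longrightarrow> f y = g y"
  shows "pd \<phi> i f x = pd \<phi> i g x"
  unfolding pd_def
  by (subst frechet_derivative_cong_open[where g = "g \<circ> chart_inv \<phi>",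
        OF open_chart_image[OF charts_atD(1)[OF assms(1)] assms(2)]])
    (use assms charts_atD[OF assms(1)] in auto)

lemma smooth_comps_nth:
  assumes "openin (mtop M) U"
  shows "smooth_comps M U s \<longleftrightarrow>
    (\<forall>\<phi>\<in>atlas M. \<forall>i. smooth_on (snd \<phi> ` (U \<inter> fst \<phi>)) (\<lambda>y. s (chart_inv \<phi> y) \<phi> $ i))"
  unfolding smooth_comps_def using open_chart_image[OF _ assms] by (auto simp: smooth_on_vec_iff)

lemma smooth_comps_subset: "smooth_comps M U s \<Longrightarrow> V \<subseteq> U \<Longrightarrow> smooth_comps M V s"
  unfolding smooth_comps_def by (meson Int_mono image_mono order_refl smooth_on_subset)

lemma smooth_comps_differentiable:
  assumes "smooth_comps M U s" "\<phi> \<in> charts_at M x" "openin (mtop M) U" "x \<in> U"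
  shows "differentiable_in_chart \<phi> (\<lambda>y. s y \<phi> $ i) x"
proof -
  have "smooth_on (snd \<phi> ` (U \<inter> fst \<phi>)) (\<lambda>y. s (chart_inv \<phi> y) \<phi> $ i)"
    using assms charts_atD smooth_comps_nth by blast
  then show ?thesis
    unfolding o_def by (rule smooth_on_imp_differentiable) (use assms in auto)
qed

lemma smooth_comps_matrix_nth:
  assumes "openin (mtop M) U" "smooth_comps M U (A :: 'm \<Rightarrow> ('m, 'n, real) mcomps)" "\<phi> \<in> atlas M"
  shows "smooth_on (snd \<phi> ` (U \<inter> fst \<phi>)) (\<lambda>y. A (chart_inv \<phi> y) \<phi> $ i $ j)"
proof -
  have "smooth_on (snd \<phi> ` (U \<inter> fst \<phi>)) (\<lambda>y. A (chart_inv \<phi> y) \<phi> $ i)"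
    using assms smooth_comps_nth[OF assms(1), of A] by blast
  then show ?thesis using open_chart_image[OF assms(3,1)] by (simp add: smooth_on_vec_iff)
qed

lemma smooth_comps_matrix_differentiable:
  assumes "smooth_comps M U (A :: 'm \<Rightarrow> ('m, 'n, real) mcomps)"
    "\<phi> \<in> charts_at M x" "openin (mtop M) U" "x \<in> U"
  shows "differentiable_in_chart \<phi> (\<lambda>y. A y \<phi> $ i $ j) x"
  unfolding o_def
  by (rule smooth_on_imp_differentiable[OF smooth_comps_matrix_nth[OF assms(3,1)]]) (use assms in auto)

lemma smooth_transition:
  assumes "\<phi> \<in> atlas M" "\<psi> \<in> atlas M"
  shows "smooth_on (snd \<phi> ` (fst \<psi> \<inter> fst \<phi>)) (\<lambda>y. snd \<psi> (chart_inv \<phi> y))"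
  using manifold assms by (auto simp: smooth_manifold_def o_def Int_commute)

text \<open>The Jacobian is defined entrywise; this identifies it with the total derivative of the transition
map, so that the cocycle rule below becomes the chain rule.\<close>

lemma jacobian_matrix:
  assumes "\<phi> \<in> charts_at M x" "\<psi> \<in> charts_at M x"
  shows "(snd \<psi> \<circ> chart_inv \<phi> has_derivative (*v) (jacobian \<phi> \<psi> x)) (at (snd \<phi> x))"
proof -
  let ?F = "snd \<psi> \<circ> chart_inv \<phi>" and ?z = "snd \<phi> x"
  have "?F differentiable (at ?z)"
    unfolding o_def
    by (rule smooth_on_imp_differentiable[OF smooth_transition]) (use assms in auto)
  then have D: "(?F has_derivative frechet_derivative ?F (at ?z)) (at ?z)"
    by (simp add: frechet_derivative_works)
  then have lin: "linear (frechet_derivative ?F (at ?z))"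
    using has_derivative_linear by blast
  have "pd \<phi> i (\<lambda>y. snd \<psi> y $ j) x = frechet_derivative ?F (at ?z) (axis i 1) $ j" for i j
    using bounded_linear.has_derivative[OF bounded_linear_vec_nth D, of j]
    by (simp add: pd_def o_def frechet_derivative_eqI)
  then have "jacobian \<phi> \<psi> x = matrix (frechet_derivative ?F (at ?z))"
    by (simp add: jacobian_def matrix_def)
  then show ?thesis using D lin by (simp add: matrix_works)
qed

lemma jacobian_eqI:
  assumes "\<phi> \<in> charts_at M x" "\<psi> \<in> charts_at M x"
    and "(snd \<psi> \<circ> chart_inv \<phi> has_derivative (*v) A) (at (snd \<phi> x))"
  shows "jacobian \<phi> \<psi> x = A"
  using has_derivative_unique[OF jacobian_matrix[OF assms(1,2)] assms(3)]
  by (metis matrix_eq)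

lemma jacobian_self:
  assumes "\<phi> \<in> charts_at M x"
  shows "jacobian \<phi> \<phi> x = mat 1"
proof (rule jacobian_eqI[OF assms assms])
  have "((\<lambda>y. y) has_derivative (\<lambda>v. v)) (at (snd \<phi> x))" by (rule has_derivative_ident)
  then have "(snd \<phi> \<circ> chart_inv \<phi> has_derivative (\<lambda>v. v)) (at (snd \<phi> x))"
    by (rule has_derivative_transform_within_open[OF _ open_chart_image[of \<phi> "fst \<phi>"]])
      (use assms openin_chart[of \<phi>] charts_atD[OF assms] in auto)
  then show "(snd \<phi> \<circ> chart_inv \<phi> has_derivative (*v) (mat 1)) (at (snd \<phi> x))"
    by (simp add: matrix_vector_mul_lid[abs_def])
qed

lemma jacobian_cocycle:
  assumes "\<phi> \<in> charts_at M x" "\<psi> \<in> charts_at M x" "\<theta> \<in> charts_at M x"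
  shows "jacobian \<phi> \<theta> x = jacobian \<psi> \<theta> x ** jacobian \<phi> \<psi> x"
proof (rule jacobian_eqI[OF assms(1,3)])
  have "(snd \<theta> \<circ> chart_inv \<psi> has_derivative (*v) (jacobian \<psi> \<theta> x)) (at ((snd \<psi> \<circ> chart_inv \<phi>) (snd \<phi> x)))"
    using jacobian_matrix[OF assms(2,3)] charts_atD[OF assms(1)] by (simp add: o_def)
  from diff_chain_at[OF jacobian_matrix[OF assms(1,2)] this]
  have "((snd \<theta> \<circ> chart_inv \<psi>) \<circ> (snd \<psi> \<circ> chart_inv \<phi>)
      has_derivative (*v) (jacobian \<psi> \<theta> x ** jacobian \<phi> \<psi> x)) (at (snd \<phi> x))"
    by (simp add: o_def matrix_vector_mul_assoc)
  then show "(snd \<theta> \<circ> chart_inv \<phi> has_derivative (*v) (jacobian \<psi> \<theta> x ** jacobian \<phi> \<psi> x)) (at (snd \<phi> x))"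
  proof (rule has_derivative_transform_within_open)
    show "open (snd \<phi> ` (fst \<psi> \<inter> fst \<phi>))" "snd \<phi> x \<in> snd \<phi> ` (fst \<psi> \<inter> fst \<phi>)"
      using assms openin_chart[of \<psi>] by (auto intro: open_chart_image)
  qed (use charts_atD[OF assms(1)] charts_atD[OF assms(2)] in auto)
qed

lemma smooth_jacobian:
  assumes "\<phi> \<in> atlas M" "\<psi> \<in> atlas M"
  shows "smooth_on (snd \<phi> ` (fst \<psi> \<inter> fst \<phi>)) (\<lambda>y. jacobian \<phi> \<psi> (chart_inv \<phi> y) $ j $ i)"
proof -
  let ?S = "snd \<phi> ` (fst \<psi> \<inter> fst \<phi>)"
  have op: "open ?S" using assms openin_chart open_chart_image by blast
  have "smooth_on ?S (\<lambda>y. snd \<psi> (chart_inv \<phi> y) $ j)"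
    using smooth_transition[OF assms] op by (simp add: smooth_on_vec_iff)
  then have "smooth_on ?S (\<lambda>y. frechet_derivative (\<lambda>y. snd \<psi> (chart_inv \<phi> y) $ j) (at y) (axis i 1))"
    by (rule smooth_on_frechet_derivative)
  then show ?thesis
    by (rule smooth_on_cong[OF op, rotated])
      (use assms in \<open>auto simp: jacobian_def pd_def o_def\<close>)
qed

lemma smooth_jacobian':
  assumes "\<phi> \<in> atlas M" "\<psi> \<in> atlas M"
  shows "smooth_on (snd \<psi> ` (fst \<phi> \<inter> fst \<psi>)) (\<lambda>y. jacobian \<phi> \<psi> (chart_inv \<psi> y) $ j $ i)"
proof -
  let ?S = "snd \<psi> ` (fst \<phi> \<inter> fst \<psi>)"
  have op: "open ?S" using assms openin_chart open_chart_image by blast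
  have sub: "(\<lambda>y. snd \<phi> (chart_inv \<psi> y)) ` ?S \<subseteq> snd \<phi> ` (fst \<psi> \<inter> fst \<phi>)"
    using assms by auto
  have "smooth_on ?S (\<lambda>y. jacobian \<phi> \<psi> (chart_inv \<phi> (snd \<phi> (chart_inv \<psi> y))) $ j $ i)"
    using smooth_on_compose[OF op sub smooth_transition[OF assms(2,1)] smooth_jacobian[OF assms]] .
  then show ?thesis
    by (rule smooth_on_cong[OF op, rotated]) (use assms in auto)
qed

text \<open>The vector field and the one-form with constant components \<open>c\<close> in the chart \<open>\<phi>\<close>, over its domain. They
provide local sections through every point of a fibre, with which an involutivity condition can be
tested.\<close>

definition coordinate_vector :: "('m, 'n) chart \<Rightarrow> real^'n \<Rightarrow> 'm \<Rightarrow> ('m, 'n, real) comps" where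
  "coordinate_vector \<phi> c y = (\<lambda>\<psi>. if \<psi> \<in> charts_at M y then jacobian \<phi> \<psi> y *v c else 0)"

definition coordinate_form :: "('m, 'n) chart \<Rightarrow> real^'n \<Rightarrow> 'm \<Rightarrow> ('m, 'n, real) comps" where
  "coordinate_form \<phi> c y = (\<lambda>\<psi>. if \<psi> \<in> charts_at M y then c v* jacobian \<psi> \<phi> y else 0)"

lemma coordinate_self:
  assumes "\<phi> \<in> charts_at M y"
  shows "coordinate_vector \<phi> c y \<phi> = c" "coordinate_form \<phi> c y \<phi> = c"
  using assms jacobian_self by (auto simp: coordinate_vector_def coordinate_form_def)

lemma coordinate_vector_tangent: "\<phi> \<in> charts_at M y \<Longrightarrow> coordinate_vector \<phi> c y \<in> tangent_at M y"
  by (auto simp: tangent_at_def coordinate_vector_def matrix_vector_mul_assoc jacobian_cocycle[symmetric])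

lemma coordinate_form_cotangent: "\<phi> \<in> charts_at M y \<Longrightarrow> coordinate_form \<phi> c y \<in> cotangent_at M y"
  by (auto simp: cotangent_at_def coordinate_form_def vector_matrix_mul_assoc jacobian_cocycle[symmetric])

lemma smooth_coordinate_vector:
  assumes "\<phi> \<in> atlas M"
  shows "smooth_comps M (fst \<phi>) (coordinate_vector \<phi> c)"
  unfolding smooth_comps_nth[OF openin_chart[OF assms]]
proof safe
  fix \<psi> i assume \<psi>: "\<psi> \<in> atlas M"
  note op = open_chart_image[OF \<psi> openin_chart[OF assms]]
  have "smooth_on (snd \<psi> ` (fst \<phi> \<inter> fst \<psi>)) (\<lambda>y. \<Sum>j\<in>UNIV. jacobian \<phi> \<psi> (chart_inv \<psi> y) $ i $ j * c $ j)"
    by (intro smooth_intros op smooth_jacobian' assms \<psi>)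
  then show "smooth_on (snd \<psi> ` (fst \<phi> \<inter> fst \<psi>)) (\<lambda>y. coordinate_vector \<phi> c (chart_inv \<psi> y) \<psi> $ i)"
    by (rule smooth_on_cong[OF op, rotated])
      (use \<psi> assms in \<open>auto simp: coordinate_vector_def charts_at_def matrix_vector_mult_def\<close>)
qed

lemma smooth_coordinate_form:
  assumes "\<phi> \<in> atlas M"
  shows "smooth_comps M (fst \<phi>) (coordinate_form \<phi> c)"
  unfolding smooth_comps_nth[OF openin_chart[OF assms]]
proof safe
  fix \<psi> i assume \<psi>: "\<psi> \<in> atlas M"
  note op = open_chart_image[OF \<psi> openin_chart[OF assms]]
  have "smooth_on (snd \<psi> ` (fst \<phi> \<inter> fst \<psi>)) (\<lambda>y. \<Sum>j\<in>UNIV. c $ j * jacobian \<psi> \<phi> (chart_inv \<psi> y) $ j $ i)"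
    by (intro smooth_intros op smooth_jacobian assms \<psi>)
  then show "smooth_on (snd \<psi> ` (fst \<phi> \<inter> fst \<psi>)) (\<lambda>y. coordinate_form \<phi> c (chart_inv \<psi> y) \<psi> $ i)"
    by (rule smooth_on_cong[OF op, rotated])
      (use \<psi> assms in \<open>auto simp: coordinate_form_def charts_at_def vector_matrix_mult_def\<close>)
qed

end


section \<open>Linear algebra of a generalized complex structure\<close>

definition re_vec :: "complex^'n \<Rightarrow> real^'n" where "re_vec z = (\<chi> i. Re (z $ i))"
definition im_vec :: "complex^'n \<Rightarrow> real^'n" where "im_vec z = (\<chi> i. Im (z $ i))"
definition cnj_vec :: "complex^'n \<Rightarrow> complex^'n" where "cnj_vec z = (\<chi> i. cnj (z $ i))"
definition of_real_vec :: "real^'n \<Rightarrow> complex^'n" where "of_real_vec v = (\<chi> i. of_real (v $ i))"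

abbreviation complex_matrix :: "real^'n^'n \<Rightarrow> complex^'n^'n" where
  "complex_matrix \<equiv> map_matrix of_real"

lemma complex_vec_eq_iff: "z = w \<longleftrightarrow> re_vec z = re_vec w \<and> im_vec z = im_vec w"
  by (auto simp: re_vec_def im_vec_def vec_eq_iff complex_eq_iff)

lemma re_im_vec_simps [simp]:
  "re_vec (z + w) = re_vec z + re_vec w" "im_vec (z + w) = im_vec z + im_vec w"
  "re_vec (z - w) = re_vec z - re_vec w" "im_vec (z - w) = im_vec z - im_vec w"
  "re_vec (- z) = - re_vec z" "im_vec (- z) = - im_vec z"
  "re_vec 0 = 0" "im_vec 0 = 0"
  "re_vec (\<i> *s z) = - im_vec z" "im_vec (\<i> *s z) = re_vec z"
  "re_vec (of_real_vec v) = v" "im_vec (of_real_vec v) = 0"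
  "re_vec (cnj_vec z) = re_vec z" "im_vec (cnj_vec z) = - im_vec z"
  by (auto simp: re_vec_def im_vec_def of_real_vec_def cnj_vec_def vec_eq_iff)

lemma re_im_matrix_vec [simp]:
  "re_vec (complex_matrix A *v z) = A *v re_vec z" "im_vec (complex_matrix A *v z) = A *v im_vec z"
  "re_vec (z v* complex_matrix A) = re_vec z v* A" "im_vec (z v* complex_matrix A) = im_vec z v* A"
  by (auto simp: re_vec_def im_vec_def vec_eq_iff matrix_vector_mult_def vector_matrix_mult_def)

lemma complex_matrix_mult: "complex_matrix (A ** B) = complex_matrix A ** complex_matrix B"
  by (simp add: vec_eq_iff matrix_matrix_mult_def)

lemma complex_matrix_transpose: "complex_matrix (transpose A) = transpose (complex_matrix A)"
  by (simp add: vec_eq_iff transpose_def)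

lemma complex_matrix_minus: "complex_matrix (- A) = - complex_matrix A"
  by (simp add: vec_eq_iff)

lemma complexify_alt: "complexify s = (\<lambda>\<phi>. of_real_vec (fst s \<phi>), \<lambda>\<phi>. of_real_vec (snd s \<phi>))"
  by (simp add: complexify_def of_real_vec_def)

lemma vec_scale_matrix:
  fixes A :: "'k::field^'n^'n"
  shows "A *v (c *s x) = c *s (A *v x)" "(c *s x) v* A = c *s (x v* A)"
  by (auto simp: vec_eq_iff matrix_vector_mult_def vector_matrix_mult_def sum_distrib_left ac_simps)

lemma vec_minus_matrix:
  fixes A :: "'k::field^'n^'n"
  shows "A *v (- x) = - (A *v x)" "(- x) v* A = - (x v* A)"
  by (auto simp: vec_eq_iff matrix_vector_mult_def vector_matrix_mult_def sum_negf)

lemma matrix_add_vec: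
  fixes A :: "'k::field^'n^'n"
  shows "A *v (x + y) = A *v x + A *v y" "(x + y) v* A = x v* A + y v* A"
    "A *v (x - y) = A *v x - A *v y" "(x - y) v* A = x v* A - y v* A"
    "A *v 0 = 0" "0 v* A = 0"
  by (auto simp: vec_eq_iff matrix_vector_mult_def vector_matrix_mult_def
      sum.distrib sum_subtractf algebra_simps)

lemmas matrix_linear = vec_scale_matrix vec_minus_matrix matrix_add_vec

lemma cnj_vec_simps:
  "cnj_vec (z + w) = cnj_vec z + cnj_vec w" "cnj_vec (z - w) = cnj_vec z - cnj_vec w"
  "cnj_vec (- z) = - cnj_vec z" "cnj_vec (\<i> *s z) = - (\<i> *s cnj_vec z)"
  "cnj_vec (complex_matrix A *v z) = complex_matrix A *v cnj_vec z"
  "cnj_vec (z v* complex_matrix A) = cnj_vec z v* complex_matrix A"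
  by (simp_all add: complex_vec_eq_iff matrix_linear)

lemma cnj_vec_inj: "cnj_vec z = cnj_vec w \<longleftrightarrow> z = w"
  by (simp add: complex_vec_eq_iff)

definition dot :: "'k::field^'n \<Rightarrow> 'k^'n \<Rightarrow> 'k" where
  "dot x y = (\<Sum>i\<in>UNIV. x $ i * y $ i)"

lemma dot_linear:
  "dot (x + y) z = dot x z + dot y z" "dot z (x + y) = dot z x + dot z y"
  "dot (x - y) z = dot x z - dot y z" "dot z (x - y) = dot z x - dot z y"
  "dot (- x) z = - dot x z" "dot z (- x) = - dot z x"
  "dot (c *s x) z = c * dot x z" "dot z (c *s x) = c * dot z x"
  "dot 0 z = 0" "dot z 0 = 0"
  by (auto simp: dot_def sum.distrib sum_subtractf sum_negf sum_distrib_left algebra_simps)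

lemma dot_commute: "dot x y = dot y x"
  by (simp add: dot_def mult.commute)

lemma dot_matrix: "dot (x v* A) y = dot x (A *v y)"
  unfolding dot_def vector_matrix_mult_def matrix_vector_mult_def
  by (simp add: sum_distrib_left sum_distrib_right mult.assoc) (rule sum.swap)

lemma dot_skew:
  assumes "transpose A = - A"
  shows "dot (x v* A) y = - dot (y v* A) x"
proof -
  have "dot (x v* A) y = dot (A *v y) x" by (simp add: dot_matrix dot_commute[of x])
  also have "A *v y = y v* (- A)" by (simp flip: assms)
  also have "\<dots> = - (y v* A)"
    by (simp add: vec_eq_iff vector_matrix_mult_def sum_negf)
  finally show ?thesis by (simp add: dot_linear)
qed

lemma dot_nondegenerate:
  fixes x :: "'k::field^'n::finite"
  assumes "\<And>y. dot x y = 0"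
  shows "x = 0"
proof -
  have "dot x (axis i 1) = x $ i" for i
    by (simp add: dot_def axis_def if_distrib cong: if_cong)
  then show ?thesis using assms by (simp add: vec_eq_iff)
qed

lemma pairing_dot: "pairing \<phi> s t = dot (snd s \<phi>) (fst t \<phi>) + dot (snd t \<phi>) (fst s \<phi>)"
  by (simp add: pairing_def dot_def sum.distrib)

text \<open>The matrices \<open>A\<close>, \<open>P\<close>, \<open>W\<close> of \<open>a\<close>, \<open>\<pi>\<close>, \<open>\<omega>\<close> in one chart at one point, subject to the four block
components of \<open>J\<^sup>2 = - id\<close>. The field is left open because the identities are used over the reals and
over the complex numbers.\<close>

locale complex_block_matrix =
  fixes A P W :: "'k::field^'n^'n::finite"
  assumes P_skew: "transpose P = - P" and W_skew: "transpose W = - W"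
    and AA: "\<And>u. A *v (A *v u) + u v* W v* P = - u"
    and AP: "\<And>\<xi>. A *v (\<xi> v* P) = \<xi> v* A v* P"
    and WA: "\<And>u. (A *v u) v* W = u v* W v* A"
    and WP: "\<And>\<xi>. \<xi> v* P v* W + \<xi> v* A v* A = - \<xi>"
begin

lemma AA': "A *v (A *v u) = - u - u v* W v* P"
  using AA[of u] by (simp add: eq_diff_eq)

lemma PW': "\<xi> v* P v* W = - \<xi> - \<xi> v* A v* A"
  using WP[of \<xi>] by (simp add: eq_diff_eq)

end

text \<open>Every identity in complex vectors splits into its real and imaginary parts, because the matrices
are real.\<close>

lemma complex_block_matrix_complexify:
  assumes "complex_block_matrix A P W"
  shows "complex_block_matrix (complex_matrix A) (complex_matrix P) (complex_matrix W)"
proof -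
  interpret complex_block_matrix A P W by fact
  show ?thesis
  proof
    show "transpose (complex_matrix P) = - complex_matrix P"
      "transpose (complex_matrix W) = - complex_matrix W"
      using P_skew W_skew by (simp_all flip: complex_matrix_transpose complex_matrix_minus)
  qed (auto simp: complex_vec_eq_iff AA AP WA WP)
qed


context manifold_charts
begin

text \<open>The transformation laws relate components at arbitrary pairs of charts, so as rewrite rules they
would loop. The following rules only instantiate them at given charts.\<close>

lemma tangent_atI:
  assumes "\<And>\<phi>. \<phi> \<notin> charts_at M x \<Longrightarrow> u \<phi> = 0"
    and "\<And>\<phi> \<psi>. \<phi> \<in> charts_at M x \<Longrightarrow> \<psi> \<in> charts_at M x \<Longrightarrow>
      u \<psi> = map_matrix of_real (jacobian \<phi> \<psi> x) *v u \<phi>"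
  shows "u \<in> tangent_at M x"
  using assms unfolding tangent_at_def by blast

lemma tangent_atD:
  assumes "u \<in> tangent_at M x"
  shows "\<phi> \<notin> charts_at M x \<Longrightarrow> u \<phi> = 0"
    and "\<phi> \<in> charts_at M x \<Longrightarrow> \<psi> \<in> charts_at M x \<Longrightarrow>
      u \<psi> = map_matrix of_real (jacobian \<phi> \<psi> x) *v u \<phi>"
  using assms unfolding tangent_at_def by blast+

lemma cotangent_atI:
  assumes "\<And>\<phi>. \<phi> \<notin> charts_at M x \<Longrightarrow> \<xi> \<phi> = 0"
    and "\<And>\<phi> \<psi>. \<phi> \<in> charts_at M x \<Longrightarrow> \<psi> \<in> charts_at M x \<Longrightarrow>
      \<xi> \<phi> = \<xi> \<psi> v* map_matrix of_real (jacobian \<phi> \<psi> x)"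
  shows "\<xi> \<in> cotangent_at M x"
  using assms unfolding cotangent_at_def by blast

lemma cotangent_atD:
  assumes "\<xi> \<in> cotangent_at M x"
  shows "\<phi> \<notin> charts_at M x \<Longrightarrow> \<xi> \<phi> = 0"
    and "\<phi> \<in> charts_at M x \<Longrightarrow> \<psi> \<in> charts_at M x \<Longrightarrow>
      \<xi> \<phi> = \<xi> \<psi> v* map_matrix of_real (jacobian \<phi> \<psi> x)"
  using assms unfolding cotangent_at_def by blast+

lemma zero_tangent: "0 \<in> tangent_at M x"
  by (rule tangent_atI) (simp_all add: matrix_linear)

lemma zero_cotangent: "0 \<in> cotangent_at M x"
  by (rule cotangent_atI) (simp_all add: matrix_linear)

lemma tangent_at_linear:
  assumes "u \<in> tangent_at M x" "v \<in> tangent_at M x"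
  shows "(\<lambda>\<phi>. c *s u \<phi> + d *s v \<phi>) \<in> tangent_at M x"
proof (rule tangent_atI)
  fix \<phi> \<psi> assume *: "\<phi> \<in> charts_at M x" "\<psi> \<in> charts_at M x"
  show "c *s u \<psi> + d *s v \<psi> = map_matrix of_real (jacobian \<phi> \<psi> x) *v (c *s u \<phi> + d *s v \<phi>)"
    unfolding tangent_atD(2)[OF assms(1) *] tangent_atD(2)[OF assms(2) *] by (simp add: matrix_linear)
qed (simp add: tangent_atD(1)[OF assms(1)] tangent_atD(1)[OF assms(2)])

lemma cotangent_at_linear:
  assumes "\<xi> \<in> cotangent_at M x" "\<eta> \<in> cotangent_at M x"
  shows "(\<lambda>\<phi>. c *s \<xi> \<phi> + d *s \<eta> \<phi>) \<in> cotangent_at M x"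
proof (rule cotangent_atI)
  fix \<phi> \<psi> assume *: "\<phi> \<in> charts_at M x" "\<psi> \<in> charts_at M x"
  show "c *s \<xi> \<phi> + d *s \<eta> \<phi> = (c *s \<xi> \<psi> + d *s \<eta> \<psi>) v* map_matrix of_real (jacobian \<phi> \<psi> x)"
    unfolding cotangent_atD(2)[OF assms(1) *] cotangent_atD(2)[OF assms(2) *] by (simp add: matrix_linear)
qed (simp add: cotangent_atD(1)[OF assms(1)] cotangent_atD(1)[OF assms(2)])

lemma tangent_at_map:
  assumes "u \<in> tangent_at M x" "h 0 = 0"
    and "\<And>C z. h (map_matrix of_real C *v z) = map_matrix of_real C *v h z"
  shows "(\<lambda>\<phi>. h (u \<phi>)) \<in> tangent_at M x"
proof (rule tangent_atI)
  fix \<phi> \<psi> assume *: "\<phi> \<in> charts_at M x" "\<psi> \<in> charts_at M x"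
  show "h (u \<psi>) = map_matrix of_real (jacobian \<phi> \<psi> x) *v h (u \<phi>)"
    unfolding tangent_atD(2)[OF assms(1) *] by (rule assms(3))
qed (simp add: tangent_atD(1)[OF assms(1)] assms(2))

lemma cotangent_at_map:
  assumes "\<xi> \<in> cotangent_at M x" "h 0 = 0"
    and "\<And>C z. h (z v* map_matrix of_real C) = h z v* map_matrix of_real C"
  shows "(\<lambda>\<phi>. h (\<xi> \<phi>)) \<in> cotangent_at M x"
proof (rule cotangent_atI)
  fix \<phi> \<psi> assume *: "\<phi> \<in> charts_at M x" "\<psi> \<in> charts_at M x"
  show "h (\<xi> \<phi>) = h (\<xi> \<psi>) v* map_matrix of_real (jacobian \<phi> \<psi> x)"
    unfolding cotangent_atD(2)[OF assms(1) *] by (rule assms(3))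
qed (simp add: cotangent_atD(1)[OF assms(1)] assms(2))

lemma tangent_re_im:
  fixes V :: "('m, 'n, complex) comps"
  assumes "V \<in> tangent_at M x"
  shows "(\<lambda>\<phi>. re_vec (V \<phi>)) \<in> tangent_at M x" "(\<lambda>\<phi>. im_vec (V \<phi>)) \<in> tangent_at M x"
    "(\<lambda>\<phi>. cnj_vec (V \<phi>)) \<in> tangent_at M x"
  by (rule tangent_at_map[OF assms]; simp add: complex_vec_eq_iff matrix_linear)+

lemma cotangent_re_im:
  fixes \<xi> :: "('m, 'n, complex) comps"
  assumes "\<xi> \<in> cotangent_at M x"
  shows "(\<lambda>\<phi>. re_vec (\<xi> \<phi>)) \<in> cotangent_at M x" "(\<lambda>\<phi>. im_vec (\<xi> \<phi>)) \<in> cotangent_at M x"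
    "(\<lambda>\<phi>. cnj_vec (\<xi> \<phi>)) \<in> cotangent_at M x"
  by (rule cotangent_at_map[OF assms]; simp add: complex_vec_eq_iff matrix_linear)+

lemma tangent_of_real:
  assumes "u \<in> tangent_at M x"
  shows "(\<lambda>\<phi>. of_real_vec (u \<phi>)) \<in> tangent_at M x"
  by (rule tangent_at_map[OF assms]; simp add: complex_vec_eq_iff matrix_linear)

lemma comps_eqI:
  assumes "u \<in> tangent_at M x \<or> u \<in> cotangent_at M x" "v \<in> tangent_at M x \<or> v \<in> cotangent_at M x"
    and "\<And>\<phi>. \<phi> \<in> charts_at M x \<Longrightarrow> u \<phi> = v \<phi>"
  shows "u = v"
proof
  fix \<phi> show "u \<phi> = v \<phi>"
  proof (cases "\<phi> \<in> charts_at M x")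
    case False
    then have "u \<phi> = 0" "v \<phi> = 0"
      using assms(1,2) tangent_atD(1) cotangent_atD(1) by blast+
    then show ?thesis by simp
  qed (rule assms(3))
qed

end

locale generalized_complex_blocks = manifold_charts M
  for M :: "('m, 'n::finite) manifold" +
  fixes L :: "('m \<times> ('m, 'n, complex) gcomps) set"
    and a \<pi> \<omega> :: "'m \<Rightarrow> ('m, 'n, real) mcomps"
  assumes gc: "generalized_complex M L"
    and a: "endomorphism_field M a" and \<pi>: "bivector_field M \<pi>" and \<omega>: "two_form M \<omega>"
    and L_eq: "L = eigen_family M (block_endo a \<pi> \<omega>)"
begin

abbreviation "J \<equiv> block_endo a \<pi> \<omega>"

definition eigen_vector :: "'m \<Rightarrow> ('m, 'n, real) gcomps \<Rightarrow> ('m, 'n, complex) gcomps" where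
  "eigen_vector x s = complexify (J x s) + gscale \<i> (complexify s)"

lemma L_lagrangian: "complex_lagrangian_family M L" and L_involutive: "involutive M L"
  using gc by (auto simp: generalized_complex_def complex_dirac_def)

lemma L_mem_iff: "(x, S) \<in> L \<longleftrightarrow> x \<in> points M \<and> (\<exists>s\<in>gtangent_at M x. S = eigen_vector x s)"
  unfolding L_eq eigen_family_def eigen_vector_def by auto

lemma eigen_vector_apply:
  "fst (eigen_vector x s) \<phi> =
     of_real_vec (a x \<phi> *v fst s \<phi> + snd s \<phi> v* \<pi> x \<phi>) + \<i> *s of_real_vec (fst s \<phi>)"
  "snd (eigen_vector x s) \<phi> =
     of_real_vec (fst s \<phi> v* \<omega> x \<phi> - snd s \<phi> v* a x \<phi>) + \<i> *s of_real_vec (snd s \<phi>)"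
  by (simp_all add: eigen_vector_def gscale_def complexify_alt block_endo_def endo_def contract_def dual_endo_def)

text \<open>The fibre of \<open>L\<close> is closed under multiplication by \<open>\<i>\<close>: thus \<open>\<i> (J s + \<i> s) = J t + \<i> t\<close> for some real
\<open>t\<close>, and comparing real and imaginary parts gives \<open>t = J s\<close> and \<open>J t = - s\<close>.\<close>

lemma block_square:
  assumes \<phi>: "\<phi> \<in> charts_at M x"
    and v: "v = a x \<phi> *v u + \<xi> v* \<pi> x \<phi>" and \<eta>: "\<eta> = u v* \<omega> x \<phi> - \<xi> v* a x \<phi>"
  shows "a x \<phi> *v v + \<eta> v* \<pi> x \<phi> = - u" "v v* \<omega> x \<phi> - \<eta> v* a x \<phi> = - \<xi>"
proof -
  let ?s = "(coordinate_vector \<phi> u x, coordinate_form \<phi> \<xi> x)"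
  have x: "x \<in> points M" using \<phi> points_chart by blast
  have "?s \<in> gtangent_at M x"
    using \<phi> by (simp add: gtangent_at_def coordinate_vector_tangent coordinate_form_cotangent)
  then have "eigen_vector x ?s \<in> fibre L x" using L_mem_iff x by (auto simp: fibre_def)
  then have "gscale \<i> (eigen_vector x ?s) \<in> fibre L x"
    using L_lagrangian x by (simp add: complex_lagrangian_family_def complex_subspace_def)
  then obtain t where t: "gscale \<i> (eigen_vector x ?s) = eigen_vector x t"
    using L_mem_iff by (auto simp: fibre_def)
  have 1: "\<i> *s fst (eigen_vector x ?s) \<phi> = fst (eigen_vector x t) \<phi>"
    and 2: "\<i> *s snd (eigen_vector x ?s) \<phi> = snd (eigen_vector x t) \<phi>"
    unfolding t[symmetric] by (simp_all add: gscale_def)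
  show "a x \<phi> *v v + \<eta> v* \<pi> x \<phi> = - u" "v v* \<omega> x \<phi> - \<eta> v* a x \<phi> = - \<xi>"
    using 1 2 unfolding v \<eta> by (auto simp: eigen_vector_apply complex_vec_eq_iff coordinate_self \<phi>)
qed

lemma block_matrix:
  assumes \<phi>: "\<phi> \<in> charts_at M x"
  shows "complex_block_matrix (a x \<phi>) (\<pi> x \<phi>) (\<omega> x \<phi>)"
proof
  have x: "x \<in> points M" using \<phi> points_chart by blast
  show "transpose (\<pi> x \<phi>) = - \<pi> x \<phi>" "transpose (\<omega> x \<phi>) = - \<omega> x \<phi>"
    using \<pi> \<omega> \<phi> x unfolding bivector_field_def two_form_def by blast+
  note sq = block_square[OF \<phi> refl refl]
  show "a x \<phi> *v (a x \<phi> *v u) + u v* \<omega> x \<phi> v* \<pi> x \<phi> = - u" for u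
    using sq(1)[of u 0] by (simp add: matrix_linear)
  show "(a x \<phi> *v u) v* \<omega> x \<phi> = u v* \<omega> x \<phi> v* a x \<phi>" for u
    using sq(2)[of u 0] by (simp add: matrix_linear)
  show "a x \<phi> *v (\<xi> v* \<pi> x \<phi>) = \<xi> v* a x \<phi> v* \<pi> x \<phi>" for \<xi>
    using sq(1)[of 0 \<xi>] by (simp add: matrix_linear)
  show "\<xi> v* \<pi> x \<phi> v* \<omega> x \<phi> + \<xi> v* a x \<phi> v* a x \<phi> = - \<xi>" for \<xi>
    using sq(2)[of 0 \<xi>] by (simp add: matrix_linear)
qed

lemmas complex_block_matrix = complex_block_matrix_complexify[OF block_matrix]

lemma complex_multiple_apply:
  "contract (complex_multiple c P x) \<xi> \<phi> = c *s (\<xi> \<phi> v* complex_matrix (P x \<phi>))"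
  "endo (complex_multiple c P x) \<xi> \<phi> = c *s (complex_matrix (P x \<phi>) *v \<xi> \<phi>)"
  by (auto simp: contract_def endo_def complex_multiple_def vec_eq_iff vector_matrix_mult_def
     matrix_vector_mult_def sum_distrib_left ac_simps)

lemma endo_tangent:
  assumes "u \<in> tangent_at M x"
  shows "(\<lambda>\<phi>. complex_matrix (a x \<phi>) *v u \<phi>) \<in> tangent_at M x"
proof -
  have "complex_matrix (a x \<psi>) *v (complex_matrix (jacobian \<phi> \<psi> x) *v w) =
    complex_matrix (jacobian \<phi> \<psi> x) *v (complex_matrix (a x \<phi>) *v w)"
    if "\<phi> \<in> charts_at M x" "\<psi> \<in> charts_at M x" for \<phi> \<psi> w
  proof -
    have "a x \<psi> ** jacobian \<phi> \<psi> x = jacobian \<phi> \<psi> x ** a x \<phi>"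
      using a that points_chart unfolding endomorphism_field_def by blast
    then show ?thesis by (simp add: matrix_vector_mul_assoc flip: complex_matrix_mult)
  qed
  from this[symmetric] show ?thesis
    by (intro tangent_atI) (simp_all add: tangent_atD(1)[OF assms] matrix_linear tangent_atD(2)[OF assms, symmetric])
qed

lemma dual_endo_cotangent:
  assumes "\<xi> \<in> cotangent_at M x"
  shows "(\<lambda>\<phi>. \<xi> \<phi> v* complex_matrix (a x \<phi>)) \<in> cotangent_at M x"
proof -
  have "w v* complex_matrix (jacobian \<phi> \<psi> x) v* complex_matrix (a x \<phi>) =
    w v* complex_matrix (a x \<psi>) v* complex_matrix (jacobian \<phi> \<psi> x)"
    if "\<phi> \<in> charts_at M x" "\<psi> \<in> charts_at M x" for \<phi> \<psi> w
  proof -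
    have "a x \<psi> ** jacobian \<phi> \<psi> x = jacobian \<phi> \<psi> x ** a x \<phi>"
      using a that points_chart unfolding endomorphism_field_def by blast
    then show ?thesis by (simp add: vector_matrix_mul_assoc flip: complex_matrix_mult)
  qed
  from this[symmetric] show ?thesis
    by (intro cotangent_atI) (simp_all add: cotangent_atD(1)[OF assms] matrix_linear cotangent_atD(2)[OF assms, symmetric])
qed

lemma sharp_tangent:
  assumes "\<xi> \<in> cotangent_at M x"
  shows "(\<lambda>\<phi>. \<xi> \<phi> v* complex_matrix (\<pi> x \<phi>)) \<in> tangent_at M x"
proof (rule tangent_atI)
  fix \<phi> \<psi> assume *: "\<phi> \<in> charts_at M x" "\<psi> \<in> charts_at M x"
  have eq: "\<pi> x \<psi> = jacobian \<phi> \<psi> x ** \<pi> x \<phi> ** transpose (jacobian \<phi> \<psi> x)"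
    using \<pi> * points_chart unfolding bivector_field_def by blast
  have "C *v y = y v* transpose C" for C :: "complex^'n^'n" and y by simp
  then show "\<xi> \<psi> v* complex_matrix (\<pi> x \<psi>) =
      complex_matrix (jacobian \<phi> \<psi> x) *v (\<xi> \<phi> v* complex_matrix (\<pi> x \<phi>))"
    unfolding eq cotangent_atD(2)[OF assms *]
    by (simp only: vector_matrix_mul_assoc complex_matrix_mult complex_matrix_transpose matrix_mul_assoc)
qed (simp add: cotangent_atD(1)[OF assms] matrix_linear)

lemma flat_cotangent:
  assumes "u \<in> tangent_at M x"
  shows "(\<lambda>\<phi>. u \<phi> v* complex_matrix (\<omega> x \<phi>)) \<in> cotangent_at M x"
proof (rule cotangent_atI)
  fix \<phi> \<psi> assume *: "\<phi> \<in> charts_at M x" "\<psi> \<in> charts_at M x"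
  have eq: "\<omega> x \<phi> = transpose (jacobian \<phi> \<psi> x) ** \<omega> x \<psi> ** jacobian \<phi> \<psi> x"
    using \<omega> * points_chart unfolding two_form_def by blast
  have "C *v y = y v* transpose C" for C :: "complex^'n^'n" and y by simp
  then show "u \<phi> v* complex_matrix (\<omega> x \<phi>) =
      (u \<psi> v* complex_matrix (\<omega> x \<psi>)) v* complex_matrix (jacobian \<phi> \<psi> x)"
    unfolding eq tangent_atD(2)[OF assms *]
    by (simp only: vector_matrix_mul_assoc complex_matrix_mult complex_matrix_transpose matrix_mul_assoc)
qed (simp add: tangent_atD(1)[OF assms] matrix_linear)

text \<open>The elements \<open>J s + \<i> s\<close> with \<open>s\<close> real are exactly the complex solutions of \<open>J z = \<i> z\<close>: the real vector
\<open>s\<close> is recovered as the imaginary part of \<open>z\<close>.\<close>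

lemma mem_L_iff:
  "(x, (V, \<Xi>)) \<in> L \<longleftrightarrow> x \<in> points M \<and> V \<in> tangent_at M x \<and> \<Xi> \<in> cotangent_at M x \<and>
    (\<forall>\<phi>\<in>charts_at M x.
      complex_matrix (a x \<phi>) *v V \<phi> + \<Xi> \<phi> v* complex_matrix (\<pi> x \<phi>) = \<i> *s V \<phi> \<and>
      V \<phi> v* complex_matrix (\<omega> x \<phi>) - \<Xi> \<phi> v* complex_matrix (a x \<phi>) = \<i> *s \<Xi> \<phi>)"
    (is "?l \<longleftrightarrow> ?r")
proof
  assume ?l
  then obtain s where s: "s \<in> gtangent_at M x" "(V, \<Xi>) = eigen_vector x s" and x: "x \<in> points M"
    using L_mem_iff by auto
  have "(V, \<Xi>) \<in> gtangent_at M x"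
    using \<open>?l\<close> L_lagrangian by (auto simp: complex_lagrangian_family_def total_space_def)
  then have VX: "V \<in> tangent_at M x" "\<Xi> \<in> cotangent_at M x" by (auto simp: gtangent_at_def)
  have V: "V = fst (eigen_vector x s)" "\<Xi> = snd (eigen_vector x s)"
    using s by (metis fst_conv snd_conv)+
  have "complex_matrix (a x \<phi>) *v V \<phi> + \<Xi> \<phi> v* complex_matrix (\<pi> x \<phi>) = \<i> *s V \<phi> \<and>
      V \<phi> v* complex_matrix (\<omega> x \<phi>) - \<Xi> \<phi> v* complex_matrix (a x \<phi>) = \<i> *s \<Xi> \<phi>"
    if "\<phi> \<in> charts_at M x" for \<phi>
    using block_square[OF that refl refl, of "fst s \<phi>" "snd s \<phi>"]
    by (simp add: V complex_vec_eq_iff eigen_vector_apply)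
  then show ?r using x VX by blast
next
  assume r: ?r
  let ?s = "(\<lambda>\<phi>. im_vec (V \<phi>), \<lambda>\<phi>. im_vec (\<Xi> \<phi>))"
  have "?s \<in> gtangent_at M x"
    using tangent_re_im(2) cotangent_re_im(2) r unfolding gtangent_at_def by blast
  moreover have *: "fst (eigen_vector x ?s) \<phi> = V \<phi> \<and> snd (eigen_vector x ?s) \<phi> = \<Xi> \<phi>" for \<phi>
  proof (cases "\<phi> \<in> charts_at M x")
    case True
    then have "complex_matrix (a x \<phi>) *v V \<phi> + \<Xi> \<phi> v* complex_matrix (\<pi> x \<phi>) = \<i> *s V \<phi>"
      "V \<phi> v* complex_matrix (\<omega> x \<phi>) - \<Xi> \<phi> v* complex_matrix (a x \<phi>) = \<i> *s \<Xi> \<phi>"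
      using r by blast+
    then show ?thesis by (simp add: complex_vec_eq_iff eigen_vector_apply)
  next
    case False
    then have "V \<phi> = 0" "\<Xi> \<phi> = 0" using r tangent_atD(1) cotangent_atD(1) by blast+
    then show ?thesis by (simp add: complex_vec_eq_iff eigen_vector_apply matrix_linear)
  qed
  have "eigen_vector x ?s = (V, \<Xi>)" by (intro prod_eqI ext) (simp_all add: *)
  ultimately show ?l using r L_mem_iff by metis
qed

lemma mem_conj_L_iff:
  "(x, (V, \<Xi>)) \<in> conj_family L \<longleftrightarrow> x \<in> points M \<and> V \<in> tangent_at M x \<and> \<Xi> \<in> cotangent_at M x \<and>
    (\<forall>\<phi>\<in>charts_at M x.
      complex_matrix (a x \<phi>) *v V \<phi> + \<Xi> \<phi> v* complex_matrix (\<pi> x \<phi>) = - (\<i> *s V \<phi>) \<and>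
      V \<phi> v* complex_matrix (\<omega> x \<phi>) - \<Xi> \<phi> v* complex_matrix (a x \<phi>) = - (\<i> *s \<Xi> \<phi>))"
    (is "?l \<longleftrightarrow> ?r")
proof -
  have cc: "cnj_vec (cnj_vec z) = z" for z :: "complex^'n" by (simp add: cnj_vec_def vec_eq_iff)
  have "?l \<longleftrightarrow> (x, (\<lambda>\<phi>. cnj_vec (V \<phi>), \<lambda>\<phi>. cnj_vec (\<Xi> \<phi>))) \<in> L"
    unfolding conj_family_def cnj_vec_def[symmetric]
  proof safe
    assume "(x, (\<lambda>\<phi>. cnj_vec (V \<phi>), \<lambda>\<phi>. cnj_vec (\<Xi> \<phi>))) \<in> L"
    then show "\<exists>x' u \<xi>. (x, V, \<Xi>) = (x', (\<lambda>\<phi>. cnj_vec (u \<phi>), \<lambda>\<phi>. cnj_vec (\<xi> \<phi>))) \<and> (x', (u, \<xi>)) \<in> L"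
      by (intro exI[of _ x] exI[of _ "\<lambda>\<phi>. cnj_vec (V \<phi>)"] exI[of _ "\<lambda>\<phi>. cnj_vec (\<Xi> \<phi>)"]) (simp add: cc)
  qed (simp add: cc)
  also have "\<dots> \<longleftrightarrow> ?r"
  proof -
    have "(\<lambda>\<phi>. cnj_vec (V \<phi>)) \<in> tangent_at M x \<longleftrightarrow> V \<in> tangent_at M x"
      using tangent_re_im(3)[of V] tangent_re_im(3)[of "\<lambda>\<phi>. cnj_vec (V \<phi>)"] by (auto simp: cc)
    moreover have eqs: "A *v cnj_vec v + cnj_vec \<xi> v* P = \<i> *s cnj_vec v \<longleftrightarrow> A *v v + \<xi> v* P = - (\<i> *s v)"
        "cnj_vec v v* P - cnj_vec \<xi> v* A = \<i> *s cnj_vec \<xi> \<longleftrightarrow> v v* P - \<xi> v* A = - (\<i> *s \<xi>)"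
      if "A = complex_matrix B" "P = complex_matrix C" for A P B C and v \<xi> :: "complex^'n"
      using cnj_vec_inj[of "A *v v + \<xi> v* P" "- (\<i> *s v)"]
        cnj_vec_inj[of "v v* P - \<xi> v* A" "- (\<i> *s \<xi>)"] that by (simp_all add: cnj_vec_simps)
    moreover have "(\<lambda>\<phi>. cnj_vec (\<Xi> \<phi>)) \<in> cotangent_at M x \<longleftrightarrow> \<Xi> \<in> cotangent_at M x"
      using cotangent_re_im(3)[of \<Xi>] cotangent_re_im(3)[of "\<lambda>\<phi>. cnj_vec (\<Xi> \<phi>)"] by (auto simp: cc)
    ultimately show ?thesis
      unfolding mem_L_iff eqs[OF refl refl] by simp
  qed
  finally show ?thesis .
qed

end


section \<open>The products of L with its conjugate\<close>

lemma mem_tangent_product: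
  "(x, (V, \<Xi>)) \<in> L \<star> R \<longleftrightarrow> (\<exists>\<Xi>1 \<Xi>2. (x, (V, \<Xi>1)) \<in> L \<and> (x, (V, \<Xi>2)) \<in> R \<and> \<Xi> = \<Xi>1 + \<Xi>2)"
  unfolding tangent_product_def by force

lemma mem_cotangent_product:
  "(x, (V, \<Xi>)) \<in> L \<circledast> R \<longleftrightarrow> (\<exists>V1 V2. (x, (V1, \<Xi>)) \<in> L \<and> (x, (V2, \<Xi>)) \<in> R \<and> V = V1 + V2)"
  unfolding cotangent_product_def by force

lemma mem_reverse: "(x, (V, \<Xi>)) \<in> reverse L \<longleftrightarrow> (x, (- V, \<Xi>)) \<in> L"
  unfolding reverse_def by (auto intro: exI[of _ "- V"])

lemma i_mult_i: "\<i> * (\<i> * z) = - z"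
  by (simp flip: mult.assoc)

text \<open>The lifts in the next three lemmas come from solving the linear equations of the two eigenspaces.
Adding or subtracting these equations determines one half of each lift, and the other half is given
by the vector to be lifted.\<close>

lemma tangent_product_lift:
  fixes A P W :: "complex^'n^'n"
  assumes "complex_block_matrix A P W"
    and v: "v = (1 / (2 * \<i>)) *s (\<xi> v* P)"
    and \<xi>1: "\<xi>1 = (1/2) *s \<xi> + (\<i>/2) *s (\<xi> v* A)" and \<xi>2: "\<xi>2 = (1/2) *s \<xi> + (-\<i>/2) *s (\<xi> v* A)"
  shows "A *v v + \<xi>1 v* P = \<i> *s v" "v v* W - \<xi>1 v* A = \<i> *s \<xi>1"
    and "A *v (- v) + \<xi>2 v* P = - (\<i> *s (- v))" "(- v) v* W - \<xi>2 v* A = - (\<i> *s \<xi>2)"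
proof -
  interpret complex_block_matrix A P W by fact
  show "A *v v + \<xi>1 v* P = \<i> *s v" "v v* W - \<xi>1 v* A = \<i> *s \<xi>1"
    "A *v (- v) + \<xi>2 v* P = - (\<i> *s (- v))" "(- v) v* W - \<xi>2 v* A = - (\<i> *s \<xi>2)"
    unfolding v \<xi>1 \<xi>2
    by (simp_all add: matrix_linear AP PW' vec_eq_iff algebra_simps i_mult_i divide_simps)
qed

lemma cotangent_product_lift:
  fixes A P W :: "complex^'n^'n"
  assumes "complex_block_matrix A P W"
    and \<xi>: "\<xi> = (1 / (2 * \<i>)) *s (u v* W)"
    and v1: "v1 = (1/2) *s u + (-\<i>/2) *s (A *v u)" and v2: "v2 = (1/2) *s u + (\<i>/2) *s (A *v u)"
  shows "A *v v1 + \<xi> v* P = \<i> *s v1" "v1 v* W - \<xi> v* A = \<i> *s \<xi>"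
    and "A *v (- v2) + \<xi> v* P = - (\<i> *s (- v2))" "(- v2) v* W - \<xi> v* A = - (\<i> *s \<xi>)"
proof -
  interpret complex_block_matrix A P W by fact
  show "A *v v1 + \<xi> v* P = \<i> *s v1" "v1 v* W - \<xi> v* A = \<i> *s \<xi>"
    "A *v (- v2) + \<xi> v* P = - (\<i> *s (- v2))" "(- v2) v* W - \<xi> v* A = - (\<i> *s \<xi>)"
    unfolding \<xi> v1 v2
    by (simp_all add: matrix_linear WA AA' vec_eq_iff algebra_simps i_mult_i divide_simps)
qed

lemma conjugate_product_lift:
  fixes A P W :: "complex^'n^'n"
  assumes "complex_block_matrix A P W"
    and \<xi>: "\<xi> = (1 / 2) *s (p v* W)"
    and v1: "v1 = (1/2) *s (A *v p) + (\<i>/2) *s p" and v2: "v2 = (1/2) *s (A *v p) + (-\<i>/2) *s p"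
  shows "A *v v1 + \<xi> v* P = \<i> *s v1" "v1 v* W - \<xi> v* A = \<i> *s \<xi>"
    and "A *v v2 + \<xi> v* P = - (\<i> *s v2)" "v2 v* W - \<xi> v* A = - (\<i> *s \<xi>)"
proof -
  interpret complex_block_matrix A P W by fact
  show "A *v v1 + \<xi> v* P = \<i> *s v1" "v1 v* W - \<xi> v* A = \<i> *s \<xi>"
    "A *v v2 + \<xi> v* P = - (\<i> *s v2)" "v2 v* W - \<xi> v* A = - (\<i> *s \<xi>)"
    unfolding \<xi> v1 v2
    by (simp_all add: matrix_linear WA AA' vec_eq_iff algebra_simps i_mult_i divide_simps)
qed

lemma vec_solve:
  fixes b c v w x z :: "complex^'n"
  shows "b + v = \<i> *s z \<Longrightarrow> - b + w = \<i> *s z \<Longrightarrow> z = (1 / (2 * \<i>)) *s (v + w)"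
    and "b - x = \<i> *s z \<Longrightarrow> - c - x = - (\<i> *s z) \<Longrightarrow> z = (1 / (2 * \<i>)) *s (b + c)"
    and "b - x = \<i> *s z \<Longrightarrow> c - x = - (\<i> *s z) \<Longrightarrow> z = (1 / 2) *s ((-\<i>) *s b + \<i> *s c)"
    and "b + x = \<i> *s v \<Longrightarrow> c + x = - (\<i> *s w) \<Longrightarrow> v + w = (-\<i>) *s b + \<i> *s c"
proof -
  show "z = (1 / (2 * \<i>)) *s (v + w)" if "b + v = \<i> *s z" "- b + w = \<i> *s z"
  proof -
    have eqs: "v = \<i> *s z - b" "w = \<i> *s z + b" using that by (auto simp: algebra_simps)
    show ?thesis unfolding eqs by (simp add: vec_eq_iff algebra_simps i_mult_i)
  qed
  show "z = (1 / (2 * \<i>)) *s (b + c)" if "b - x = \<i> *s z" "- c - x = - (\<i> *s z)"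
  proof -
    have eqs: "b = \<i> *s z + x" "c = \<i> *s z - x" using that by (auto simp: algebra_simps)
    show ?thesis unfolding eqs by (simp add: vec_eq_iff algebra_simps i_mult_i)
  qed
  show "z = (1 / 2) *s ((-\<i>) *s b + \<i> *s c)" if "b - x = \<i> *s z" "c - x = - (\<i> *s z)"
  proof -
    have eqs: "b = \<i> *s z + x" "c = x - \<i> *s z" using that by (auto simp: algebra_simps)
    show ?thesis unfolding eqs by (simp add: vec_eq_iff algebra_simps i_mult_i)
  qed
  show "v + w = (-\<i>) *s b + \<i> *s c" if "b + x = \<i> *s v" "c + x = - (\<i> *s w)"
  proof -
    have eqs: "b = \<i> *s v - x" "c = - (\<i> *s w) - x" using that by (auto simp: algebra_simps)
    show ?thesis unfolding eqs by (simp add: vec_eq_iff algebra_simps i_mult_i)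
  qed
qed

context generalized_complex_blocks
begin

lemma complex_multiple_fibre:
  "\<xi> \<in> cotangent_at M x \<Longrightarrow> contract (complex_multiple c \<pi> x) \<xi> \<in> tangent_at M x"
  "u \<in> tangent_at M x \<Longrightarrow> contract (complex_multiple c \<omega> x) u \<in> cotangent_at M x"
  "u \<in> tangent_at M x \<Longrightarrow> endo (complex_multiple c a x) u \<in> tangent_at M x"
  using tangent_at_linear[OF sharp_tangent zero_tangent, of \<xi> x c 0]
    cotangent_at_linear[OF flat_cotangent zero_cotangent, of u x c 0]
    tangent_at_linear[OF endo_tangent zero_tangent, of u x c 0]
  by (simp_all add: complex_multiple_apply[abs_def])

lemma tangent_product_eq:
  "L \<star> reverse (conj_family L) = graph_bivector M (complex_multiple (1 / (2 * \<i>)) \<pi>)"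
proof (intro set_eqI iffI; clarify)
  fix x V \<Xi> assume "(x, (V, \<Xi>)) \<in> L \<star> reverse (conj_family L)"
  then obtain \<Xi>1 \<Xi>2 where 1: "(x, (V, \<Xi>1)) \<in> L" and 2: "(x, (- V, \<Xi>2)) \<in> conj_family L" and \<Xi>: "\<Xi> = \<Xi>1 + \<Xi>2"
    by (auto simp: mem_tangent_product mem_reverse)
  note 1 = 1[unfolded mem_L_iff] and 2 = 2[unfolded mem_conj_L_iff]
  have \<Xi>c: "\<Xi> \<in> cotangent_at M x"
    using cotangent_at_linear[of \<Xi>1 x \<Xi>2 1 1] 1 2 unfolding \<Xi> by (simp add: plus_fun_def)
  have "V = contract (complex_multiple (1 / (2 * \<i>)) \<pi> x) \<Xi>"
  proof (rule comps_eqI)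
    show "V \<in> tangent_at M x \<or> V \<in> cotangent_at M x" using 1 by blast
    fix \<phi> assume \<phi>: "\<phi> \<in> charts_at M x"
    then show "V \<phi> = contract (complex_multiple (1 / (2 * \<i>)) \<pi> x) \<Xi> \<phi>"
      using 1 2 vec_solve[of "complex_matrix (a x \<phi>) *v V \<phi>" "\<Xi>1 \<phi> v* complex_matrix (\<pi> x \<phi>)" "V \<phi>"
        "\<Xi>2 \<phi> v* complex_matrix (\<pi> x \<phi>)"]
      by (simp add: complex_multiple_apply \<Xi> matrix_linear del: split_paired_All)
  qed (use complex_multiple_fibre \<Xi>c in blast)
  then show "(x, (V, \<Xi>)) \<in> graph_bivector M (complex_multiple (1 / (2 * \<i>)) \<pi>)"
    using 1 \<Xi>c by (auto simp: graph_bivector_def)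
next
  fix x V \<Xi> assume "(x, (V, \<Xi>)) \<in> graph_bivector M (complex_multiple (1 / (2 * \<i>)) \<pi>)"
  then have x: "x \<in> points M" and \<Xi>: "\<Xi> \<in> cotangent_at M x" and V: "V = contract (complex_multiple (1 / (2 * \<i>)) \<pi> x) \<Xi>"
    by (auto simp: graph_bivector_def)
  have Vt: "V \<in> tangent_at M x" "- V \<in> tangent_at M x"
    using tangent_at_linear[OF complex_multiple_fibre(1)[OF \<Xi>] zero_tangent, of "-1" "1 / (2 * \<i>)" 0]
    unfolding V by (auto simp: \<Xi> complex_multiple_fibre fun_Compl_def)
  define \<Xi>1 where "\<Xi>1 = (\<lambda>\<phi>. (1/2) *s \<Xi> \<phi> + (\<i>/2) *s (\<Xi> \<phi> v* complex_matrix (a x \<phi>)))"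
  define \<Xi>2 where "\<Xi>2 = (\<lambda>\<phi>. (1/2) *s \<Xi> \<phi> + (-\<i>/2) *s (\<Xi> \<phi> v* complex_matrix (a x \<phi>)))"
  have c: "\<Xi>1 \<in> cotangent_at M x" "\<Xi>2 \<in> cotangent_at M x"
    unfolding \<Xi>1_def \<Xi>2_def by (rule cotangent_at_linear[OF \<Xi> dual_endo_cotangent[OF \<Xi>]])+
  have lift: "complex_matrix (a x \<phi>) *v V \<phi> + \<Xi>1 \<phi> v* complex_matrix (\<pi> x \<phi>) = \<i> *s V \<phi>"
    "V \<phi> v* complex_matrix (\<omega> x \<phi>) - \<Xi>1 \<phi> v* complex_matrix (a x \<phi>) = \<i> *s \<Xi>1 \<phi>"
    "complex_matrix (a x \<phi>) *v (- V) \<phi> + \<Xi>2 \<phi> v* complex_matrix (\<pi> x \<phi>) = - (\<i> *s (- V) \<phi>)"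
    "(- V) \<phi> v* complex_matrix (\<omega> x \<phi>) - \<Xi>2 \<phi> v* complex_matrix (a x \<phi>) = - (\<i> *s \<Xi>2 \<phi>)"
    if "\<phi> \<in> charts_at M x" for \<phi>
    unfolding fun_Compl_def
    by (rule tangent_product_lift[OF complex_block_matrix[OF that], where \<xi> = "\<Xi> \<phi>"];
        simp add: V complex_multiple_apply \<Xi>1_def \<Xi>2_def)+
  have "(x, (V, \<Xi>1)) \<in> L" "(x, (- V, \<Xi>2)) \<in> conj_family L"
    unfolding mem_L_iff mem_conj_L_iff using x Vt c lift by blast+
  moreover have "\<Xi> = \<Xi>1 + \<Xi>2" by (auto simp: \<Xi>1_def \<Xi>2_def vec_eq_iff fun_eq_iff)
  ultimately show "(x, (V, \<Xi>)) \<in> L \<star> reverse (conj_family L)"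
    unfolding mem_tangent_product mem_reverse by blast
qed

lemma cotangent_product_eq:
  "L \<circledast> reverse (conj_family L) = graph_two_form M (complex_multiple (1 / (2 * \<i>)) \<omega>)"
proof (intro set_eqI iffI; clarify)
  fix x V \<Xi> assume "(x, (V, \<Xi>)) \<in> L \<circledast> reverse (conj_family L)"
  then obtain V1 V2 where 1: "(x, (V1, \<Xi>)) \<in> L" and 2: "(x, (- V2, \<Xi>)) \<in> conj_family L" and V: "V = V1 + V2"
    by (auto simp: mem_cotangent_product mem_reverse)
  note 1 = 1[unfolded mem_L_iff] and 2 = 2[unfolded mem_conj_L_iff]
  have Vt: "V \<in> tangent_at M x"
    using tangent_at_linear[of V1 x "- V2" 1 "-1"] 1 2 unfolding V by (simp add: plus_fun_def fun_Compl_def)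
  have "\<Xi> = contract (complex_multiple (1 / (2 * \<i>)) \<omega> x) V"
  proof (rule comps_eqI)
    show "\<Xi> \<in> tangent_at M x \<or> \<Xi> \<in> cotangent_at M x" using 1 by blast
    fix \<phi> assume \<phi>: "\<phi> \<in> charts_at M x"
    then have "V1 \<phi> v* complex_matrix (\<omega> x \<phi>) - \<Xi> \<phi> v* complex_matrix (a x \<phi>) = \<i> *s \<Xi> \<phi>"
      "(- V2) \<phi> v* complex_matrix (\<omega> x \<phi>) - \<Xi> \<phi> v* complex_matrix (a x \<phi>) = - (\<i> *s \<Xi> \<phi>)"
      using 1 2 by blast+
    then show "\<Xi> \<phi> = contract (complex_multiple (1 / (2 * \<i>)) \<omega> x) V \<phi>"
      using vec_solve(2)[of "V1 \<phi> v* complex_matrix (\<omega> x \<phi>)" "\<Xi> \<phi> v* complex_matrix (a x \<phi>)" "\<Xi> \<phi>"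
          "V2 \<phi> v* complex_matrix (\<omega> x \<phi>)"]
      by (simp add: complex_multiple_apply V matrix_linear)
  qed (use complex_multiple_fibre Vt in blast)
  then show "(x, (V, \<Xi>)) \<in> graph_two_form M (complex_multiple (1 / (2 * \<i>)) \<omega>)"
    using 1 Vt by (auto simp: graph_two_form_def)
next
  fix x V \<Xi> assume "(x, (V, \<Xi>)) \<in> graph_two_form M (complex_multiple (1 / (2 * \<i>)) \<omega>)"
  then have x: "x \<in> points M" and V: "V \<in> tangent_at M x" and \<Xi>: "\<Xi> = contract (complex_multiple (1 / (2 * \<i>)) \<omega> x) V"
    by (auto simp: graph_two_form_def)
  define V1 where "V1 = (\<lambda>\<phi>. (1/2) *s V \<phi> + (-\<i>/2) *s (complex_matrix (a x \<phi>) *v V \<phi>))"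
  define V2 where "V2 = (\<lambda>\<phi>. (1/2) *s V \<phi> + (\<i>/2) *s (complex_matrix (a x \<phi>) *v V \<phi>))"
  have c: "V1 \<in> tangent_at M x" "V2 \<in> tangent_at M x"
    unfolding V1_def V2_def by (rule tangent_at_linear[OF V endo_tangent[OF V]])+
  have c2: "- V2 \<in> tangent_at M x"
    using tangent_at_linear[OF c(2) zero_tangent, of "-1" 0] by (simp add: fun_Compl_def)
  have lift: "complex_matrix (a x \<phi>) *v V1 \<phi> + \<Xi> \<phi> v* complex_matrix (\<pi> x \<phi>) = \<i> *s V1 \<phi>"
    "V1 \<phi> v* complex_matrix (\<omega> x \<phi>) - \<Xi> \<phi> v* complex_matrix (a x \<phi>) = \<i> *s \<Xi> \<phi>"
    "complex_matrix (a x \<phi>) *v (- V2) \<phi> + \<Xi> \<phi> v* complex_matrix (\<pi> x \<phi>) = - (\<i> *s (- V2) \<phi>)"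
    "(- V2) \<phi> v* complex_matrix (\<omega> x \<phi>) - \<Xi> \<phi> v* complex_matrix (a x \<phi>) = - (\<i> *s \<Xi> \<phi>)"
    if "\<phi> \<in> charts_at M x" for \<phi>
    unfolding fun_Compl_def
    by (rule cotangent_product_lift[OF complex_block_matrix[OF that], where u = "V \<phi>"];
        simp add: \<Xi> complex_multiple_apply V1_def V2_def)+
  have "(x, (V1, \<Xi>)) \<in> L" "(x, (- V2, \<Xi>)) \<in> conj_family L"
    unfolding mem_L_iff mem_conj_L_iff using x c c2 lift complex_multiple_fibre(2)[OF V] \<Xi> by blast+
  moreover have "V = V1 + V2" by (auto simp: V1_def V2_def vec_eq_iff fun_eq_iff)
  ultimately show "(x, (V, \<Xi>)) \<in> L \<circledast> reverse (conj_family L)"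
    unfolding mem_cotangent_product mem_reverse by blast
qed

abbreviation (input) "D \<equiv> L \<circledast> conj_family L"

text \<open>An element of \<open>D\<close> is the sum of \<open>V\<^sub>1 + \<xi>\<close> in \<open>L\<close> and the tangent part of \<open>V\<^sub>2 + \<xi>\<close> in
its conjugate. Subtracting the eigenvalue equations \<open>a V\<^sub>1 + \<pi> \<xi> = \<i> V\<^sub>1\<close> and
\<open>a V\<^sub>2 + \<pi> \<xi> = - \<i> V\<^sub>2\<close> gives \<open>a (V\<^sub>1 - V\<^sub>2) = \<i> (V\<^sub>1 + V\<^sub>2)\<close>, so the parameter is
\<open>p = - \<i> (V\<^sub>1 - V\<^sub>2)\<close>.\<close>

lemma mem_D_iff:
  "(x, (V, \<Xi>)) \<in> D \<longleftrightarrow> x \<in> points M \<and> (\<exists>p\<in>tangent_at M x.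
    V = endo (complex_multiple 1 a x) p \<and> \<Xi> = contract (complex_multiple (1/2) \<omega> x) p)"
proof safe
  assume "(x, (V, \<Xi>)) \<in> D"
  then obtain V1 V2 where 1: "(x, (V1, \<Xi>)) \<in> L" and 2: "(x, (V2, \<Xi>)) \<in> conj_family L" and V: "V = V1 + V2"
    by (auto simp: mem_cotangent_product)
  note 1 = 1[unfolded mem_L_iff] and 2 = 2[unfolded mem_conj_L_iff]
  show "x \<in> points M" using 1 by blast
  define p where "p = (\<lambda>\<phi>. (-\<i>) *s V1 \<phi> + \<i> *s V2 \<phi>)"
  have p: "p \<in> tangent_at M x" unfolding p_def by (rule tangent_at_linear) (use 1 2 in blast)+
  have Vt: "V \<in> tangent_at M x"
    using tangent_at_linear[of V1 x V2 1 1] 1 2 unfolding V by (simp add: plus_fun_def)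
  have eq: "V \<phi> = endo (complex_multiple 1 a x) p \<phi>" "\<Xi> \<phi> = contract (complex_multiple (1/2) \<omega> x) p \<phi>"
    if "\<phi> \<in> charts_at M x" for \<phi>
  proof -
    have e: "complex_matrix (a x \<phi>) *v V1 \<phi> + \<Xi> \<phi> v* complex_matrix (\<pi> x \<phi>) = \<i> *s V1 \<phi>"
      "V1 \<phi> v* complex_matrix (\<omega> x \<phi>) - \<Xi> \<phi> v* complex_matrix (a x \<phi>) = \<i> *s \<Xi> \<phi>"
      "complex_matrix (a x \<phi>) *v V2 \<phi> + \<Xi> \<phi> v* complex_matrix (\<pi> x \<phi>) = - (\<i> *s V2 \<phi>)"
      "V2 \<phi> v* complex_matrix (\<omega> x \<phi>) - \<Xi> \<phi> v* complex_matrix (a x \<phi>) = - (\<i> *s \<Xi> \<phi>)"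
      using 1 2 that by blast+
    show "V \<phi> = endo (complex_multiple 1 a x) p \<phi>"
      using vec_solve(4)[OF e(1,3)] by (simp add: complex_multiple_apply V p_def matrix_linear)
    show "\<Xi> \<phi> = contract (complex_multiple (1/2) \<omega> x) p \<phi>"
      using vec_solve(3)[OF e(2,4)] by (simp add: complex_multiple_apply p_def matrix_linear)
  qed
  show "\<exists>p\<in>tangent_at M x. V = endo (complex_multiple 1 a x) p \<and> \<Xi> = contract (complex_multiple (1/2) \<omega> x) p"
  proof (intro bexI conjI)
    show "V = endo (complex_multiple 1 a x) p"
      by (rule comps_eqI[where x = x]) (use Vt p complex_multiple_fibre eq in blast)+
    show "\<Xi> = contract (complex_multiple (1/2) \<omega> x) p"
      by (rule comps_eqI[where x = x]) (use 1 p complex_multiple_fibre eq in blast)+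
  qed (rule p)
next
  fix p :: "('m, 'n, complex) comps" assume x: "x \<in> points M" and p: "p \<in> tangent_at M x"
  let ?V = "endo (complex_multiple 1 a x) p" and ?\<Xi> = "contract (complex_multiple (1/2) \<omega> x) p"
  define V1 where "V1 = (\<lambda>\<phi>. (1/2) *s (complex_matrix (a x \<phi>) *v p \<phi>) + (\<i>/2) *s p \<phi>)"
  define V2 where "V2 = (\<lambda>\<phi>. (1/2) *s (complex_matrix (a x \<phi>) *v p \<phi>) + (-\<i>/2) *s p \<phi>)"
  have c: "V1 \<in> tangent_at M x" "V2 \<in> tangent_at M x"
    unfolding V1_def V2_def by (rule tangent_at_linear[OF endo_tangent[OF p] p])+
  have lift: "complex_matrix (a x \<phi>) *v V1 \<phi> + ?\<Xi> \<phi> v* complex_matrix (\<pi> x \<phi>) = \<i> *s V1 \<phi>"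
    "V1 \<phi> v* complex_matrix (\<omega> x \<phi>) - ?\<Xi> \<phi> v* complex_matrix (a x \<phi>) = \<i> *s ?\<Xi> \<phi>"
    "complex_matrix (a x \<phi>) *v V2 \<phi> + ?\<Xi> \<phi> v* complex_matrix (\<pi> x \<phi>) = - (\<i> *s V2 \<phi>)"
    "V2 \<phi> v* complex_matrix (\<omega> x \<phi>) - ?\<Xi> \<phi> v* complex_matrix (a x \<phi>) = - (\<i> *s ?\<Xi> \<phi>)"
    if "\<phi> \<in> charts_at M x" for \<phi>
    by (rule conjugate_product_lift[OF complex_block_matrix[OF that], where p = "p \<phi>"];
        simp add: complex_multiple_apply V1_def V2_def)+
  have "(x, (V1, ?\<Xi>)) \<in> L" "(x, (V2, ?\<Xi>)) \<in> conj_family L"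
    unfolding mem_L_iff mem_conj_L_iff using x c lift complex_multiple_fibre(2)[OF p] by blast+
  moreover have "?V = V1 + V2" by (auto simp: V1_def V2_def vec_eq_iff fun_eq_iff complex_multiple_apply)
  ultimately show "(x, (?V, ?\<Xi>)) \<in> D"
    unfolding mem_cotangent_product by blast
qed

text \<open>Isotropy is the relation \<open>a*\<omega> = \<omega>a\<close> together with the skew-symmetry of \<open>\<omega>\<close>. Conversely, orthogonality of
\<open>V + \<xi>\<close> to all \<open>e(q)\<close> means \<open>\<omega> V = 2 a* \<xi>\<close>, and then \<open>p = - a V - 2 \<pi> \<xi>\<close> satisfies \<open>e(p) = V + \<xi>\<close>.\<close>

lemma D_lagrangian: "complex_lagrangian_family M D"
  unfolding complex_lagrangian_family_def
proof (intro conjI ballI)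
  show "D \<subseteq> total_space M"
    using complex_multiple_fibre by (auto simp: mem_D_iff total_space_def gtangent_at_def)
  fix x assume x: "x \<in> points M"
  have F: "fibre D x = {(endo (complex_multiple 1 a x) p, contract (complex_multiple (1/2) \<omega> x) p) | p. p \<in> tangent_at M x}"
    using x by (auto simp: fibre_def mem_D_iff)
  have lin: "endo (complex_multiple 1 a x) (\<lambda>\<phi>. c *s p \<phi> + d *s q \<phi>) =
      (\<lambda>\<phi>. c *s endo (complex_multiple 1 a x) p \<phi> + d *s endo (complex_multiple 1 a x) q \<phi>)"
    "contract (complex_multiple (1/2) \<omega> x) (\<lambda>\<phi>. c *s p \<phi> + d *s q \<phi>) =
      (\<lambda>\<phi>. c *s contract (complex_multiple (1/2) \<omega> x) p \<phi> + d *s contract (complex_multiple (1/2) \<omega> x) q \<phi>)"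
    for c d p q
    by (auto simp: fun_eq_iff complex_multiple_apply matrix_linear vec_eq_iff algebra_simps)
  have comb: "(\<lambda>\<phi>. c *s fst s \<phi> + d *s fst t \<phi>, \<lambda>\<phi>. c *s snd s \<phi> + d *s snd t \<phi>) \<in> fibre D x"
    if "s \<in> fibre D x" "t \<in> fibre D x" for s t c d
  proof -
    obtain p q where p: "p \<in> tangent_at M x" "s = (endo (complex_multiple 1 a x) p, contract (complex_multiple (1/2) \<omega> x) p)"
      and q: "q \<in> tangent_at M x" "t = (endo (complex_multiple 1 a x) q, contract (complex_multiple (1/2) \<omega> x) q)"
      using \<open>s \<in> fibre D x\<close> \<open>t \<in> fibre D x\<close> unfolding F by blast
    show ?thesis unfolding F p q fst_conv snd_conv lin[symmetric]
      using tangent_at_linear[OF p(1) q(1), of c d] by blast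
  qed
  have "0 = endo (complex_multiple 1 a x) 0" "0 = contract (complex_multiple (1/2) \<omega> x) 0"
    by (auto simp: fun_eq_iff complex_multiple_apply matrix_linear)
  then have z: "0 \<in> fibre D x"
    unfolding F zero_prod_def using zero_tangent by blast
  show "complex_subspace (fibre D x)"
    unfolding complex_subspace_def
  proof (intro conjI ballI allI z)
    fix s t assume st: "s \<in> fibre D x" "t \<in> fibre D x"
    show "s + t \<in> fibre D x"
      using comb[OF st, of 1 1] by (simp add: plus_prod_def plus_fun_def)
    show "gscale c s \<in> fibre D x" for c
      using comb[OF st(1,1), of c 0] by (simp add: gscale_def)
  qed
  show "fibre D x = orthogonal_at M x (fibre D x)"
  proof safe
    fix V \<Xi> assume "(V, \<Xi>) \<in> fibre D x"
    then obtain p where p: "p \<in> tangent_at M x" "V = endo (complex_multiple 1 a x) p" "\<Xi> = contract (complex_multiple (1/2) \<omega> x) p"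
      unfolding F by blast
    have "pairing \<phi> s (V, \<Xi>) = 0" if s: "s \<in> fibre D x" and \<phi>: "\<phi> \<in> charts_at M x" for s \<phi>
    proof -
      interpret complex_block_matrix "complex_matrix (a x \<phi>)" "complex_matrix (\<pi> x \<phi>)" "complex_matrix (\<omega> x \<phi>)"
        by (rule complex_block_matrix[OF \<phi>])
      obtain q where q: "s = (endo (complex_multiple 1 a x) q, contract (complex_multiple (1/2) \<omega> x) q)"
        using s unfolding F by blast
      show ?thesis
        unfolding p q pairing_dot fst_conv snd_conv complex_multiple_apply
        using dot_skew[OF W_skew, of "q \<phi>" "complex_matrix (a x \<phi>) *v p \<phi>"]
        by (simp add: dot_linear WA dot_matrix)
    qed
    then show "(V, \<Xi>) \<in> orthogonal_at M x (fibre D x)"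
      using p complex_multiple_fibre by (simp add: orthogonal_at_def gtangent_at_def)
  next
    fix V \<Xi> assume o: "(V, \<Xi>) \<in> orthogonal_at M x (fibre D x)"
    then have V: "V \<in> tangent_at M x" and \<Xi>: "\<Xi> \<in> cotangent_at M x"
      by (auto simp: orthogonal_at_def gtangent_at_def)
    define p where "p = (\<lambda>\<phi>. (-1) *s (complex_matrix (a x \<phi>) *v V \<phi>) + (-2) *s (\<Xi> \<phi> v* complex_matrix (\<pi> x \<phi>)))"
    have p: "p \<in> tangent_at M x" unfolding p_def by (intro tangent_at_linear endo_tangent sharp_tangent V \<Xi>)
    have eq: "V \<phi> = endo (complex_multiple 1 a x) p \<phi> \<and> \<Xi> \<phi> = contract (complex_multiple (1/2) \<omega> x) p \<phi>"
      if \<phi>: "\<phi> \<in> charts_at M x" for \<phi>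
    proof -
      interpret complex_block_matrix "complex_matrix (a x \<phi>)" "complex_matrix (\<pi> x \<phi>)" "complex_matrix (\<omega> x \<phi>)"
        by (rule complex_block_matrix[OF \<phi>])
      have "dot (2 *s (\<Xi> \<phi> v* complex_matrix (a x \<phi>)) - V \<phi> v* complex_matrix (\<omega> x \<phi>)) w = 0" for w
      proof -
        let ?q = "\<lambda>\<psi>. of_real_vec (coordinate_vector \<phi> (re_vec w) x \<psi>) "
        let ?r = "\<lambda>\<psi>. of_real_vec (coordinate_vector \<phi> (im_vec w) x \<psi>) "
        define q where "q = (\<lambda>\<psi>. 1 *s ?q \<psi> + \<i> *s ?r \<psi>)"
        have q: "q \<in> tangent_at M x" unfolding q_def
          by (intro tangent_at_linear tangent_of_real coordinate_vector_tangent \<phi>)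
        have "q \<phi> = w" unfolding q_def by (simp add: coordinate_self \<phi> complex_vec_eq_iff)
        moreover have "pairing \<phi> (endo (complex_multiple 1 a x) q, contract (complex_multiple (1/2) \<omega> x) q) (V, \<Xi>) = 0"
          using o q \<phi> unfolding orthogonal_at_def F by blast
        ultimately show ?thesis
          unfolding pairing_dot fst_conv snd_conv complex_multiple_apply
          using dot_skew[OF W_skew, of w "V \<phi>"]
          by (simp add: dot_linear dot_matrix field_simps)
      qed
      from dot_nondegenerate[OF this]
      have W: "V \<phi> v* complex_matrix (\<omega> x \<phi>) = 2 *s (\<Xi> \<phi> v* complex_matrix (a x \<phi>))" by simp
      then show ?thesis
        unfolding complex_multiple_apply p_def
        by (simp add: matrix_linear AA' PW' AP WA W)
    qed
    have "V = endo (complex_multiple 1 a x) p"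
      by (rule comps_eqI[where x = x]) (use V p complex_multiple_fibre eq in blast)+
    moreover have "\<Xi> = contract (complex_multiple (1/2) \<omega> x) p"
      by (rule comps_eqI[where x = x]) (use \<Xi> p complex_multiple_fibre eq in blast)+
    ultimately show "(V, \<Xi>) \<in> fibre D x" unfolding F using p by blast
  qed
qed

end


section \<open>The Dorfman bracket of complex sections\<close>

definition complex_section ::
  "('m \<Rightarrow> ('m, 'n::finite, real) gcomps) \<Rightarrow> ('m \<Rightarrow> ('m, 'n, real) gcomps) \<Rightarrow> 'm \<Rightarrow> ('m, 'n, complex) gcomps" where
  "complex_section s t x = complexify (s x) + gscale \<i> (complexify (t x))"

lemma complex_section_apply:
  "fst (complex_section s t x) \<phi> = of_real_vec (fst (s x) \<phi>) + \<i> *s of_real_vec (fst (t x) \<phi>)"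
  "snd (complex_section s t x) \<phi> = of_real_vec (snd (s x) \<phi>) + \<i> *s of_real_vec (snd (t x) \<phi>)"
  by (simp_all add: complex_section_def complexify_alt gscale_def)

lemma complex_section_nth:
  "fst (complex_section s t x) \<phi> $ j = of_real (fst (s x) \<phi> $ j) + \<i> * of_real (fst (t x) \<phi> $ j)"
  "snd (complex_section s t x) \<phi> $ j = of_real (snd (s x) \<phi> $ j) + \<i> * of_real (snd (t x) \<phi> $ j)"
  by (simp_all add: complex_section_apply of_real_vec_def)

definition differentiable_section :: "('m, 'n::finite) chart \<Rightarrow> ('m \<Rightarrow> ('m, 'n, 'k::real_normed_field) gcomps) \<Rightarrow> 'm \<Rightarrow> bool" where
  "differentiable_section \<phi> s x \<longleftrightarrow> (\<forall>j. differentiable_in_chart \<phi> (\<lambda>y. fst (s y) \<phi> $ j) x \<and>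
     differentiable_in_chart \<phi> (\<lambda>y. snd (s y) \<phi> $ j) x)"

lemma pd_complex:
  assumes "differentiable_in_chart \<phi> f x" "differentiable_in_chart \<phi> g x"
  shows "pd \<phi> i (\<lambda>y. complex_of_real (f y) + \<i> * complex_of_real (g y)) x =
    of_real (pd \<phi> i f x) + \<i> * of_real (pd \<phi> i g x)"
proof -
  note f = pd_linear[OF bounded_linear_of_real assms(1)]
  have b: "bounded_linear (\<lambda>t. \<i> * complex_of_real t)"
    by (rule bounded_linear_compose[OF bounded_linear_mult_right bounded_linear_of_real])
  show ?thesis
    by (subst pd_add[OF differentiable_in_chart_linear[OF bounded_linear_of_real assms(1)]
          differentiable_in_chart_linear[OF b assms(2)]])
      (simp add: f pd_linear[OF b assms(2)])
qed

lemma dorfman_nth: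
  "fst (dorfman s t x) \<phi> $ j = (\<Sum>i\<in>UNIV. fst (s x) \<phi> $ i * pd \<phi> i (\<lambda>y. fst (t y) \<phi> $ j) x
     - fst (t x) \<phi> $ i * pd \<phi> i (\<lambda>y. fst (s y) \<phi> $ j) x)"
  "snd (dorfman s t x) \<phi> $ j = (\<Sum>i\<in>UNIV. fst (s x) \<phi> $ i * pd \<phi> i (\<lambda>y. snd (t y) \<phi> $ j) x
      + snd (t x) \<phi> $ i * pd \<phi> j (\<lambda>y. fst (s y) \<phi> $ i) x
      - fst (t x) \<phi> $ i * (pd \<phi> i (\<lambda>y. snd (s y) \<phi> $ j) x - pd \<phi> j (\<lambda>y. snd (s y) \<phi> $ i) x))"
  by (simp_all add: dorfman_def lie_bracket_def lie_derivative_def contract_def ext_deriv_def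
      vector_matrix_mult_def o_def sum_subtractf)

text \<open>The bracket is complex bilinear, so its values on complex sections reduce to real brackets. This
single expansion serves both the sections \<open>J s + \<i> s\<close> of \<open>L\<close> and the sections \<open>e(u) + \<i> e(v)\<close> of \<open>D\<close>.\<close>

lemma dorfman_complex_section:
  assumes "differentiable_section \<phi> s x" "differentiable_section \<phi> s' x"
    "differentiable_section \<phi> t x" "differentiable_section \<phi> t' x"
  shows "fst (dorfman (complex_section s s') (complex_section t t') x) \<phi> =
      of_real_vec (fst (dorfman s t x) \<phi> - fst (dorfman s' t' x) \<phi>)
      + \<i> *s of_real_vec (fst (dorfman s t' x) \<phi> + fst (dorfman s' t x) \<phi>)"
    and "snd (dorfman (complex_section s s') (complex_section t t') x) \<phi> =
      of_real_vec (snd (dorfman s t x) \<phi> - snd (dorfman s' t' x) \<phi>)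
      + \<i> *s of_real_vec (snd (dorfman s t' x) \<phi> + snd (dorfman s' t x) \<phi>)"
proof -
  have d: "differentiable_in_chart \<phi> (\<lambda>y. fst (r y) \<phi> $ j) x"
     "differentiable_in_chart \<phi> (\<lambda>y. snd (r y) \<phi> $ j) x" if "r \<in> {s, s', t, t'}" for r j
    using that assms unfolding differentiable_section_def by blast+
  show "fst (dorfman (complex_section s s') (complex_section t t') x) \<phi> =
      of_real_vec (fst (dorfman s t x) \<phi> - fst (dorfman s' t' x) \<phi>)
      + \<i> *s of_real_vec (fst (dorfman s t' x) \<phi> + fst (dorfman s' t x) \<phi>)"
    unfolding vec_eq_iff complex_eq_iff
    by (simp add: dorfman_nth complex_section_nth pd_complex d of_real_vec_def Re_sum Im_sum
       sum.distrib sum_subtractf sum_negf algebra_simps del: split_paired_All)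
  show "snd (dorfman (complex_section s s') (complex_section t t') x) \<phi> =
      of_real_vec (snd (dorfman s t x) \<phi> - snd (dorfman s' t' x) \<phi>)
      + \<i> *s of_real_vec (snd (dorfman s t' x) \<phi> + snd (dorfman s' t x) \<phi>)"
    unfolding vec_eq_iff complex_eq_iff
    by (simp add: dorfman_nth complex_section_nth pd_complex d of_real_vec_def Re_sum Im_sum
       sum.distrib sum_subtractf sum_negf algebra_simps del: split_paired_All)
qed

lemma dot_complex:
  "Re (dot z w) = dot (re_vec z) (re_vec w) - dot (im_vec z) (im_vec w)"
  "Im (dot z w) = dot (re_vec z) (im_vec w) + dot (im_vec z) (re_vec w)"
  by (simp_all add: dot_def re_vec_def im_vec_def sum_subtractf sum.distrib)

lemma lie_zero [simp]:
  "lie_bracket (\<lambda>y. 0) v x = 0" "lie_bracket v (\<lambda>y. 0) x = 0"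
  "lie_derivative (\<lambda>y. 0) \<xi> x = 0" "lie_derivative v (\<lambda>y. 0) x = 0" "ext_deriv (\<lambda>y. 0) x = 0"
  by (auto simp: fun_eq_iff vec_eq_iff lie_bracket_def lie_derivative_def ext_deriv_def)

lemma contract_zero [simp]: "contract P 0 = 0" "contract 0 u = 0" "endo A 0 = 0" "dual_endo A 0 = 0"
  by (auto simp: fun_eq_iff vec_eq_iff contract_def endo_def dual_endo_def vector_matrix_mult_def
      matrix_vector_mult_def)

lemma lie_derivative_scale:
  fixes c :: real
  assumes "\<And>j. differentiable_in_chart \<phi> (\<lambda>y. \<eta> y \<phi> $ j) x"
  shows "lie_derivative u (\<lambda>y \<psi>. c *s \<eta> y \<psi>) x \<phi> = c *s lie_derivative u \<eta> x \<phi>"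
proof -
  have "pd \<phi> i (\<lambda>y. c * \<eta> y \<phi> $ j) x = c * pd \<phi> i (\<lambda>y. \<eta> y \<phi> $ j) x" for i j
    by (rule pd_linear[OF bounded_linear_mult_right assms])
  then show ?thesis
    unfolding lie_derivative_def vec_eq_iff vector_smult_component vec_lambda_beta sum_distrib_left
    by (intro allI sum.cong refl) (simp add: distrib_left mult.left_commute)
qed

lemma ext_deriv_scale:
  fixes c :: real
  assumes "\<And>j. differentiable_in_chart \<phi> (\<lambda>y. \<xi> y \<phi> $ j) x"
  shows "contract (ext_deriv (\<lambda>y \<psi>. c *s \<xi> y \<psi>) x) v \<phi> = c *s contract (ext_deriv \<xi> x) v \<phi>"
proof -
  have "pd \<phi> i (\<lambda>y. c * \<xi> y \<phi> $ j) x = c * pd \<phi> i (\<lambda>y. \<xi> y \<phi> $ j) x" for i j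
    by (rule pd_linear[OF bounded_linear_mult_right assms])
  then show ?thesis
    unfolding ext_deriv_def contract_def vector_matrix_mult_def vec_eq_iff vector_smult_component
      vec_lambda_beta sum_distrib_left
    by (intro allI sum.cong refl) (simp add: right_diff_distrib mult.left_commute)
qed

context manifold_charts
begin

lemma smooth_comps_nthD:
  assumes "smooth_comps M U s" "openin (mtop M) U" "\<phi> \<in> atlas M"
  shows "smooth_on (snd \<phi> ` (U \<inter> fst \<phi>)) (\<lambda>y. s (chart_inv \<phi> y) \<phi> $ i)"
  using assms smooth_comps_nth by blast

lemma smooth_comps_vec_matrix:
  fixes A :: "'m \<Rightarrow> ('m, 'n, real) mcomps" and u :: "'m \<Rightarrow> ('m, 'n, real) comps"
  assumes "openin (mtop M) U" "smooth_comps M (points M) A" "smooth_comps M U u"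
  shows "smooth_comps M U (\<lambda>y. endo (A y) (u y))" "smooth_comps M U (\<lambda>y. contract (A y) (u y))"
    "smooth_comps M U (\<lambda>y. dual_endo (A y) (u y))"
proof -
  have AU: "smooth_comps M U A"
    by (rule smooth_comps_subset[OF assms(2) openin_subset[OF assms(1)]])
  have *: "smooth_on (snd \<phi> ` (U \<inter> fst \<phi>)) (\<lambda>y. A (chart_inv \<phi> y) \<phi> $ i $ j)"
    "smooth_on (snd \<phi> ` (U \<inter> fst \<phi>)) (\<lambda>y. u (chart_inv \<phi> y) \<phi> $ j)" if "\<phi> \<in> atlas M" for \<phi> i j
    by (rule smooth_comps_matrix_nth[OF assms(1) AU that], rule smooth_comps_nthD[OF assms(3,1) that])
  show "smooth_comps M U (\<lambda>y. endo (A y) (u y))" "smooth_comps M U (\<lambda>y. contract (A y) (u y))"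
    "smooth_comps M U (\<lambda>y. dual_endo (A y) (u y))"
    unfolding smooth_comps_nth[OF assms(1)] endo_def contract_def dual_endo_def
      matrix_vector_mult_def vector_matrix_mult_def vec_lambda_beta
    by (intro ballI allI, rule smooth_on_sum, erule open_chart_image, rule assms(1),
        rule smooth_on_mult, erule open_chart_image, rule assms(1), (erule *)+)+
qed

lemma smooth_comps_linear:
  fixes s t :: "'m \<Rightarrow> ('m, 'n, real) comps"
  assumes "openin (mtop M) U" "smooth_comps M U s" "smooth_comps M U t"
  shows "smooth_comps M U (\<lambda>y \<phi>. c *s s y \<phi> + d *s t y \<phi>)"
proof -
  have *: "smooth_on (snd \<phi> ` (U \<inter> fst \<phi>)) (\<lambda>y. s (chart_inv \<phi> y) \<phi> $ j)"
    "smooth_on (snd \<phi> ` (U \<inter> fst \<phi>)) (\<lambda>y. t (chart_inv \<phi> y) \<phi> $ j)" if "\<phi> \<in> atlas M" for \<phi> j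
    using assms(2,3)[THEN smooth_comps_nthD, OF assms(1) that] by simp_all
  show ?thesis
    unfolding smooth_comps_nth[OF assms(1)] vector_add_component vector_smult_component
    by (intro ballI allI, rule smooth_on_add, erule open_chart_image, rule assms(1),
        (rule smooth_on_mult, erule open_chart_image, rule assms(1), rule smooth_on_const, erule *)+)
qed

lemma smooth_complex_section:
  assumes "openin (mtop M) U" "smooth_comps M U (fst \<circ> s)" "smooth_comps M U (snd \<circ> s)"
    "smooth_comps M U (fst \<circ> t)" "smooth_comps M U (snd \<circ> t)"
  shows "smooth_comps M U (fst \<circ> complex_section s t)" "smooth_comps M U (snd \<circ> complex_section s t)"
proof -
  have *: "smooth_on (snd \<phi> ` (U \<inter> fst \<phi>)) (\<lambda>y. fst (s (chart_inv \<phi> y)) \<phi> $ j)"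
    "smooth_on (snd \<phi> ` (U \<inter> fst \<phi>)) (\<lambda>y. fst (t (chart_inv \<phi> y)) \<phi> $ j)"
    "smooth_on (snd \<phi> ` (U \<inter> fst \<phi>)) (\<lambda>y. snd (s (chart_inv \<phi> y)) \<phi> $ j)"
    "smooth_on (snd \<phi> ` (U \<inter> fst \<phi>)) (\<lambda>y. snd (t (chart_inv \<phi> y)) \<phi> $ j)" if "\<phi> \<in> atlas M" for \<phi> j
    using assms(2-5)[THEN smooth_comps_nthD, OF assms(1) that] by simp_all
  show "smooth_comps M U (fst \<circ> complex_section s t)" "smooth_comps M U (snd \<circ> complex_section s t)"
    unfolding smooth_comps_nth[OF assms(1)] o_def complex_section_nth
    by (intro ballI allI, rule smooth_on_add, erule open_chart_image, rule assms(1),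
        rule smooth_on_of_real, erule open_chart_image, rule assms(1), erule *,
        rule smooth_on_mult, erule open_chart_image, rule assms(1), rule smooth_on_const,
        rule smooth_on_of_real, erule open_chart_image, rule assms(1), erule *)+
qed

lemma smooth_differentiable_section:
  assumes "openin (mtop M) U" "x \<in> U" "\<phi> \<in> charts_at M x"
    "smooth_comps M U (fst \<circ> s)" "smooth_comps M U (snd \<circ> s)"
  shows "differentiable_section \<phi> s x"
  using smooth_comps_differentiable[OF assms(4,3,1,2)] smooth_comps_differentiable[OF assms(5,3,1,2)]
  by (simp add: differentiable_section_def)

lemma dorfman_cong:
  assumes "openin (mtop M) U" "x \<in> U" "\<phi> \<in> charts_at M x"
    and "\<And>y. y \<in> U \<Longrightarrow> s y = s' y" "\<And>y. y \<in> U \<Longrightarrow> t y = t' y"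
  shows "fst (dorfman s t x) \<phi> = fst (dorfman s' t' x) \<phi>" "snd (dorfman s t x) \<phi> = snd (dorfman s' t' x) \<phi>"
proof -
  have "pd \<phi> i (\<lambda>y. fst (s y) \<phi> $ j) x = pd \<phi> i (\<lambda>y. fst (s' y) \<phi> $ j) x"
    "pd \<phi> i (\<lambda>y. snd (s y) \<phi> $ j) x = pd \<phi> i (\<lambda>y. snd (s' y) \<phi> $ j) x"
    "pd \<phi> i (\<lambda>y. fst (t y) \<phi> $ j) x = pd \<phi> i (\<lambda>y. fst (t' y) \<phi> $ j) x"
    "pd \<phi> i (\<lambda>y. snd (t y) \<phi> $ j) x = pd \<phi> i (\<lambda>y. snd (t' y) \<phi> $ j) x" for i j
    by (rule pd_cong[OF assms(3,1,2)]; simp add: assms(4,5))+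
  then show "fst (dorfman s t x) \<phi> = fst (dorfman s' t' x) \<phi>" "snd (dorfman s t x) \<phi> = snd (dorfman s' t' x) \<phi>"
    using assms(2,4,5) by (simp_all add: vec_eq_iff dorfman_nth)
qed

definition real_section :: "'m set \<Rightarrow> ('m \<Rightarrow> ('m, 'n, real) gcomps) \<Rightarrow> bool" where
  "real_section U s \<longleftrightarrow> (\<forall>x\<in>U. s x \<in> gtangent_at M x) \<and> smooth_comps M U (fst \<circ> s) \<and> smooth_comps M U (snd \<circ> s)"

definition local_vector_field :: "'m set \<Rightarrow> ('m \<Rightarrow> ('m, 'n, real) comps) \<Rightarrow> bool" where
  "local_vector_field U u \<longleftrightarrow> (\<forall>x\<in>U. u x \<in> tangent_at M x) \<and> smooth_comps M U u"

definition local_one_form :: "'m set \<Rightarrow> ('m \<Rightarrow> ('m, 'n, real) comps) \<Rightarrow> bool" where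
  "local_one_form U \<xi> \<longleftrightarrow> (\<forall>x\<in>U. \<xi> x \<in> cotangent_at M x) \<and> smooth_comps M U \<xi>"

lemma real_section_subset: "real_section U s \<Longrightarrow> V \<subseteq> U \<Longrightarrow> real_section V s"
  unfolding real_section_def using smooth_comps_subset by blast

lemma smooth_comps_zero: "smooth_comps M U (\<lambda>y. 0 :: ('m, 'n, real) comps)"
  unfolding smooth_comps_def by (simp add: zero_fun_def smooth_on_const)

lemma real_section_vec: "local_vector_field U u \<Longrightarrow> real_section U (vec_section u)"
  unfolding real_section_def local_vector_field_def
  by (auto simp: vec_section_def gtangent_at_def zero_cotangent o_def smooth_comps_zero)

lemma real_section_form: "local_one_form U \<xi> \<Longrightarrow> real_section U (form_section \<xi>)"
  unfolding real_section_def local_one_form_def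
  by (auto simp: form_section_def gtangent_at_def zero_tangent o_def smooth_comps_zero)

lemma coordinate_section:
  assumes "\<phi> \<in> atlas M"
  shows "local_vector_field (fst \<phi>) (coordinate_vector \<phi> c)" "local_one_form (fst \<phi>) (coordinate_form \<phi> c)"
    "real_section (fst \<phi>) (\<lambda>y. (coordinate_vector \<phi> c y, coordinate_form \<phi> d y))"
  using assms smooth_coordinate_vector smooth_coordinate_form coordinate_vector_tangent coordinate_form_cotangent
  unfolding local_vector_field_def local_one_form_def real_section_def
  by (auto simp: charts_at_def gtangent_at_def o_def)

end


section \<open>Integrability: the torsion of J and its components\<close>

lemma axis_vec_matrix: "(axis i 1 v* A) $ j = A $ i $ j" for A :: "real^'n^'n::finite"
  by (simp add: vector_matrix_mult_def axis_def if_distrib[of "\<lambda>t. t * _"] cong: if_cong)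

lemma sum_axis: "(\<Sum>m\<in>UNIV. axis k (1::real) $ m * f m) = f (k :: 'n::finite)"
  by (simp add: axis_def if_distrib[of "\<lambda>t. t * _"] cong: if_cong)

text \<open>The finite sums behind Cartan's formula \<open>[u,v]\<^sup>\<omega> = \<iota>\<^sub>v\<iota>\<^sub>u d\<omega>\<close>. Here \<open>u k\<close>, \<open>v k\<close> and \<open>W k l\<close> are components
at a point, and \<open>du i k\<close>, \<open>dv i k\<close> and \<open>dW i k l\<close> are their \<open>i\<close>-th partial derivatives. All terms
containing derivatives of \<open>u\<close> or \<open>v\<close> cancel in pairs, after exchanging the names of the summation
indices.\<close>

lemma cartan_sums:
  fixes W :: "'n::finite \<Rightarrow> 'n \<Rightarrow> real"
  assumes W: "\<And>k l. W k l = - W l k" and dW: "\<And>i k l. dW i k l = - dW i l k"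
  shows "(\<Sum>k\<in>UNIV. u k * (\<Sum>l\<in>UNIV. v l * dW k l j + dv k l * W l j) + (\<Sum>l\<in>UNIV. v l * W l k) * du j k)
    - (\<Sum>k\<in>UNIV. v k * ((\<Sum>l\<in>UNIV. u l * dW k l j + du k l * W l j) - (\<Sum>l\<in>UNIV. u l * dW j l k + du j l * W l k)))
    - (\<Sum>l\<in>UNIV. (\<Sum>k\<in>UNIV. u k * dv k l - v k * du k l) * W l j)
    = (\<Sum>k\<in>UNIV. \<Sum>l\<in>UNIV. u k * v l * (dW k l j + dW l j k + dW j k l))"
proof -
  let ?S = "\<lambda>f. \<Sum>k\<in>UNIV. \<Sum>l\<in>UNIV. f k l :: real"
  have sw: "?S f = ?S (\<lambda>k l. f l k)" for f by (rule sum.swap)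
  have 1: "(\<Sum>k\<in>UNIV. u k * (\<Sum>l\<in>UNIV. v l * dW k l j + dv k l * W l j) + (\<Sum>l\<in>UNIV. v l * W l k) * du j k)
      = ?S (\<lambda>k l. u k * v l * dW k l j + u k * dv k l * W l j + v l * W l k * du j k)"
    by (simp add: sum.distrib sum_distrib_left sum_distrib_right algebra_simps)
  have 2: "(\<Sum>k\<in>UNIV. v k * ((\<Sum>l\<in>UNIV. u l * dW k l j + du k l * W l j) - (\<Sum>l\<in>UNIV. u l * dW j l k + du j l * W l k)))
      = ?S (\<lambda>k l. v k * u l * dW k l j + v k * du k l * W l j - v k * u l * dW j l k - v k * du j l * W l k)"
    by (simp add: sum.distrib sum_subtractf sum_distrib_left sum_distrib_right algebra_simps)
  have 3: "(\<Sum>l\<in>UNIV. (\<Sum>k\<in>UNIV. u k * dv k l - v k * du k l) * W l j)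
      = ?S (\<lambda>l k. u k * dv k l * W l j - v k * du k l * W l j)"
    by (simp add: sum_distrib_left sum_distrib_right algebra_simps)
  have 3: "(\<Sum>l\<in>UNIV. (\<Sum>k\<in>UNIV. u k * dv k l - v k * du k l) * W l j)
      = ?S (\<lambda>k l. u k * dv k l * W l j) - ?S (\<lambda>k l. v k * du k l * W l j)"
    unfolding 3 by (subst sw) (simp add: sum_subtractf)
  have 4: "?S (\<lambda>k l. v k * u l * dW k l j) = - ?S (\<lambda>k l. u k * v l * dW l j k)"
  proof -
    have "?S (\<lambda>k l. v k * u l * dW k l j) = ?S (\<lambda>k l. v l * u k * dW l k j)" by (rule sw)
    also have "\<dots> = ?S (\<lambda>k l. - (u k * v l * dW l j k))"
    proof (intro sum.cong refl)
      show "v l * u k * dW l k j = - (u k * v l * dW l j k)" for k l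
        unfolding dW[of l k j] by simp
    qed
    finally show ?thesis by (simp add: sum_negf)
  qed
  have 5: "?S (\<lambda>k l. v k * u l * dW j l k) = ?S (\<lambda>k l. u k * v l * dW j k l)"
    by (subst sw) (simp only: mult.commute)
  have 6: "?S (\<lambda>k l. v k * du j l * W l k) = - ?S (\<lambda>k l. v l * W l k * du j k)"
  proof -
    have "?S (\<lambda>k l. v k * du j l * W l k) = ?S (\<lambda>k l. v l * du j k * W k l)" by (rule sw)
    also have "\<dots> = ?S (\<lambda>k l. - (v l * W l k * du j k))"
    proof (intro sum.cong refl)
      show "v l * du j k * W k l = - (v l * W l k * du j k)" for k l
        unfolding W[of k l] by simp
    qed
    finally show ?thesis by (simp add: sum_negf)
  qed
  show ?thesis
    unfolding 1 2 3 using 4 5 6 by (simp add: sum.distrib sum_subtractf distrib_left)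
qed

context generalized_complex_blocks
begin

lemma smooth_blocks: "smooth_comps M (points M) a" "smooth_comps M (points M) \<pi>" "smooth_comps M (points M) \<omega>"
  using a \<pi> \<omega> unfolding endomorphism_field_def bivector_field_def two_form_def by blast+

lemma smooth_J:
  assumes "openin (mtop M) U" "smooth_comps M U (fst \<circ> s)" "smooth_comps M U (snd \<circ> s)"
  shows "smooth_comps M U (fst \<circ> (\<lambda>y. J y (s y)))" "smooth_comps M U (snd \<circ> (\<lambda>y. J y (s y)))"
proof -
  have s: "smooth_comps M U (\<lambda>y. fst (s y))" "smooth_comps M U (\<lambda>y. snd (s y))"
    using assms(2,3) by (simp_all add: o_def)
  note v = smooth_comps_vec_matrix[OF assms(1) smooth_blocks(1)] smooth_comps_vec_matrix[OF assms(1) smooth_blocks(2)]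
    smooth_comps_vec_matrix[OF assms(1) smooth_blocks(3)]
  show "smooth_comps M U (fst \<circ> (\<lambda>y. J y (s y)))"
    using smooth_comps_linear[OF assms(1) v(1)[OF s(1)] v(5)[OF s(2)], of 1 1]
    by (simp add: block_endo_def o_def plus_fun_def)
  show "smooth_comps M U (snd \<circ> (\<lambda>y. J y (s y)))"
    using smooth_comps_linear[OF assms(1) v(8)[OF s(1)] v(3)[OF s(2)], of 1 "-1"]
    by (simp add: block_endo_def o_def fun_diff_def)
qed

lemma eigen_section:
  assumes "openin (mtop M) U" "real_section U s"
  shows "local_section M L U (complex_section (\<lambda>y. J y (s y)) s)"
  unfolding local_section_def
proof (intro conjI ballI assms(1))
  fix x assume "x \<in> U"
  then show "(x, complex_section (\<lambda>y. J y (s y)) s x) \<in> L"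
    using assms openin_subset[OF assms(1)]
    by (auto simp: L_mem_iff complex_section_def eigen_vector_def real_section_def)
qed (use assms in \<open>auto intro!: smooth_complex_section smooth_J simp: real_section_def\<close>)

text \<open>The sections \<open>S = J s + \<i> s\<close> and \<open>T = J t + \<i> t\<close> of \<open>L\<close> have the bracket \<open>B + \<i> C\<close>, which by involutivity is
orthogonal to \<open>J r + \<i> r\<close> for every constant coordinate section \<open>r\<close>. The real part of this says
\<open>\<langle>B, J r\<rangle> = \<langle>C, r\<rangle>\<close>, that is \<open>C = - J B\<close> since \<open>J\<close> is skew for the pairing; hence \<open>B = J C\<close>, which is the
vanishing of the Nijenhuis torsion of \<open>J\<close> on \<open>s\<close> and \<open>t\<close>.\<close>

lemma nijenhuis_torsion_vanishes:
  assumes U: "openin (mtop M) U" and s: "real_section U s" and t: "real_section U t"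
    and x: "x \<in> U" and \<phi>: "\<phi> \<in> charts_at M x"
    and B: "B = dorfman (\<lambda>y. J y (s y)) (\<lambda>y. J y (t y)) x - dorfman s t x"
    and C: "C = dorfman (\<lambda>y. J y (s y)) t x + dorfman s (\<lambda>y. J y (t y)) x"
  shows "fst B \<phi> = a x \<phi> *v fst C \<phi> + snd C \<phi> v* \<pi> x \<phi>"
    and "snd B \<phi> = fst C \<phi> v* \<omega> x \<phi> - snd C \<phi> v* a x \<phi>"
proof -
  let ?V = "U \<inter> fst \<phi>"
  have V: "openin (mtop M) ?V" and xV: "x \<in> ?V"
    using U x \<phi> openin_chart[of \<phi>] by auto
  have sV: "real_section ?V s" and tV: "real_section ?V t"
    using real_section_subset[OF s] real_section_subset[OF t] by auto
  interpret complex_block_matrix "a x \<phi>" "\<pi> x \<phi>" "\<omega> x \<phi>" by (rule block_matrix[OF \<phi>])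
  have d: "differentiable_section \<phi> s x" "differentiable_section \<phi> t x"
    "differentiable_section \<phi> (\<lambda>y. J y (s y)) x" "differentiable_section \<phi> (\<lambda>y. J y (t y)) x"
    using s t unfolding real_section_def
    by (auto intro!: smooth_differentiable_section[OF U x \<phi>] smooth_J[OF U])
  define S where "S = complex_section (\<lambda>y. J y (s y)) s"
  define T where "T = complex_section (\<lambda>y. J y (t y)) t"
  have fst_ST: "fst (dorfman S T x) \<phi> = of_real_vec (fst B \<phi>) + \<i> *s of_real_vec (fst C \<phi>)"
    and snd_ST: "snd (dorfman S T x) \<phi> = of_real_vec (snd B \<phi>) + \<i> *s of_real_vec (snd C \<phi>)"
    unfolding S_def T_def B C dorfman_complex_section[OF d(3,1,4,2)] by simp_all
  \<comment> \<open>The real part of the pairing of \<open>B + \<i> C\<close> with \<open>J r + \<i> r\<close>, where \<open>r = c + e\<close>.\<close>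
  have test: "dot (snd B \<phi>) (a x \<phi> *v c + e v* \<pi> x \<phi>) - dot (snd C \<phi>) c
      + dot (c v* \<omega> x \<phi> - e v* a x \<phi>) (fst B \<phi>) - dot e (fst C \<phi>) = 0" for c e
  proof -
    let ?r = "\<lambda>y. (coordinate_vector \<phi> c y, coordinate_form \<phi> e y)"
    let ?R = "complex_section (\<lambda>y. J y (?r y)) ?r"
    have "real_section ?V ?r"
      using real_section_subset[OF coordinate_section(3)] charts_atD(1)[OF \<phi>] by blast
    then have "local_section M L ?V S" "local_section M L ?V T" "local_section M L ?V ?R"
      using eigen_section[OF V] sV tV unfolding S_def T_def by blast+
    then have "pairing \<phi> (dorfman S T x) (?R x) = 0"
      using L_involutive xV \<phi> unfolding involutive_def by blast
    then have "Re (pairing \<phi> (dorfman S T x) (?R x)) = 0" by simp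
    then show ?thesis
      unfolding pairing_dot fst_ST snd_ST
      by (simp add: dot_complex complex_section_apply block_endo_def endo_def contract_def dual_endo_def
          coordinate_self[OF \<phi>])
  qed
  have C2: "snd C \<phi> = snd B \<phi> v* a x \<phi> - fst B \<phi> v* \<omega> x \<phi>"
  proof -
    have "dot (snd B \<phi> v* a x \<phi> - fst B \<phi> v* \<omega> x \<phi> - snd C \<phi>) c = 0" for c
      using test[of c 0] dot_skew[OF W_skew, of c "fst B \<phi>"] by (simp add: dot_linear dot_matrix matrix_linear)
    from dot_nondegenerate[OF this] show ?thesis by simp
  qed
  have C1: "fst C \<phi> = - (snd B \<phi> v* \<pi> x \<phi>) - a x \<phi> *v fst B \<phi>"
  proof -
    have "dot (- (snd B \<phi> v* \<pi> x \<phi>) - a x \<phi> *v fst B \<phi> - fst C \<phi>) e = 0" for e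
      using test[of 0 e] dot_skew[OF P_skew, of e "snd B \<phi>"]
      by (simp add: dot_linear dot_matrix matrix_linear dot_commute[of _ e] dot_commute[of "snd B \<phi>"])
    from dot_nondegenerate[OF this] show ?thesis by simp
  qed
  show "fst B \<phi> = a x \<phi> *v fst C \<phi> + snd C \<phi> v* \<pi> x \<phi>"
    unfolding C1 C2 by (simp add: matrix_linear AA' AP)
  show "snd B \<phi> = fst C \<phi> v* \<omega> x \<phi> - snd C \<phi> v* a x \<phi>"
    unfolding C1 C2 by (simp add: matrix_linear PW' WA)
qed

lemma J_vec_section: "J y (vec_section u y) = (endo_field a u y, sharp \<omega> u y)"
  by (simp add: block_endo_def vec_section_def endo_field_def sharp_def)

lemma J_form_section: "J y (form_section \<xi> y) = (sharp \<pi> \<xi> y, - dual_endo_field a \<xi> y)"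
  by (simp add: block_endo_def form_section_def dual_endo_field_def sharp_def)

lemma dorfman_pair:
  "dorfman (\<lambda>y. (u y, \<xi> y)) (\<lambda>y. (v y, \<eta> y)) x =
    (lie_bracket u v x, lie_derivative u \<eta> x - contract (ext_deriv \<xi> x) (v x))"
  by (simp add: dorfman_def o_def)

lemma section_eta: "vec_section u = (\<lambda>y. (u y, 0))" "form_section u = (\<lambda>y. (0, u y))"
  by (auto simp: vec_section_def form_section_def)

lemma form_bracket_eq:
  "form_bracket \<omega> u v x = lie_derivative u (sharp \<omega> v) x - contract (ext_deriv (sharp \<omega> u) x) (v x)
    - sharp \<omega> (lie_bracket u v) x"
  by (simp add: form_bracket_def section_eta dorfman_pair)

text \<open>The torsion of \<open>J\<close> on two vector fields. Its tangent and cotangent parts contain \<open>[u,v]\<close> through \<open>a\<^sup>2[u,v]\<close>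
and \<open>\<pi>\<omega>[u,v]\<close>; collecting these terms into \<open>[u,v]\<^sup>a\<close> and \<open>[u,v]\<^sup>\<omega>\<close> gives the two identities.\<close>

lemma bracket_identities:
  assumes U: "openin (mtop M) U" and u: "local_vector_field U u" and v: "local_vector_field U v"
    and x: "x \<in> U" and \<phi>: "\<phi> \<in> charts_at M x"
  defines "K \<equiv> endo_bracket a u v x \<phi>" and "\<beta> \<equiv> form_bracket \<omega> u v x \<phi>"
  shows "lie_bracket (endo_field a u) (endo_field a v) x \<phi> = a x \<phi> *v K + \<beta> v* \<pi> x \<phi>"
    and "lie_derivative (endo_field a u) (sharp \<omega> v) x \<phi>
      - contract (ext_deriv (sharp \<omega> u) x) (endo_field a v x) \<phi> = K v* \<omega> x \<phi> - \<beta> v* a x \<phi>"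
proof -
  interpret complex_block_matrix "a x \<phi>" "\<pi> x \<phi>" "\<omega> x \<phi>" by (rule block_matrix[OF \<phi>])
  note N = nijenhuis_torsion_vanishes[OF U real_section_vec[OF u] real_section_vec[OF v] x \<phi> refl refl,
      unfolded J_vec_section, unfolded section_eta dorfman_pair, simplified]
  have K: "lie_bracket (endo_field a u) v x \<phi> + lie_bracket u (endo_field a v) x \<phi> = K + a x \<phi> *v lie_bracket u v x \<phi>"
    by (simp add: K_def endo_bracket_def endo_field_def endo_def)
  have b: "lie_derivative u (sharp \<omega> v) x \<phi> - contract (ext_deriv (sharp \<omega> u) x) (v x) \<phi>
      = \<beta> + lie_bracket u v x \<phi> v* \<omega> x \<phi>"
    by (simp add: \<beta>_def form_bracket_eq sharp_def contract_def)
  have b': "- contract (ext_deriv (sharp \<omega> u) x) (v x) \<phi> + lie_derivative u (sharp \<omega> v) x \<phi>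
      = \<beta> + lie_bracket u v x \<phi> v* \<omega> x \<phi>"
    using b by (simp add: algebra_simps)
  show "lie_bracket (endo_field a u) (endo_field a v) x \<phi> = a x \<phi> *v K + \<beta> v* \<pi> x \<phi>"
    using N(1) unfolding K b b' by (simp add: matrix_linear AA')
  show "lie_derivative (endo_field a u) (sharp \<omega> v) x \<phi>
      - contract (ext_deriv (sharp \<omega> u) x) (endo_field a v x) \<phi> = K v* \<omega> x \<phi> - \<beta> v* a x \<phi>"
    using N(2) unfolding K b b' by (simp add: matrix_linear WA)
qed

text \<open>The torsion of \<open>J\<close> on two one-forms: its tangent part is the compatibility of \<open>\<pi>\<close> with brackets that
characterises Poisson bivectors, and its cotangent part is the concomitant of \<open>\<pi>\<close> and \<open>a\<close>.\<close>

lemma form_identities: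
  assumes U: "openin (mtop M) U" and \<xi>: "local_one_form U \<xi>" and \<eta>: "local_one_form U \<eta>"
    and x: "x \<in> U" and \<phi>: "\<phi> \<in> charts_at M x"
  shows "lie_bracket (sharp \<pi> \<xi>) (sharp \<pi> \<eta>) x \<phi> =
      (lie_derivative (sharp \<pi> \<xi>) \<eta> x \<phi> - contract (ext_deriv \<xi> x) (sharp \<pi> \<eta> x) \<phi>) v* \<pi> x \<phi>"
    and "pn_concomitant \<pi> a \<xi> \<eta> x \<phi> = 0"
proof -
  note N = nijenhuis_torsion_vanishes[OF U real_section_form[OF \<xi>] real_section_form[OF \<eta>] x \<phi> refl refl,
      unfolded J_form_section, unfolded section_eta dorfman_pair, simplified]
  have neg: "(\<lambda>y. - dual_endo_field a \<zeta> y) = (\<lambda>y \<psi>. (-1) *s dual_endo_field a \<zeta> y \<psi>)" for \<zeta>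
    by (auto simp: fun_eq_iff vec_eq_iff)
  have d: "differentiable_in_chart \<phi> (\<lambda>y. dual_endo_field a \<zeta> y \<phi> $ j) x" if "local_one_form U \<zeta>" for \<zeta> j
  proof (rule smooth_comps_differentiable[OF _ \<phi> U x])
    show "smooth_comps M U (dual_endo_field a \<zeta>)"
      using smooth_comps_vec_matrix(3)[OF U smooth_blocks(1), of \<zeta>] that
      by (simp add: local_one_form_def dual_endo_field_def[abs_def])
  qed
  show "lie_bracket (sharp \<pi> \<xi>) (sharp \<pi> \<eta>) x \<phi> =
      (lie_derivative (sharp \<pi> \<xi>) \<eta> x \<phi> - contract (ext_deriv \<xi> x) (sharp \<pi> \<eta> x) \<phi>) v* \<pi> x \<phi>"
    using N(1) by (simp add: matrix_linear)
  show "pn_concomitant \<pi> a \<xi> \<eta> x \<phi> = 0"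
    using N(2) unfolding neg lie_derivative_scale[where \<eta> = "dual_endo_field a \<eta>" and \<phi> = \<phi>, OF d[OF \<eta>]]
      ext_deriv_scale[where \<xi> = "dual_endo_field a \<xi>" and \<phi> = \<phi>, OF d[OF \<xi>]]
    by (simp add: pn_concomitant_def matrix_linear sharp_def dual_endo_field_def dual_endo_def vec_eq_iff algebra_simps)
qed

lemma skew_entry:
  assumes "\<phi> \<in> charts_at M y"
  shows "\<pi> y \<phi> $ i $ j = - \<pi> y \<phi> $ j $ i" "\<omega> y \<phi> $ i $ j = - \<omega> y \<phi> $ j $ i"
proof -
  have "transpose (\<pi> y \<phi>) $ j $ i = (- \<pi> y \<phi>) $ j $ i" "transpose (\<omega> y \<phi>) $ j $ i = (- \<omega> y \<phi>) $ j $ i"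
    by (simp_all only: complex_block_matrix.P_skew[OF block_matrix[OF assms]]
        complex_block_matrix.W_skew[OF block_matrix[OF assms]])
  then show "\<pi> y \<phi> $ i $ j = - \<pi> y \<phi> $ j $ i" "\<omega> y \<phi> $ i $ j = - \<omega> y \<phi> $ j $ i"
    by (simp_all add: transpose_def)
qed

text \<open>On the coordinate forms \<open>dx\<^sub>j\<close> and \<open>dx\<^sub>k\<close>, which are constant in the chart, the tangent part of the torsion
reduces to the components of the Schouten square of \<open>\<pi>\<close>.\<close>

lemma poisson: "poisson M \<pi>"
  unfolding poisson_def
proof (intro conjI \<pi> ballI allI)
  fix x \<phi> i j k assume \<phi>: "\<phi> \<in> charts_at M x"
  note \<phi>a = charts_atD(1)[OF \<phi>] and x = charts_atD(2)[OF \<phi>]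
  note U = openin_chart[OF \<phi>a]
  let ?e = "\<lambda>j. coordinate_form \<phi> (axis j 1)"
  have e: "?e j y \<phi> = axis j 1" if "y \<in> fst \<phi>" for y j
    using that \<phi>a by (simp add: coordinate_self charts_at_def)
  have \<pi>e: "sharp \<pi> (?e j) y \<phi> $ i = \<pi> y \<phi> $ j $ i" if "y \<in> fst \<phi>" for y i j
    by (simp add: sharp_def contract_def e[OF that] axis_vec_matrix)
  have pd1: "pd \<phi> l (\<lambda>y. sharp \<pi> (?e j) y \<phi> $ i) x = pd \<phi> l (\<lambda>y. \<pi> y \<phi> $ j $ i) x" for l i j
    by (rule pd_cong[OF \<phi> U x]) (rule \<pi>e)
  have pd2: "pd \<phi> l (\<lambda>y. ?e j y \<phi> $ i) x = 0" for l i j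
    using pd_cong[OF \<phi> U x, of "\<lambda>y. ?e j y \<phi> $ i" "\<lambda>y. axis j 1 $ i"] by (simp add: e)
  have skew_pd: "pd \<phi> l (\<lambda>y. \<pi> y \<phi> $ i $ j) x = - pd \<phi> l (\<lambda>y. \<pi> y \<phi> $ j $ i) x" for l i j
  proof -
    have "pd \<phi> l (\<lambda>y. \<pi> y \<phi> $ i $ j) x = pd \<phi> l (\<lambda>y. - \<pi> y \<phi> $ j $ i) x"
      by (rule pd_cong[OF \<phi> U x]) (rule skew_entry, use \<phi>a in \<open>simp add: charts_at_def\<close>)
    also have "\<dots> = - pd \<phi> l (\<lambda>y. \<pi> y \<phi> $ j $ i) x"
    proof (rule pd_linear[OF bounded_linear_minus[OF bounded_linear_ident]])
      show "differentiable_in_chart \<phi> (\<lambda>y. \<pi> y \<phi> $ j $ i) x"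
        by (rule smooth_comps_matrix_differentiable[OF smooth_comps_subset[OF smooth_blocks(2) openin_subset[OF U]] \<phi> U x])
    qed
    finally show ?thesis .
  qed
  have "lie_bracket (sharp \<pi> (?e j)) (sharp \<pi> (?e k)) x \<phi> $ i =
      ((lie_derivative (sharp \<pi> (?e j)) (?e k) x \<phi> - contract (ext_deriv (?e j) x) (sharp \<pi> (?e k) x) \<phi>) v* \<pi> x \<phi>) $ i"
    by (subst form_identities(1)[OF U coordinate_section(2)[OF \<phi>a] coordinate_section(2)[OF \<phi>a] x \<phi>]) (rule refl)
  then have "(\<Sum>l\<in>UNIV. \<pi> x \<phi> $ j $ l * pd \<phi> l (\<lambda>y. \<pi> y \<phi> $ k $ i) x - \<pi> x \<phi> $ k $ l * pd \<phi> l (\<lambda>y. \<pi> y \<phi> $ j $ i) x)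
      = (\<Sum>l\<in>UNIV. pd \<phi> l (\<lambda>y. \<pi> y \<phi> $ j $ k) x * \<pi> x \<phi> $ l $ i)"
    by (simp add: lie_bracket_def lie_derivative_def ext_deriv_def contract_def vector_matrix_mult_def
        pd1 pd2 \<pi>e[OF x] e[OF x] sum_axis)
  then show "schouten_square \<pi> x \<phi> i j k = 0"
    unfolding schouten_square_def
    by (simp add: skew_entry(1)[OF \<phi>, of _ j] skew_entry(1)[OF \<phi>, of _ k] skew_pd[of _ i j]
      sum.distrib sum_subtractf sum_negf mult.commute)
qed

lemma form_bracket_nth:
  assumes U: "openin (mtop M) U" and u: "local_vector_field U u" and v: "local_vector_field U v"
    and x: "x \<in> U" and \<phi>: "\<phi> \<in> charts_at M x"
  shows "form_bracket \<omega> u v x \<phi> $ j = (\<Sum>k\<in>UNIV. \<Sum>l\<in>UNIV. u x \<phi> $ k * v x \<phi> $ l *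
    (pd \<phi> k (\<lambda>y. \<omega> y \<phi> $ l $ j) x + pd \<phi> l (\<lambda>y. \<omega> y \<phi> $ j $ k) x + pd \<phi> j (\<lambda>y. \<omega> y \<phi> $ k $ l) x))"
proof -
  note \<phi>a = charts_atD(1)[OF \<phi>] and x' = charts_atD(2)[OF \<phi>]
  note inv = chart_inv_left[OF \<phi>a x']
  have d\<omega>: "differentiable_in_chart \<phi> (\<lambda>y. \<omega> y \<phi> $ k $ l) x" for k l
    by (rule smooth_comps_matrix_differentiable[OF smooth_comps_subset[OF smooth_blocks(3) openin_subset[OF U]] \<phi> U x])
  have du: "differentiable_in_chart \<phi> (\<lambda>y. w y \<phi> $ k) x" if "local_vector_field U w" for w k
    using smooth_comps_differentiable[OF _ \<phi> U x] that unfolding local_vector_field_def by blast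
  have pds: "pd \<phi> i (\<lambda>y. sharp \<omega> w y \<phi> $ j) x =
      (\<Sum>l\<in>UNIV. w x \<phi> $ l * pd \<phi> i (\<lambda>y. \<omega> y \<phi> $ l $ j) x + pd \<phi> i (\<lambda>y. w y \<phi> $ l) x * \<omega> x \<phi> $ l $ j)"
    if w: "local_vector_field U w" for w i j
    unfolding sharp_def contract_def vector_matrix_mult_def vec_lambda_beta
    by (subst pd_sum, rule differentiable_in_chart_mult[OF du[OF w] d\<omega>])
      (intro sum.cong refl pd_mult du[OF w] d\<omega> inv)
  have skew_pd: "pd \<phi> l (\<lambda>y. \<omega> y \<phi> $ i $ j) x = - pd \<phi> l (\<lambda>y. \<omega> y \<phi> $ j $ i) x" for l i j
  proof -
    have "pd \<phi> l (\<lambda>y. \<omega> y \<phi> $ i $ j) x = pd \<phi> l (\<lambda>y. - \<omega> y \<phi> $ j $ i) x"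
      by (rule pd_cong[OF \<phi> openin_chart[OF \<phi>a] x']) (rule skew_entry, use \<phi>a in \<open>simp add: charts_at_def\<close>)
    also have "\<dots> = - pd \<phi> l (\<lambda>y. \<omega> y \<phi> $ j $ i) x"
      by (rule pd_linear[OF bounded_linear_minus[OF bounded_linear_ident] d\<omega>])
    finally show ?thesis .
  qed
  have s: "sharp \<omega> w x \<phi> $ j = (\<Sum>l\<in>UNIV. w x \<phi> $ l * \<omega> x \<phi> $ l $ j)" for w j
    by (simp add: sharp_def contract_def vector_matrix_mult_def)
  show ?thesis
    unfolding cartan_sums[where W = "\<lambda>k l. \<omega> x \<phi> $ k $ l" and dW = "\<lambda>i k l. pd \<phi> i (\<lambda>y. \<omega> y \<phi> $ k $ l) x"
        and u = "\<lambda>k. u x \<phi> $ k" and v = "\<lambda>k. v x \<phi> $ k" and du = "\<lambda>i k. pd \<phi> i (\<lambda>y. u y \<phi> $ k) x"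
        and dv = "\<lambda>i k. pd \<phi> i (\<lambda>y. v y \<phi> $ k) x", OF skew_entry(2)[OF \<phi>] skew_pd, symmetric]
    unfolding form_bracket_eq minus_apply vector_minus_component
    by (simp only: lie_derivative_def contract_def ext_deriv_def lie_bracket_def s vector_matrix_mult_def
        vec_lambda_beta pds[OF u] pds[OF v])
qed

lemma form_bracket_closed:
  assumes "closed_two_form M \<omega>" "openin (mtop M) U" "local_vector_field U u" "local_vector_field U v"
    and "x \<in> U" "\<phi> \<in> charts_at M x"
  shows "form_bracket \<omega> u v x \<phi> = 0"
proof -
  have "x \<in> points M" using points_chart assms(6) by blast
  then show ?thesis
    using assms(1,6) unfolding vec_eq_iff form_bracket_nth[OF assms(2-6)] closed_two_form_def by simp
qed

end


section \<open>Involutivity of the product of L and its conjugate\<close>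

context generalized_complex_blocks
begin

text \<open>The section \<open>e(u) = a u + (1/2) \<omega> u\<close> of the introduction, for a real vector field \<open>u\<close>.\<close>

definition half_section :: "('m \<Rightarrow> ('m, 'n, real) comps) \<Rightarrow> 'm \<Rightarrow> ('m, 'n, real) gcomps" where
  "half_section u y = (endo_field a u y, \<lambda>\<phi>. (1/2) *s sharp \<omega> u y \<phi>)"

lemma half_section_apply:
  "fst (half_section u y) \<phi> = a y \<phi> *v u y \<phi>" "snd (half_section u y) \<phi> = (1/2) *s (u y \<phi> v* \<omega> y \<phi>)"
  by (simp_all add: half_section_def endo_field_def endo_def sharp_def contract_def)

lemma smooth_half_section:
  assumes "openin (mtop M) U" "local_vector_field U u"
  shows "smooth_comps M U (fst \<circ> half_section u)" "smooth_comps M U (snd \<circ> half_section u)"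
    "smooth_comps M U (sharp \<omega> u)"
proof -
  have u: "smooth_comps M U u" using assms(2) by (simp add: local_vector_field_def)
  note v = smooth_comps_vec_matrix[OF assms(1) smooth_blocks(1) u] smooth_comps_vec_matrix[OF assms(1) smooth_blocks(3) u]
  show "smooth_comps M U (fst \<circ> half_section u)"
    using v(1) by (simp add: half_section_def o_def endo_field_def)
  show *: "smooth_comps M U (sharp \<omega> u)"
    using v(5) by (simp add: sharp_def[abs_def])
  show "smooth_comps M U (snd \<circ> half_section u)"
    using smooth_comps_linear[OF assms(1) * *, of "1/2" 0] by (simp add: half_section_def o_def)
qed

text \<open>Both sides are one-forms; evaluated on \<open>w\<close> they are \<open>\<langle>[e(u), e(v)], e(w)\<rangle>\<close> and \<open>(1/2) d\<omega>(u, v, w)\<close>. After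
inserting \<open>bracket_identities\<close> the terms with \<open>[u,v]\<^sup>a\<close> cancel by \<open>a*\<omega> = \<omega>a\<close>, and what remains is
\<open>- (1/2) (a* a* \<beta> + \<omega>\<pi> \<beta>) = (1/2) \<beta>\<close>.\<close>

lemma half_section_bracket:
  assumes U: "openin (mtop M) U" and u: "local_vector_field U u" and v: "local_vector_field U v"
    and x: "x \<in> U" and \<phi>: "\<phi> \<in> charts_at M x"
  shows "snd (dorfman (half_section u) (half_section v) x) \<phi> v* a x \<phi>
    - (1/2) *s (fst (dorfman (half_section u) (half_section v) x) \<phi> v* \<omega> x \<phi>) = (1/2) *s form_bracket \<omega> u v x \<phi>"
proof -
  interpret complex_block_matrix "a x \<phi>" "\<pi> x \<phi>" "\<omega> x \<phi>" by (rule block_matrix[OF \<phi>])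
  have d: "differentiable_in_chart \<phi> (\<lambda>y. sharp \<omega> w y \<phi> $ j) x" if "local_vector_field U w" for w j
    by (rule smooth_comps_differentiable[OF smooth_half_section(3)[OF U that] \<phi> U x])
  note br = bracket_identities[OF U u v x \<phi>]
  have 1: "fst (dorfman (half_section u) (half_section v) x) \<phi> =
      a x \<phi> *v endo_bracket a u v x \<phi> + form_bracket \<omega> u v x \<phi> v* \<pi> x \<phi>"
    using br(1) by (simp add: half_section_def[abs_def] dorfman_pair)
  have "snd (dorfman (half_section u) (half_section v) x) \<phi> =
      (1/2) *s (lie_derivative (endo_field a u) (sharp \<omega> v) x \<phi>
        - contract (ext_deriv (sharp \<omega> u) x) (endo_field a v x) \<phi>)"
    by (simp add: half_section_def[abs_def] dorfman_pair lie_derivative_scale[where \<phi> = \<phi> and \<eta> = "sharp \<omega> v", OF d[OF v]]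
       ext_deriv_scale[where \<phi> = \<phi> and \<xi> = "sharp \<omega> u", OF d[OF u]] vec_eq_iff algebra_simps)
  then have 2: "snd (dorfman (half_section u) (half_section v) x) \<phi> =
      (1/2) *s (endo_bracket a u v x \<phi> v* \<omega> x \<phi> - form_bracket \<omega> u v x \<phi> v* a x \<phi>)"
    unfolding br(2) .
  show ?thesis unfolding 1 2
    by (simp add: matrix_linear WA PW' vec_eq_iff algebra_simps)
qed

lemma half_section_in_D:
  assumes "x \<in> points M" "u x \<in> tangent_at M x" "v x \<in> tangent_at M x"
  shows "(x, complex_section (half_section u) (half_section v) x) \<in> D"
proof -
  let ?p = "\<lambda>\<phi>. 1 *s of_real_vec (u x \<phi>) + \<i> *s of_real_vec (v x \<phi>)"
  have p: "?p \<in> tangent_at M x" by (intro tangent_at_linear tangent_of_real assms)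
  have eq: "complex_section (half_section u) (half_section v) x =
      (endo (complex_multiple 1 a x) ?p, contract (complex_multiple (1/2) \<omega> x) ?p)"
  proof (intro prod_eqI ext)
    fix \<phi>
    show "fst (complex_section (half_section u) (half_section v) x) \<phi> =
        fst (endo (complex_multiple 1 a x) ?p, contract (complex_multiple (1/2) \<omega> x) ?p) \<phi>"
      by (simp add: complex_section_apply half_section_apply complex_multiple_apply complex_vec_eq_iff)
    have "of_real_vec ((1/2) *s w) = (1/2) *s of_real_vec w" for w :: "real^'n"
      by (simp add: of_real_vec_def vec_eq_iff)
    moreover have "of_real_vec (w v* B) = of_real_vec w v* complex_matrix B" for w :: "real^'n" and B
      by (simp add: complex_vec_eq_iff matrix_linear)
    ultimately show "snd (complex_section (half_section u) (half_section v) x) \<phi> =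
        snd (endo (complex_multiple 1 a x) ?p, contract (complex_multiple (1/2) \<omega> x) ?p) \<phi>"
      by (simp add: complex_section_apply half_section_apply complex_multiple_apply matrix_linear)
  qed
  show ?thesis unfolding eq mem_D_iff using assms(1) p by blast
qed

lemma half_section_local:
  assumes "openin (mtop M) U" "local_vector_field U u" "local_vector_field U v"
  shows "local_section M D U (complex_section (half_section u) (half_section v))"
  unfolding local_section_def
proof (intro conjI ballI assms(1))
  show "(x, complex_section (half_section u) (half_section v) x) \<in> D" if "x \<in> U" for x
    using half_section_in_D that assms openin_subset[OF assms(1)] unfolding local_vector_field_def by blast
qed (intro smooth_complex_section smooth_half_section assms)+

lemma smooth_re_im:
  fixes V :: "'m \<Rightarrow> ('m, 'n, complex) comps"
  assumes "openin (mtop M) U" "smooth_comps M U V"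
  shows "smooth_comps M U (\<lambda>y \<phi>. re_vec (V y \<phi>))" "smooth_comps M U (\<lambda>y \<phi>. im_vec (V y \<phi>))"
  unfolding smooth_comps_nth[OF assms(1)] re_vec_def im_vec_def vec_lambda_beta
  by (intro ballI allI, rule smooth_on_linear, erule open_chart_image, rule assms(1),
      rule bounded_linear_Re bounded_linear_Im, rule smooth_comps_nthD[OF assms(2,1)], assumption)+

text \<open>Smooth sections of \<open>D\<close> come from smooth vector fields, because \<open>p = - a V - 2 \<pi> \<xi>\<close> inverts \<open>e\<close> on \<open>D\<close> by a
formula with smooth coefficients.\<close>

lemma D_section_split:
  assumes U: "openin (mtop M) U" and s: "local_section M D U s"
  obtains u v where "local_vector_field U u" "local_vector_field U v"
    "\<And>y. y \<in> U \<Longrightarrow> s y = complex_section (half_section u) (half_section v) y"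
proof -
  define P where "P y = (\<lambda>\<phi>. (-1) *s (complex_matrix (a y \<phi>) *v fst (s y) \<phi>)
      + (-2) *s (snd (s y) \<phi> v* complex_matrix (\<pi> y \<phi>)))" for y
  define Q where "Q h y = (\<lambda>\<phi>. (-1) *s endo (a y) (\<lambda>\<phi>. h (fst (s y) \<phi>)) \<phi>
      + (-2) *s contract (\<pi> y) (\<lambda>\<phi>. h (snd (s y) \<phi>)) \<phi>)" for h :: "complex^'n \<Rightarrow> real^'n" and y
  let ?u = "Q re_vec" and ?v = "Q im_vec"
  have Q: "re_vec (P y \<phi>) = ?u y \<phi>" "im_vec (P y \<phi>) = ?v y \<phi>" for y \<phi>
    by (simp_all add: P_def Q_def endo_def contract_def re_vec_def im_vec_def vec_eq_iff
       matrix_vector_mult_def vector_matrix_mult_def)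
  have mem: "(y, s y) \<in> D" if "y \<in> U" for y using s that unfolding local_section_def by blast
  have Pt: "P y \<in> tangent_at M y" if "y \<in> U" for y
  proof -
    have "fst (s y) \<in> tangent_at M y" "snd (s y) \<in> cotangent_at M y"
      using D_lagrangian mem[OF that] unfolding complex_lagrangian_family_def total_space_def gtangent_at_def
      by auto
    then show ?thesis unfolding P_def by (intro tangent_at_linear endo_tangent sharp_tangent)
  qed
  have P_eq: "fst (s y) = endo (complex_multiple 1 a y) (P y) \<and> snd (s y) = contract (complex_multiple (1/2) \<omega> y) (P y)"
    if y: "y \<in> U" for y
  proof -
    obtain p where p: "p \<in> tangent_at M y" "fst (s y) = endo (complex_multiple 1 a y) p"
      "snd (s y) = contract (complex_multiple (1/2) \<omega> y) p"
      using mem[OF y] mem_D_iff[of y "fst (s y)" "snd (s y)"] by auto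
    have "P y = p"
    proof (rule comps_eqI[where x = y])
      fix \<phi> assume "\<phi> \<in> charts_at M y"
      then interpret complex_block_matrix "complex_matrix (a y \<phi>)" "complex_matrix (\<pi> y \<phi>)" "complex_matrix (\<omega> y \<phi>)"
        by (rule complex_block_matrix)
      show "P y \<phi> = p \<phi>"
        unfolding P_def p complex_multiple_apply by (simp add: matrix_linear AA')
    qed (use Pt[OF y] p in blast)+
    then show ?thesis using p by simp
  qed
  have sm: "smooth_comps M U (fst \<circ> s)" "smooth_comps M U (snd \<circ> s)" using s unfolding local_section_def by blast+
  have smQ: "smooth_comps M U (Q h)" if "\<And>V :: 'm \<Rightarrow> ('m, 'n, complex) comps. smooth_comps M U V \<Longrightarrow> smooth_comps M U (\<lambda>y \<phi>. h (V y \<phi>))" for h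
    unfolding Q_def
    by (rule smooth_comps_linear[OF U smooth_comps_vec_matrix(1)[OF U smooth_blocks(1)] smooth_comps_vec_matrix(2)[OF U smooth_blocks(2)]])
      (use that[OF sm(1)] that[OF sm(2)] in \<open>simp_all add: o_def\<close>)
  have "local_vector_field U ?u" "local_vector_field U ?v"
    unfolding local_vector_field_def
    using tangent_re_im[OF Pt] smQ[OF smooth_re_im(1)[OF U]] smQ[OF smooth_re_im(2)[OF U]]
    by (simp_all add: Q)
  moreover have "s y = complex_section (half_section ?u) (half_section ?v) y" if "y \<in> U" for y
  proof (intro prod_eqI ext)
    fix \<phi>
    have e: "fst (s y) = endo (complex_multiple 1 a y) (P y)" "snd (s y) = contract (complex_multiple (1/2) \<omega> y) (P y)"
      using P_eq[OF that] by blast+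
    show "fst (s y) \<phi> = fst (complex_section (half_section ?u) (half_section ?v) y) \<phi>"
      unfolding e(1) by (simp add: complex_section_apply half_section_apply complex_multiple_apply complex_vec_eq_iff Q)
    have "re_vec ((1/2) *s z) = (1/2) *s re_vec z" "im_vec ((1/2) *s z) = (1/2) *s im_vec z" for z :: "complex^'n"
      by (simp_all add: re_vec_def im_vec_def vec_eq_iff)
    then show "snd (s y) \<phi> = snd (complex_section (half_section ?u) (half_section ?v) y) \<phi>"
      unfolding e(2) by (simp add: complex_section_apply half_section_apply complex_multiple_apply complex_vec_eq_iff Q)
  qed
  ultimately show ?thesis by (rule that)
qed

text \<open>Coordinate vector fields detect every component of \<open>d\<omega>\<close>, which gives one direction. For the other,
\<open>D_section_split\<close> and bilinearity reduce the bracket of arbitrary complex sections to real brackets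
\<open>[e(u), e(v)]\<close>, all of which are orthogonal to \<open>D\<close> once \<open>\<omega>\<close> is closed.\<close>

lemma weak_concurrence: "involutive M D \<longleftrightarrow> closed_two_form M \<omega>"
proof
  assume inv: "involutive M D"
  show "closed_two_form M \<omega>"
    unfolding closed_two_form_def
  proof (intro ballI allI)
    fix x \<phi> i j k assume \<phi>: "\<phi> \<in> charts_at M x"
    note \<phi>a = charts_atD(1)[OF \<phi>] and x = charts_atD(2)[OF \<phi>]
    note U = openin_chart[OF \<phi>a]
    let ?c = "coordinate_vector \<phi>"
    have c: "local_vector_field (fst \<phi>) (?c e)" for e by (rule coordinate_section(1)[OF \<phi>a])
    have z: "local_vector_field (fst \<phi>) (\<lambda>y. 0)"
      by (simp add: local_vector_field_def zero_tangent smooth_comps_zero)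
    have h0: "half_section (\<lambda>y. 0) = (\<lambda>y. (0, 0))"
      by (auto simp: half_section_def endo_field_def sharp_def fun_eq_iff)
    have dz: "dorfman (\<lambda>y. (0, 0)) (\<lambda>y. (0, 0)) x = 0"
      by (simp add: dorfman_pair zero_prod_def)
    have d: "differentiable_section \<phi> (half_section w) x" if "local_vector_field (fst \<phi>) w" for w
      by (rule smooth_differentiable_section[OF U x \<phi> smooth_half_section(1,2)[OF U that]])
    let ?S = "\<lambda>e. complex_section (half_section (?c e)) (half_section (\<lambda>y. 0))"
    have "dot (form_bracket \<omega> (?c (axis i 1)) (?c (axis j 1)) x \<phi>) r = 0" for r
    proof -
      let ?B = "dorfman (half_section (?c (axis i 1))) (half_section (?c (axis j 1))) x"
      have "pairing \<phi> (dorfman (?S (axis i 1)) (?S (axis j 1)) x) (?S r x) = 0"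
        using inv half_section_local[OF U c z] x \<phi> unfolding involutive_def by blast
      then have "Re (pairing \<phi> (dorfman (?S (axis i 1)) (?S (axis j 1)) x) (?S r x)) = 0" by simp
      then have "dot (snd ?B \<phi>) (a x \<phi> *v r) + dot ((1/2) *s (r v* \<omega> x \<phi>)) (fst ?B \<phi>) = 0"
        unfolding pairing_dot dorfman_complex_section[OF d[OF c] d[OF z] d[OF c] d[OF z]]
        by (simp add: dot_complex complex_section_apply half_section_apply coordinate_self[OF \<phi>] dot_linear matrix_linear
            h0 dz)
      then have "dot (snd ?B \<phi> v* a x \<phi> - (1/2) *s (fst ?B \<phi> v* \<omega> x \<phi>)) r = 0"
        using dot_skew[OF complex_block_matrix.W_skew[OF block_matrix[OF \<phi>]], of r "fst ?B \<phi>"]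
        by (simp add: dot_linear dot_matrix)
      then show ?thesis
        unfolding half_section_bracket[OF U c c x \<phi>] by (simp add: dot_linear)
    qed
    from dot_nondegenerate[OF this]
    have "form_bracket \<omega> (?c (axis i 1)) (?c (axis j 1)) x \<phi> $ k = 0" by simp
    then show "pd \<phi> i (\<lambda>y. \<omega> y \<phi> $ j $ k) x + pd \<phi> j (\<lambda>y. \<omega> y \<phi> $ k $ i) x + pd \<phi> k (\<lambda>y. \<omega> y \<phi> $ i $ j) x = 0"
      unfolding form_bracket_nth[OF U c c x \<phi>]
      by (simp add: coordinate_self[OF \<phi>] mult.assoc sum_axis flip: sum_distrib_left)
  qed
next
  assume closed: "closed_two_form M \<omega>"
  show "involutive M D"
    unfolding involutive_def
  proof (intro allI impI ballI, elim conjE)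
    fix U s1 s2 s3 x \<phi>
    assume s1: "local_section M D U s1" and s2: "local_section M D U s2" and s3: "local_section M D U s3"
      and x: "x \<in> U" and \<phi>: "\<phi> \<in> charts_at M x"
    have U: "openin (mtop M) U" using s1 by (simp add: local_section_def)
    obtain u u' where u: "local_vector_field U u" "local_vector_field U u'"
      "\<And>y. y \<in> U \<Longrightarrow> s1 y = complex_section (half_section u) (half_section u') y"
      using D_section_split[OF U s1] by blast
    obtain v v' where v: "local_vector_field U v" "local_vector_field U v'"
      "\<And>y. y \<in> U \<Longrightarrow> s2 y = complex_section (half_section v) (half_section v') y"
      using D_section_split[OF U s2] by blast
    have "(x, s3 x) \<in> D" using s3 x unfolding local_section_def by blast
    then obtain p where p: "fst (s3 x) = endo (complex_multiple 1 a x) p" "snd (s3 x) = contract (complex_multiple (1/2) \<omega> x) p"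
      using mem_D_iff[of x "fst (s3 x)" "snd (s3 x)"] by auto
    have d: "differentiable_section \<phi> (half_section w) x" if "local_vector_field U w" for w
      by (rule smooth_differentiable_section[OF U x \<phi> smooth_half_section(1,2)[OF U that]])
    let ?B = "dorfman s1 s2 x"
    have real: "snd (dorfman (half_section w) (half_section w') x) \<phi> v* a x \<phi>
        = (1/2) *s (fst (dorfman (half_section w) (half_section w') x) \<phi> v* \<omega> x \<phi>)"
      if "local_vector_field U w" "local_vector_field U w'" for w w'
      using half_section_bracket[OF U that x \<phi>] form_bracket_closed[OF closed U that x \<phi>] by simp
    have h: "re_vec ((1/2) *s z) = (1/2) *s re_vec z" "im_vec ((1/2) *s z) = (1/2) *s im_vec z" for z :: "complex^'n"
      by (simp_all add: re_vec_def im_vec_def vec_eq_iff)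
    have cong: "fst ?B \<phi> = fst (dorfman (complex_section (half_section u) (half_section u'))
          (complex_section (half_section v) (half_section v')) x) \<phi>"
      "snd ?B \<phi> = snd (dorfman (complex_section (half_section u) (half_section u'))
          (complex_section (half_section v) (half_section v')) x) \<phi>"
      by (rule dorfman_cong[OF U x \<phi>]; use u(3) v(3) in blast)+
    have B: "snd ?B \<phi> v* complex_matrix (a x \<phi>) = (1/2) *s (fst ?B \<phi> v* complex_matrix (\<omega> x \<phi>))"
      unfolding cong dorfman_complex_section[OF d[OF u(1)] d[OF u(2)] d[OF v(1)] d[OF v(2)]]
      by (simp add: complex_vec_eq_iff h) (simp add: matrix_linear real u(1,2) v(1,2) vec_eq_iff)
    show "pairing \<phi> ?B (s3 x) = 0"
      unfolding pairing_dot p complex_multiple_apply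
      using dot_skew[OF complex_block_matrix.W_skew[OF complex_block_matrix[OF \<phi>]], of "p \<phi>" "fst ?B \<phi>"]
        arg_cong[OF B, of "\<lambda>z. dot z (p \<phi>)"]
      by (simp add: dot_linear dot_matrix)
  qed
qed

text \<open>The images under \<open>e\<close> of the coordinate vector fields of a chart form a frame, since \<open>e\<close> is linear and
injective in each fibre and tangent vectors are determined by their components in one chart.\<close>

lemma D_subbundle: "vector_subbundle M D"
  unfolding vector_subbundle_def
proof (intro conjI ballI)
  show "D \<subseteq> total_space M" using D_lagrangian by (simp add: complex_lagrangian_family_def)
  fix x assume "x \<in> points M"
  then obtain \<phi> where \<phi>: "\<phi> \<in> charts_at M x" using points_chart by blast
  note \<phi>a = charts_atD(1)[OF \<phi>] and x = charts_atD(2)[OF \<phi>]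
  note U = openin_chart[OF \<phi>a]
  obtain f :: "nat \<Rightarrow> 'n" where f: "bij_betw f {..<CARD('n)} UNIV"
    using ex_bij_betw_nat_finite[of "UNIV :: 'n set"] by (auto simp: atLeast0LessThan)
  have z: "local_vector_field (fst \<phi>) (\<lambda>y. 0)"
    by (simp add: local_vector_field_def zero_tangent smooth_comps_zero)
  let ?v = "\<lambda>i. coordinate_vector \<phi> (axis (f i) 1)"
  define e where "e i = complex_section (half_section (?v i)) (half_section (\<lambda>y. 0))" for i
  define P where "P c y = (\<lambda>\<psi>. \<Sum>i<CARD('n). c i *s of_real_vec (?v i y \<psi>))" for c y
  have e: "local_section M D (fst \<phi>) (e i)" for i
    unfolding e_def by (rule half_section_local[OF U coordinate_section(1)[OF \<phi>a] z])
  have sumP: "(\<Sum>i<CARD('n). gscale (c i) (e i y)) = (endo (complex_multiple 1 a y) (P c y), contract (complex_multiple (1/2) \<omega> y) (P c y))" for c y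
  proof (intro prod_eqI ext)
    fix \<psi>
    have lin: "B *v (\<Sum>i\<in>I. g i) = (\<Sum>i\<in>I. B *v g i)" "(\<Sum>i\<in>I. g i) v* B = (\<Sum>i\<in>I. g i v* B)"
      for B :: "complex^'n^'n" and g and I :: "nat set"
      by (induction I rule: infinite_finite_induct) (simp_all add: matrix_linear)
    have sc: "k *s (\<Sum>i\<in>I. g i) = (\<Sum>i\<in>I. k *s g i)" for k and g :: "nat \<Rightarrow> complex^'n" and I
      by (simp add: vec_eq_iff sum_distrib_left)
    have fs: "(\<Sum>i\<in>I. g i) \<psi> = (\<Sum>i\<in>I. g i \<psi>)" for g :: "nat \<Rightarrow> ('m, 'n, complex) comps" and I
      by (induction I rule: infinite_finite_induct) auto
    have r: "of_real_vec (B *v w) = complex_matrix B *v of_real_vec w"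
      "of_real_vec (w v* B) = of_real_vec w v* complex_matrix B"
      "of_real_vec ((1/2) *s w) = (1/2) *s of_real_vec w" "\<i> *s of_real_vec 0 = (0 :: complex^'n)"
      for w :: "real^'n" and B
      by (simp_all add: complex_vec_eq_iff matrix_linear) (simp_all add: of_real_vec_def vec_eq_iff re_vec_def im_vec_def)
    show "fst (\<Sum>i<CARD('n). gscale (c i) (e i y)) \<psi> =
        fst (endo (complex_multiple 1 a y) (P c y), contract (complex_multiple (1/2) \<omega> y) (P c y)) \<psi>"
      by (simp add: fst_sum fs gscale_def e_def complex_section_apply half_section_apply complex_multiple_apply
          P_def lin r matrix_linear)
    show "snd (\<Sum>i<CARD('n). gscale (c i) (e i y)) \<psi> =
        snd (endo (complex_multiple 1 a y) (P c y), contract (complex_multiple (1/2) \<omega> y) (P c y)) \<psi>"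
      by (simp add: snd_sum fs gscale_def e_def complex_section_apply half_section_apply complex_multiple_apply
          P_def lin r matrix_linear sc)
  qed
  have \<phi>y: "\<phi> \<in> charts_at M y" if "y \<in> fst \<phi>" for y using \<phi>a that by (simp add: charts_at_def)
  have P_nth: "P c y \<phi> $ f i = c i" if "y \<in> fst \<phi>" "i < CARD('n)" for c y i
  proof -
    have ax: "axis (f j) (1 :: real) $ f i = (if j = i then 1 else 0)" if "j < CARD('n)" for j
      using f \<open>i < CARD('n)\<close> that by (auto simp: axis_def bij_betw_def inj_on_def)
    have "P c y \<phi> $ f i = (\<Sum>j<CARD('n). c j * complex_of_real (axis (f j) 1 $ f i))"
      by (simp add: P_def coordinate_self[OF \<phi>y[OF that(1)]] of_real_vec_def)
    also have "\<dots> = (\<Sum>j<CARD('n). if j = i then c j else 0)"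
      by (intro sum.cong refl) (simp add: ax)
    finally show ?thesis using that(2) by simp
  qed
  have P_tangent: "P c y \<in> tangent_at M y" if "y \<in> fst \<phi>" for c y
  proof -
    have "(\<lambda>\<psi>. \<Sum>i\<in>I. c i *s of_real_vec (?v i y \<psi>)) \<in> tangent_at M y" for I :: "nat set"
    proof (induction I rule: infinite_finite_induct)
      case (insert i I)
      then show ?case
        using tangent_at_linear[OF tangent_of_real[OF coordinate_vector_tangent[OF \<phi>y[OF that]]] insert.IH, of "c i" "axis (f i) 1" 1]
        by simp
    qed (use zero_tangent in \<open>simp_all add: zero_fun_def\<close>)
    then show ?thesis unfolding P_def .
  qed
  show "\<exists>U r e. x \<in> U \<and> (\<forall>i<r::nat. local_section M D U (e i)) \<and> openin (mtop M) U \<and>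
      (\<forall>y\<in>U. fibre D y = range (\<lambda>c. \<Sum>i<r. gscale (c i) (e i y)) \<and>
         (\<forall>c. (\<Sum>i<r. gscale (c i) (e i y)) = 0 \<longrightarrow> (\<forall>i<r. c i = 0)))"
  proof (intro exI conjI ballI allI impI)
    show "x \<in> fst \<phi>" "openin (mtop M) (fst \<phi>)" by (fact x U)+
    show "local_section M D (fst \<phi>) (e i)" if "i < CARD('n)" for i by (rule e)
    fix y assume y: "y \<in> fst \<phi>"
    have yM: "y \<in> points M" using \<phi>y[OF y] points_chart by blast
    show "fibre D y = range (\<lambda>c. \<Sum>i<CARD('n). gscale (c i) (e i y))"
    proof (intro equalityI subsetI)
      fix s assume "s \<in> fibre D y"
      then obtain p where p: "p \<in> tangent_at M y" "s = (endo (complex_multiple 1 a y) p, contract (complex_multiple (1/2) \<omega> y) p)"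
        using mem_D_iff[of y "fst s" "snd s"] by (auto simp: fibre_def prod_eq_iff)
      define c where "c i = p \<phi> $ f i" for i
      have "P c y \<phi> $ k = p \<phi> $ k" for k
      proof -
        obtain i where i: "i < CARD('n)" "k = f i" using f by (auto simp: bij_betw_def image_iff set_eq_iff) 
        then show ?thesis using P_nth[OF y i(1), of c] by (simp add: c_def)
      qed
      then have "P c y \<phi> = p \<phi>" by (simp add: vec_eq_iff)
      have "P c y = p"
      proof (rule comps_eqI[where x = y])
        fix \<psi> assume \<psi>: "\<psi> \<in> charts_at M y"
        show "P c y \<psi> = p \<psi>"
          unfolding tangent_atD(2)[OF p(1) \<phi>y[OF y] \<psi>] tangent_atD(2)[OF P_tangent[OF y] \<phi>y[OF y] \<psi>]
          using \<open>P c y \<phi> = p \<phi>\<close> by simp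
      qed (use p P_tangent[OF y] in blast)+
      then show "s \<in> range (\<lambda>c. \<Sum>i<CARD('n). gscale (c i) (e i y))"
        using sumP[of c y] p(2) by (intro range_eqI[of _ _ c]) simp
    next
      fix s assume "s \<in> range (\<lambda>c. \<Sum>i<CARD('n). gscale (c i) (e i y))"
      then obtain c where s: "s = (endo (complex_multiple 1 a y) (P c y), contract (complex_multiple (1/2) \<omega> y) (P c y))"
        unfolding sumP by blast
      have "(y, s) \<in> D" unfolding s mem_D_iff using yM P_tangent[OF y] by blast
      then show "s \<in> fibre D y" by (simp add: fibre_def)
    qed
    fix c i assume c: "(\<Sum>i<CARD('n). gscale (c i) (e i y)) = 0" and i: "i < CARD('n)"
    interpret complex_block_matrix "complex_matrix (a y \<phi>)" "complex_matrix (\<pi> y \<phi>)" "complex_matrix (\<omega> y \<phi>)"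
      by (rule complex_block_matrix[OF \<phi>y[OF y]])
    have "endo (complex_multiple 1 a y) (P c y) \<phi> = 0" "contract (complex_multiple (1/2) \<omega> y) (P c y) \<phi> = 0"
      using c unfolding sumP by (simp_all add: zero_prod_def)
    then have "complex_matrix (a y \<phi>) *v P c y \<phi> = 0" "P c y \<phi> v* complex_matrix (\<omega> y \<phi>) = 0"
      by (simp_all add: complex_multiple_apply vec_eq_iff)
    then have "P c y \<phi> = 0" using AA[of "P c y \<phi>"] by (simp add: matrix_linear)
    then show "c i = 0" using P_nth[OF y i, of c] by simp
  qed
qed

lemma pn_structure:
  assumes "nijenhuis M a"
  shows "PN_structure M \<pi> a"
  unfolding PN_structure_def
proof (intro conjI allI impI ballI poisson assms)
  fix \<xi> \<eta> x \<phi> assume f: "one_form M \<xi> \<and> one_form M \<eta>" and x: "x \<in> points M" and \<phi>: "\<phi> \<in> charts_at M x"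
  interpret complex_block_matrix "a x \<phi>" "\<pi> x \<phi>" "\<omega> x \<phi>" by (rule block_matrix[OF \<phi>])
  have ev: "evaluate P s t \<phi> = dot (s \<phi> v* P \<phi>) (t \<phi>)" for P :: "('m, 'n, real) mcomps" and s t
    unfolding evaluate_def dot_def vector_matrix_mult_def vec_lambda_beta sum_distrib_right
    by (subst sum.swap) (simp add: mult_ac)
  show "evaluate (\<pi> x) (dual_endo_field a \<xi> x) (\<eta> x) \<phi> = evaluate (\<pi> x) (\<xi> x) (dual_endo_field a \<eta> x) \<phi>"
    unfolding ev dual_endo_field_def dual_endo_def
    by (metis AP dot_commute dot_matrix)
  show "pn_concomitant \<pi> a \<xi> \<eta> x \<phi> = 0"
    by (rule form_identities(2)[OF openin_topspace _ _ x \<phi>]) (use f in \<open>auto simp: one_form_def local_one_form_def\<close>)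
qed

lemma omega_n_structure:
  assumes closed: "closed_two_form M \<omega>"
  shows "omega_N_structure M \<omega> a"
  unfolding omega_N_structure_def
proof (intro conjI allI impI ballI \<omega> closed)
  have loc: "local_vector_field (points M) u" if "vector_field M u" for u
    using that by (simp add: vector_field_def local_vector_field_def)
  have br: "lie_bracket (endo_field a u) (endo_field a v) x \<phi> = a x \<phi> *v endo_bracket a u v x \<phi>"
    "lie_derivative (endo_field a u) (sharp \<omega> v) x \<phi>
      - contract (ext_deriv (sharp \<omega> u) x) (endo_field a v x) \<phi> = endo_bracket a u v x \<phi> v* \<omega> x \<phi>"
    "form_bracket \<omega> u v x \<phi> = 0"
    if "vector_field M u" "vector_field M v" "x \<in> points M" "\<phi> \<in> charts_at M x" for u v x \<phi>
    using bracket_identities[OF openin_topspace loc[OF that(1)] loc[OF that(2)] that(3,4)]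
      form_bracket_closed[OF closed openin_topspace loc[OF that(1)] loc[OF that(2)] that(3,4)]
    by (simp_all add: matrix_linear)
  show "nijenhuis M a"
    unfolding nijenhuis_def using a br(1) by (auto simp: endo_field_def endo_def)
  fix u v x \<phi> assume f: "vector_field M u \<and> vector_field M v" and x: "x \<in> points M" and \<phi>: "\<phi> \<in> charts_at M x"
  interpret complex_block_matrix "a x \<phi>" "\<pi> x \<phi>" "\<omega> x \<phi>" by (rule block_matrix[OF \<phi>])
  have ev: "evaluate P s t \<phi> = dot (s \<phi> v* P \<phi>) (t \<phi>)" for P :: "('m, 'n, real) mcomps" and s t
    unfolding evaluate_def dot_def vector_matrix_mult_def vec_lambda_beta sum_distrib_right
    by (subst sum.swap) (simp add: mult_ac)
  show "evaluate (\<omega> x) (endo_field a u x) (v x) \<phi> = evaluate (\<omega> x) (u x) (endo_field a v x) \<phi>"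
    unfolding ev endo_field_def endo_def WA by (simp add: dot_matrix)
  show "fst (omega_n_concomitant \<omega> a u v x) \<phi> = 0"
    by (simp add: omega_n_concomitant_def section_eta dorfman_pair)
  show "snd (omega_n_concomitant \<omega> a u v x) \<phi> = 0"
    using br(2,3)[of u v x \<phi>] f x \<phi>
    by (simp add: omega_n_concomitant_def section_eta dorfman_pair dual_endo_field_def dual_endo_def matrix_linear)
      (simp add: sharp_def contract_def algebra_simps)
qed

lemma concurrence: "complex_dirac M D \<longleftrightarrow> PN_structure M \<pi> a \<and> omega_N_structure M \<omega> a"
proof -
  have "complex_dirac M D \<longleftrightarrow> closed_two_form M \<omega>"
    using D_lagrangian D_subbundle weak_concurrence by (simp add: complex_dirac_def)
  moreover have "nijenhuis M a" if "closed_two_form M \<omega>"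
    using omega_n_structure[OF that] by (simp add: omega_N_structure_def)
  ultimately show ?thesis
    using pn_structure omega_n_structure by (auto simp: omega_N_structure_def)
qed

end

theorem theoremF:
  fixes M :: "('m, 'n::finite) manifold"
    and L :: "('m \<times> ('m, 'n, complex) gcomps) set"
    and a \<pi> \<omega> :: "'m \<Rightarrow> ('m, 'n, real) mcomps"
  assumes "smooth_manifold M"
    and "generalized_complex M L"
    and "endomorphism_field M a" and "bivector_field M \<pi>" and "two_form M \<omega>"
    and "L = eigen_family M (block_endo a \<pi> \<omega>)"
  shows "L \<star> reverse (conj_family L) = graph_bivector M (complex_multiple (1 / (2 * \<i>)) \<pi>) \<and>
    L \<circledast> reverse (conj_family L) = graph_two_form M (complex_multiple (1 / (2 * \<i>)) \<omega>) \<and>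
    (concur_weakly M L (conj_family L) \<longleftrightarrow> closed_two_form M \<omega>) \<and>
    (concur M L (conj_family L) \<longleftrightarrow> PN_structure M \<pi> a \<and> omega_N_structure M \<omega> a)"
proof -
  interpret generalized_complex_blocks M L a \<pi> \<omega>
    by unfold_locales (use assms in blast)+
  show ?thesis
    unfolding concur_weakly_def concur_def
    using tangent_product_eq cotangent_product_eq weak_concurrence concurrence by blast
qed

end
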